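(* Let $V$ be a grading-restricted vertex algebra, let $g_1$ and $g_2$ be commuting automorphisms of $V$ (possibly of infinite order and possibly not acting semisimply on $V$), and let $W_1$ and $W_2$ be lower-bounded generalized $g_1$- and $g_2$-twisted $V$-modules, respectively. Then for every generalized surjective product $W_3$ of $W_1$ and $W_2$ (that is, every generalized $g_1g_2$-twisted $V$-module $W_3$ for which there exists a surjective twisted intertwining operator of type $\binom{W_3}{W_1W_2}$) and all integers $p,q\ge 2$, $$\dim\bigl(W_3/C_{\min(p,q)}(W_3)\bigr)\le \dim\bigl(W_1/C_p(W_1)\bigr)\,\dim\bigl(W_2/C_q(W_2)\bigr).$$
   Context: Dimensions are regarded as elements of $\mathbb N\cup\{\infty\}$ (with $0\cdot\infty=0$). All vector spaces are over $\mathbb C$. **Vertex algebra and automorphisms.** A grading-restricted vertex algebra is a $\mathbb Z$-graded space $V=\coprod_{n\in\mathbb Z}V_{(n)}$ with $\dim V_{(n)}<\infty$, $V_{(n)}=0$ for $n$ sufficiently negative, a vertex operator map $Y_V:V\otimes V\to V((x))$, a vacuum $\mathbf 1\in V_{(0)}$, and operators $L_V(0)$ (acting as $n$ on $V_{(n)}$) and $L_V(-1)$, satisfying the usual vacuum and creation properties, the Jacobi identity, $[L_V(0),Y_V(v,x)]=x\frac{d}{dx}Y_V(v,x)+Y_V(L_V(0)v,x)$ and $\frac{d}{dx}Y_V(v,x)=Y_V(L_V(-1)v,x)=[L_V(-1),Y_V(v,x)]$. Put $V_+=\coprod_{n\ge1}V_{(n)}$. Automorphisms of $V$ are linear automorphisms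 preserving $Y_V$, $\mathbf 1$ and commuting with $L_V(0),L_V(-1)$. For an automorphism $g$, $P_V^g=\{\alpha\in\mathbb C: \Re(\alpha)\in[0,1),\ e^{2\pi \mathrm i\alpha}\text{ is an eigenvalue of }g\}$, $V^{[\alpha]}$ is the generalized eigenspace of $g$ with eigenvalue $e^{2\pi\mathrm i\alpha}$, so $V=\coprod_{\alpha\in P_V^g}V^{[\alpha]}$; $V_+^{[\alpha]}=V^{[\alpha]}\cap V_+$. Write $g=e^{2\pi\mathrm i\mathcal L_g}$, $\mathcal L_g=\mathcal S_g+\mathcal N_g$, where $\mathcal S_g$ acts as $\alpha$ on $V^{[\alpha]}$ and $\mathcal N_g$ is the locally nilpotent operator commuting with $\mathcal S_g$. For formal expressions, $y^{\mathcal L_g}v=y^{\alpha}e^{(\log y)\mathcal N_g}v$ for $v\in V^{[\alpha]}$, where powers and logarithms of $x_1-x_2$, $x_2-x_1$, $x_2+x_0$ are expanded in nonnegative powers of the second variable (e.g. $\log(x_2+x_0)=\log x_2+\log(1+x_0x_2^{-1})$), and $\log$ of a quotient is the difference of logs. $\delta(x)=\sum_{n\in\mathbb Z}x^n$. **Twisted modules.** A weak $g$-twisted $V$-module is a vector space $W$ with operators $L_W(0),L_W(-1)$ and a linear map $Y_W:V\otimes W\to W\{x\}[\log x]$ ($W\{x\}$: formal series with arbitrary complex powers), $Y_W(v,x)w=\sum_{n\in\mathbb C}\sum_{k\in\mathbb N}v_{n,k}w\,x^{-n-1}(\log x)^k$, such that: (1) for $v\in V,w\in W$, $v_{n,k}w=0$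 for $\Re(n)$ sufficiently large; (2) equivariance: $Y_W^{p+1}(gv,z)w=Y_W^p(v,z)w$ for $p\in\mathbb Z$, $z\in\mathbb C^\times$, where $Y_W^p(v,z)$ is obtained by substituting $x^n\mapsto e^{nl_p(z)}$, $\log x\mapsto l_p(z)=\log|z|+\mathrm i\arg z+2\pi\mathrm ip$, $0\le\arg z<2\pi$ (equivalently, formally, substituting $\log x\mapsto\log x+2\pi\mathrm i$, $x^n\mapsto e^{2\pi\mathrm in}x^n$ in $Y_W(gv,x)w$ gives $Y_W(v,x)w$); (3) $Y_W(\mathbf 1,x)w=w$; (4) Jacobi identity $$x_0^{-1}\delta\Bigl(\tfrac{x_1-x_2}{x_0}\Bigr)Y_W(u,x_1)Y_W(v,x_2)-x_0^{-1}\delta\Bigl(\tfrac{-x_2+x_1}{x_0}\Bigr)Y_W(v,x_2)Y_W(u,x_1)=x_1^{-1}\delta\Bigl(\tfrac{x_2+x_0}{x_1}\Bigr)Y_W\Bigl(Y_V\bigl(\bigl(\tfrac{x_2+x_0}{x_1}\bigr)^{\mathcal L_g}u,x_0\bigr)v,x_2\Bigr);$$ (5) $[L_W(0),Y_W(v,x)]=x\frac{d}{dx}Y_W(v,x)+Y_W(L_V(0)v,x)$; (6) $\frac{d}{dx}Y_W(v,x)=Y_W(L_V(-1)v,x)=[L_W(-1),Y_W(v,x)]$. Write $v_n=v_{n,0}$. No action of $g$ on $W$ is required. A generalized $g$-twisted $V$-module is a weak one with a grading $W=\coprod_{n\in\mathbb C}W_{[n]}$ such that each $w\in W_{[n]}$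 satisfies $(L_W(0)-n)^Kw=0$ for some $K\in\mathbb Z_+$. It is lower-bounded if for some $N\in\mathbb Z$, $W_{[n]}=0$ whenever $\Re(n)<N$. **$C_n$-subspaces.** For an integer $n\ge2$ and a weak $g$-twisted module $W$, $C_n(W)$ is the span of all $u_{\alpha-n}w$ with $\alpha\in P_V^g$, $u\in V_+^{[\alpha]}$, $w\in W$. **Twisted intertwining operators.** For commuting automorphisms $g_1,g_2$ and weak $g_1$-, $g_2$-, $g_1g_2$-twisted modules $W_1,W_2,W_3$, a twisted intertwining operator of type $\binom{W_3}{W_1W_2}$ is a linear map $\mathcal Y:W_1\otimes W_2\to W_3\{x\}[\log x]$, $\mathcal Y(w_1,x)w_2=\sum_{k=0}^K\sum_{n\in\mathbb C}\mathcal Y_{n,k}(w_1)w_2\,x^{-n-1}(\log x)^k$, such that: $\mathcal Y_{n,k}(w_1)w_2=0$ for $\Re(n)$ sufficiently large; for $v\in V$, $w_1\in W_1$, $$x_0^{-1}\delta\Bigl(\tfrac{x_1-x_2}{x_0}\Bigr)Y_{W_3}\Bigl(\bigl(\tfrac{x_1-x_2}{x_0}\bigr)^{\mathcal L_{g_1}}v,x_1\Bigr)\mathcal Y(w_1,x_2)-x_0^{-1}\delta\Bigl(\tfrac{x_2-x_1}{-x_0}\Bigr)\mathcal Y(w_1,x_2)Y_{W_2}\Bigl(e^{\pi\mathrm i\mathcal L_{g_1}}\bigl(\tfrac{x_2-x_1}{x_0}\bigr)^{\mathcal L_{g_1}}v,x_1\Bigr)$$ $$=x_1^{-1}\delta\Bigl(\tfrac{x_2+x_0}{x_1}\Bigr)\mathcal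 Y\Bigl(Y_{W_1}\bigl(\bigl(\tfrac{x_2+x_0}{x_1}\bigr)^{\mathcal L_{g_2}}v,x_0\bigr)w_1,x_2\Bigr)$$ on $W_2$; $L_{W_3}(0)\mathcal Y(w_1,x)-\mathcal Y(w_1,x)L_{W_2}(0)=x\frac{d}{dx}\mathcal Y(w_1,x)+\mathcal Y(L_{W_1}(0)w_1,x)$; and $\frac{d}{dx}\mathcal Y(w_1,x)=\mathcal Y(L_{W_1}(-1)w_1,x)=L_{W_3}(-1)\mathcal Y(w_1,x)-\mathcal Y(w_1,x)L_{W_2}(-1)$. It is surjective if $W_3$ is spanned by all coefficients $\mathcal Y_{n,k}(w_1)w_2$, $w_1\in W_1$, $w_2\in W_2$. *)

theory Defs
  imports
    Complex_Main
    "HOL-Library.Function_Algebras"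
    "HOL-Library.Product_Plus"
    "HOL-Library.Extended_Nat"
begin

section \<open>Linear algebra\<close>

text \<open>A complex vector space is a type \<open>'a :: ab_group_add\<close> with a scalar multiplication
  satisfying \<^locale>\<open>vector_space\<close>.\<close>

definition is_decomposition ::
  "'i set \<Rightarrow> ('i \<Rightarrow> 'a::ab_group_add set) \<Rightarrow> 'a \<Rightarrow> ('i \<Rightarrow> 'a) \<Rightarrow> bool" where
  "is_decomposition I U v f \<longleftrightarrow>
     finite {i. f i \<noteq> 0} \<and> (\<forall>i\<in>I. f i \<in> U i) \<and> (\<forall>i. i \<notin> I \<longrightarrow> f i = 0) \<and>
     v = (\<Sum>i | f i \<noteq> 0. f i)"

definition is_direct_sum ::
  "(complex \<Rightarrow> 'a::ab_group_add \<Rightarrow> 'a) \<Rightarrow> 'i set \<Rightarrow> ('i \<Rightarrow> 'a set) \<Rightarrow> bool" where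
  "is_direct_sum sc I U \<longleftrightarrow>
     (\<forall>i\<in>I. module.subspace sc (U i)) \<and> (\<forall>v. \<exists>!f. is_decomposition I U v f)"

definition component ::
  "'i set \<Rightarrow> ('i \<Rightarrow> 'a::ab_group_add set) \<Rightarrow> 'a \<Rightarrow> 'i \<Rightarrow> 'a" where
  "component I U v = (THE f. is_decomposition I U v f)"

text \<open>\<open>quotient_dim sc C\<close> is the dimension of the quotient of the whole space by the
  subspace \<open>C\<close>.  The sets \<open>B\<close> are the finite sets of representatives that are mapped injectively
  onto a linearly independent subset of the quotient.\<close>

definition quotient_dim ::
  "(complex \<Rightarrow> 'a::ab_group_add \<Rightarrow> 'a) \<Rightarrow> 'a set \<Rightarrow> enat" where
  "quotient_dim sc C =
     (SUP B \<in> {B. finite B \<and> (\<forall>c. (\<Sum>b\<in>B. sc (c b) b) \<in> C \<longrightarrow> (\<forall>b\<in>B. c b = 0))}.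
        enat (card B))"

section \<open>Formal series\<close>

text \<open>A monomial \<open>(e, l)\<close> stands for the product of the \<open>x\<^bsup>e x\<^esup> (log x)\<^bsup>l x\<^esup>\<close> over the
  three formal variables \<open>x\<close>; monomials are multiplied by adding the exponents.  A formal series
  is its coefficient function, with no condition on the support.\<close>

datatype fvar = X0 | X1 | X2

type_synonym monomial = "(fvar \<Rightarrow> complex) \<times> (fvar \<Rightarrow> nat)"
type_synonym 'a series = "monomial \<Rightarrow> 'a"

definition xpow :: "fvar \<Rightarrow> complex \<Rightarrow> monomial" where
  "xpow x a = (0(x := a), 0)"

definition logpow :: "fvar \<Rightarrow> nat \<Rightarrow> monomial" where
  "logpow x k = (0, 0(x := k))"

text \<open>\<open>formal_sum \<mu> c\<close> is the sum of the \<open>c i\<close> times the monomial \<open>\<mu> i\<close> over all \<open>i\<close>.  The sum giving each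
  coefficient must be finite for this to make sense (otherwise the coefficient is 0 by convention);
  the truncation conditions below guarantee this wherever \<open>formal_sum\<close> is used.\<close>

definition formal_sum :: "('i \<Rightarrow> monomial) \<Rightarrow> ('i \<Rightarrow> 'a::comm_monoid_add) \<Rightarrow> 'a series" where
  "formal_sum \<mu> c = (\<lambda>m. \<Sum>i | \<mu> i = m \<and> c i \<noteq> 0. c i)"

definition single :: "monomial \<Rightarrow> complex series" where
  "single a = (\<lambda>m. if m = a then 1 else 0)"

definition smul ::
  "(complex \<Rightarrow> 'a::ab_group_add \<Rightarrow> 'a) \<Rightarrow> complex series \<Rightarrow> 'a series \<Rightarrow> 'a series" where
  "smul sc f F = formal_sum (\<lambda>(a, b). a + b) (\<lambda>(a, b). sc (f a) (F b))"

definition series_power :: "complex series \<Rightarrow> nat \<Rightarrow> complex series" where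
  "series_power f k = (smul (*) f ^^ k) (single 0)"

text \<open>\<open>F \<odot> S\<close> applies the linear, series-valued map \<open>F\<close> to the coefficients of the series \<open>S\<close>
  and multiplies by the monomials of \<open>S\<close>.\<close>

definition series_apply ::
  "('a \<Rightarrow> 'b::ab_group_add series) \<Rightarrow> 'a series \<Rightarrow> 'b series" (infixr \<open>\<odot>\<close> 75) where
  "F \<odot> S = formal_sum (\<lambda>(a, b). a + b) (\<lambda>(a, b). F (S a) b)"

text \<open>The derivative with respect to \<open>x\<close>, where \<open>log x\<close> has derivative \<open>x\<^bsup>-1\<^esup>\<close>.\<close>

definition fderiv ::
  "(complex \<Rightarrow> 'a::ab_group_add \<Rightarrow> 'a) \<Rightarrow> fvar \<Rightarrow> 'a series \<Rightarrow> 'a series" where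
  "fderiv sc x F = (\<lambda>(e, l).
     sc (e x + 1) (F (e(x := e x + 1), l)) +
     sc (of_nat (l x + 1)) (F (e(x := e x + 1), l(x := l x + 1))))"

text \<open>The substitution of \<open>log x + 2\<pi>\<i>\<close> for \<open>log x\<close> and \<open>e\<^bsup>2\<pi>\<i>n\<^esup>x\<^bsup>n\<^esup>\<close> for \<open>x\<^bsup>n\<^esup>\<close>.\<close>

definition monodromy ::
  "(complex \<Rightarrow> 'a::ab_group_add \<Rightarrow> 'a) \<Rightarrow> fvar \<Rightarrow> 'a series \<Rightarrow> 'a series" where
  "monodromy sc x F = (\<lambda>(e, l).
     \<Sum>j | l x \<le> j \<and> F (e, l(x := j)) \<noteq> 0.
       sc (exp (2 * pi * \<i> * e x) * of_nat (j choose l x) * (2 * pi * \<i>) ^ (j - l x))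
          (F (e, l(x := j))))"

text \<open>In the following three definitions \<open>\<epsilon>\<close> and \<open>\<eta>\<close> are signs, and \<open>y + \<epsilon> z\<close> is always expanded in
  nonnegative powers of \<open>z\<close>:
  \<^item> \<open>binomial_series y \<epsilon> z a\<close> is \<open>(y + \<epsilon> z)\<^bsup>a\<^esup>\<close>,
  \<^item> \<open>log_quotient y \<epsilon> z x\<close> is \<open>log ((y + \<epsilon> z) / x)\<close>,
  \<^item> \<open>delta y \<epsilon> z \<eta> x\<close> is \<open>x\<^bsup>-1\<^esup> \<delta>((y + \<epsilon> z) / (\<eta> x))\<close>.\<close>

definition binomial_series :: "fvar \<Rightarrow> complex \<Rightarrow> fvar \<Rightarrow> complex \<Rightarrow> complex series" where
  "binomial_series y \<epsilon> z a =
     formal_sum (\<lambda>i::nat. xpow y (a - of_nat i) + xpow z (of_nat i)) (\<lambda>i. (a gchoose i) * \<epsilon> ^ i)"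

definition log_quotient :: "fvar \<Rightarrow> complex \<Rightarrow> fvar \<Rightarrow> fvar \<Rightarrow> complex series" where
  "log_quotient y \<epsilon> z x =
     single (logpow y 1)
     + formal_sum (\<lambda>i::nat. xpow y (- of_nat (Suc i)) + xpow z (of_nat (Suc i)))
         (\<lambda>i. (-1) ^ i * \<epsilon> ^ Suc i / of_nat (Suc i))
     - single (logpow x 1)"

definition delta :: "fvar \<Rightarrow> complex \<Rightarrow> fvar \<Rightarrow> complex \<Rightarrow> fvar \<Rightarrow> complex series" where
  "delta y \<epsilon> z \<eta> x =
     formal_sum
       (\<lambda>(n::int, i::nat). xpow x (- of_int n - 1) + xpow y (of_int n - of_nat i) + xpow z (of_nat i))
       (\<lambda>(n, i). \<eta> powi (- n) * (of_int n gchoose i) * \<epsilon> ^ i)"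

section \<open>Grading-restricted vertex algebras\<close>

text \<open>\<open>vmode V u n v\<close> is \<open>u\<^sub>n v\<close>, the coefficient of \<open>x\<^bsup>-n-1\<^esup>\<close> in \<open>Y\<^sub>V(u, x)v\<close>.\<close>

record 'v vertex_algebra =
  vscale :: "complex \<Rightarrow> 'v \<Rightarrow> 'v"
  vgrade :: "int \<Rightarrow> 'v set"
  vmode :: "'v \<Rightarrow> int \<Rightarrow> 'v \<Rightarrow> 'v"
  vacuum :: 'v
  LV0 :: "'v \<Rightarrow> 'v"
  LV_neg1 :: "'v \<Rightarrow> 'v"

definition YV :: "'v::ab_group_add vertex_algebra \<Rightarrow> 'v \<Rightarrow> fvar \<Rightarrow> 'v \<Rightarrow> 'v series" where
  "YV V u x v = formal_sum (\<lambda>n::int. xpow x (- of_int n - 1)) (\<lambda>n. vmode V u n v)"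

locale grading_restricted_vertex_algebra =
  fixes V :: "'v::ab_group_add vertex_algebra"
  assumes vector_space: "vector_space (vscale V)"
    and grading: "is_direct_sum (vscale V) UNIV (vgrade V)"
    and grade_finite_dim: "\<exists>B. finite B \<and> vgrade V n \<subseteq> module.span (vscale V) B"
    and grade_bounded_below: "\<exists>N. \<forall>n<N. vgrade V n = {0}"
    and mode_linear_left: "Vector_Spaces.linear (vscale V) (vscale V) (\<lambda>u. vmode V u n v)"
    and mode_linear_right: "Vector_Spaces.linear (vscale V) (vscale V) (vmode V u n)"
    and mode_truncation: "\<exists>N. \<forall>n\<ge>N. vmode V u n v = 0"
    and vacuum_grade: "vacuum V \<in> vgrade V 0"
    and L0_linear: "Vector_Spaces.linear (vscale V) (vscale V) (LV0 V)"
    and L0_grade: "v \<in> vgrade V n \<Longrightarrow> LV0 V v = vscale V (of_int n) v"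
    and L_neg1_linear: "Vector_Spaces.linear (vscale V) (vscale V) (LV_neg1 V)"
    and vacuum_property: "vmode V (vacuum V) n v = (if n = -1 then v else 0)"
    and creation_regular: "n \<ge> 0 \<Longrightarrow> vmode V v n (vacuum V) = 0"
    and creation_value: "vmode V v (-1) (vacuum V) = v"
    and jacobi:
      "smul (vscale V) (delta X1 (-1) X2 1 X0) (YV V u X1 \<odot> YV V v X2 w)
       - smul (vscale V) (delta X2 (-1) X1 (-1) X0) (YV V v X2 \<odot> YV V u X1 w)
       = smul (vscale V) (delta X2 1 X0 1 X1) ((\<lambda>v'. YV V v' X2 w) \<odot> YV V u X0 v)"
    and L0_commutator:
      "(\<lambda>m. LV0 V (YV V v x w m)) - YV V v x (LV0 V w)
       = smul (vscale V) (single (xpow x 1)) (fderiv (vscale V) x (YV V v x w))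
         + YV V (LV0 V v) x w"
    and L_neg1_derivative: "fderiv (vscale V) x (YV V v x w) = YV V (LV_neg1 V v) x w"
    and L_neg1_commutator:
      "(\<lambda>m. LV_neg1 V (YV V v x w m)) - YV V v x (LV_neg1 V w) = YV V (LV_neg1 V v) x w"

definition V_plus :: "'v::ab_group_add vertex_algebra \<Rightarrow> 'v set" where
  "V_plus V = module.span (vscale V) (\<Union>n\<in>{1..}. vgrade V n)"

section \<open>Automorphisms\<close>

locale vertex_algebra_automorphism = grading_restricted_vertex_algebra V
  for V :: "'v::ab_group_add vertex_algebra" +
  fixes g :: "'v \<Rightarrow> 'v"
  assumes aut_linear: "Vector_Spaces.linear (vscale V) (vscale V) g"
    and aut_bij: "bij g"
    and aut_mode: "g (vmode V u n v) = vmode V (g u) n (g v)"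
    and aut_vacuum: "g (vacuum V) = vacuum V"
    and aut_L0: "g (LV0 V v) = LV0 V (g v)"
    and aut_L_neg1: "g (LV_neg1 V v) = LV_neg1 V (g v)"

definition spectrum_exponents ::
  "'v::ab_group_add vertex_algebra \<Rightarrow> ('v \<Rightarrow> 'v) \<Rightarrow> complex set" where
  "spectrum_exponents V g =
     {\<alpha>. 0 \<le> Re \<alpha> \<and> Re \<alpha> < 1 \<and> (\<exists>v. v \<noteq> 0 \<and> g v = vscale V (exp (2 * pi * \<i> * \<alpha>)) v)}"

definition gen_eigenspace ::
  "'v::ab_group_add vertex_algebra \<Rightarrow> ('v \<Rightarrow> 'v) \<Rightarrow> complex \<Rightarrow> 'v set" where
  "gen_eigenspace V g \<alpha> =
     {v. \<exists>k. ((\<lambda>u. g u - vscale V (exp (2 * pi * \<i> * \<alpha>)) u) ^^ k) v = 0}"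

definition eigencomponent ::
  "'v::ab_group_add vertex_algebra \<Rightarrow> ('v \<Rightarrow> 'v) \<Rightarrow> 'v \<Rightarrow> complex \<Rightarrow> 'v" where
  "eigencomponent V g = component (spectrum_exponents V g) (gen_eigenspace V g)"

definition semisimple_part ::
  "'v::ab_group_add vertex_algebra \<Rightarrow> ('v \<Rightarrow> 'v) \<Rightarrow> 'v \<Rightarrow> 'v" where
  "semisimple_part V g v =
     (\<Sum>\<alpha> | eigencomponent V g v \<alpha> \<noteq> 0. vscale V \<alpha> (eigencomponent V g v \<alpha>))"

text \<open>\<open>exp_SN V g N c v\<close> is \<open>e\<^bsup>c(S + N)\<^esup>v\<close>, with \<open>S\<close> the semisimple part attached to \<open>g\<close> and \<open>N\<close> a
  locally nilpotent operator commuting with \<open>S\<close>.\<close>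

definition exp_SN ::
  "'v::ab_group_add vertex_algebra \<Rightarrow> ('v \<Rightarrow> 'v) \<Rightarrow> ('v \<Rightarrow> 'v) \<Rightarrow> complex \<Rightarrow> 'v \<Rightarrow> 'v" where
  "exp_SN V g N c v =
     (\<Sum>(\<alpha>, k) | (N ^^ k) (eigencomponent V g v \<alpha>) \<noteq> 0.
        vscale V (exp (c * \<alpha>) * c ^ k / fact k) ((N ^^ k) (eigencomponent V g v \<alpha>)))"

text \<open>For an automorphism \<open>g\<close> there is exactly one such operator, so the choice is immaterial.\<close>

definition nilpotent_part ::
  "'v::ab_group_add vertex_algebra \<Rightarrow> ('v \<Rightarrow> 'v) \<Rightarrow> 'v \<Rightarrow> 'v" where
  "nilpotent_part V g =
     (SOME N. Vector_Spaces.linear (vscale V) (vscale V) N \<and>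
        (\<forall>v. \<exists>k. (N ^^ k) v = 0) \<and>
        (\<forall>v. N (semisimple_part V g v) = semisimple_part V g (N v)) \<and>
        (\<forall>v. g v = exp_SN V g N (2 * pi * \<i>) v))"

definition exp_L ::
  "'v::ab_group_add vertex_algebra \<Rightarrow> ('v \<Rightarrow> 'v) \<Rightarrow> complex \<Rightarrow> 'v \<Rightarrow> 'v" where
  "exp_L V g = exp_SN V g (nilpotent_part V g)"

text \<open>\<open>quotient_pow_L V g y \<epsilon> z x v\<close> is \<open>((y + \<epsilon> z) / x)\<^bsup>L\<^esup>v\<close> with \<open>L = \<L>\<^sub>g\<close>: on a generalized
  eigenvector \<open>v\<close> of exponent \<open>\<alpha>\<close> it is
  \<open>(y + \<epsilon> z)\<^bsup>\<alpha>\<^esup> x\<^bsup>-\<alpha>\<^esup>\<close> times the sum of the \<open>(log ((y + \<epsilon> z) / x))\<^bsup>k\<^esup> N\<^bsup>k\<^esup> v / k!\<close>.\<close>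

definition quotient_pow_L ::
  "'v::ab_group_add vertex_algebra \<Rightarrow> ('v \<Rightarrow> 'v) \<Rightarrow>
   fvar \<Rightarrow> complex \<Rightarrow> fvar \<Rightarrow> fvar \<Rightarrow> 'v \<Rightarrow> 'v series" where
  "quotient_pow_L V g y \<epsilon> z x v = (\<lambda>m.
     let N = nilpotent_part V g in
     \<Sum>(\<alpha>, k) | (N ^^ k) (eigencomponent V g v \<alpha>) \<noteq> 0.
       vscale V
         (smul (*) (smul (*) (binomial_series y \<epsilon> z \<alpha>) (single (xpow x (- \<alpha>))))
            (series_power (log_quotient y \<epsilon> z x) k) m / fact k)
         ((N ^^ k) (eigencomponent V g v \<alpha>)))"

section \<open>Twisted modules\<close>

text \<open>\<open>wmode W v n k w\<close> is \<open>v\<^bsub>n,k\<^esub>w\<close>, the coefficient of \<open>x\<^bsup>-n-1\<^esup>(log x)\<^bsup>k\<^esup>\<close> in \<open>Y\<^sub>W(v, x)w\<close>.\<close>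

record ('v, 'w) twisted_module =
  wscale :: "complex \<Rightarrow> 'w \<Rightarrow> 'w"
  wmode :: "'v \<Rightarrow> complex \<Rightarrow> nat \<Rightarrow> 'w \<Rightarrow> 'w"
  LW0 :: "'w \<Rightarrow> 'w"
  LW_neg1 :: "'w \<Rightarrow> 'w"

record ('v, 'w) graded_twisted_module = "('v, 'w) twisted_module" +
  wgrade :: "complex \<Rightarrow> 'w set"

definition log_series ::
  "(complex \<Rightarrow> nat \<Rightarrow> 'a::ab_group_add) \<Rightarrow> fvar \<Rightarrow> 'a series" where
  "log_series c x = formal_sum (\<lambda>(n, k). xpow x (- n - 1) + logpow x k) (\<lambda>(n, k). c n k)"

definition YW ::
  "('v, 'w::ab_group_add, 'z) twisted_module_scheme \<Rightarrow> 'v \<Rightarrow> fvar \<Rightarrow> 'w \<Rightarrow> 'w series" where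
  "YW W v x w = log_series (\<lambda>n k. wmode W v n k w) x"

locale weak_twisted_module = vertex_algebra_automorphism V g
  for V :: "'v::ab_group_add vertex_algebra" and g :: "'v \<Rightarrow> 'v" +
  fixes W :: "('v, 'w::ab_group_add, 'z) twisted_module_scheme"
  assumes W_vector_space: "vector_space (wscale W)"
    and LW0_linear: "Vector_Spaces.linear (wscale W) (wscale W) (LW0 W)"
    and LW_neg1_linear: "Vector_Spaces.linear (wscale W) (wscale W) (LW_neg1 W)"
    and W_mode_linear_left:
      "Vector_Spaces.linear (vscale V) (wscale W) (\<lambda>v. wmode W v n k w)"
    and W_mode_linear_right: "Vector_Spaces.linear (wscale W) (wscale W) (wmode W v n k)"
    and W_log_polynomial: "\<exists>K. \<forall>k>K. \<forall>n. wmode W v n k w = 0"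
    and W_truncation: "\<exists>N::real. \<forall>n k. Re n \<ge> N \<longrightarrow> wmode W v n k w = 0"
    and W_equivariance: "monodromy (wscale W) x (YW W (g v) x w) = YW W v x w"
    and W_vacuum: "wmode W (vacuum V) n k w = (if n = -1 \<and> k = 0 then w else 0)"
    and W_jacobi:
      "smul (wscale W) (delta X1 (-1) X2 1 X0) (YW W u X1 \<odot> YW W v X2 w)
       - smul (wscale W) (delta X2 (-1) X1 (-1) X0) (YW W v X2 \<odot> YW W u X1 w)
       = smul (wscale W) (delta X2 1 X0 1 X1)
           ((\<lambda>v'. YW W v' X2 w) \<odot> (\<lambda>u'. YV V u' X0 v) \<odot> quotient_pow_L V g X2 1 X0 X1 u)"
    and W_L0_commutator:
      "(\<lambda>m. LW0 W (YW W v x w m)) - YW W v x (LW0 W w)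
       = smul (wscale W) (single (xpow x 1)) (fderiv (wscale W) x (YW W v x w))
         + YW W (LV0 V v) x w"
    and W_L_neg1_derivative: "fderiv (wscale W) x (YW W v x w) = YW W (LV_neg1 V v) x w"
    and W_L_neg1_commutator:
      "(\<lambda>m. LW_neg1 W (YW W v x w m)) - YW W v x (LW_neg1 W w) = YW W (LV_neg1 V v) x w"

locale generalized_twisted_module = weak_twisted_module V g W
  for V :: "'v::ab_group_add vertex_algebra" and g :: "'v \<Rightarrow> 'v"
    and W :: "('v, 'w::ab_group_add) graded_twisted_module" +
  assumes W_grading: "is_direct_sum (wscale W) UNIV (wgrade W)"
    and W_grade_L0:
      "w \<in> wgrade W n \<Longrightarrow> \<exists>K>0. ((\<lambda>w. LW0 W w - wscale W n w) ^^ K) w = 0"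

locale lower_bounded_generalized_twisted_module = generalized_twisted_module V g W
  for V :: "'v::ab_group_add vertex_algebra" and g :: "'v \<Rightarrow> 'v"
    and W :: "('v, 'w::ab_group_add) graded_twisted_module" +
  assumes W_lower_bounded: "\<exists>N::int. \<forall>n. Re n < of_int N \<longrightarrow> wgrade W n = {0}"

definition C_subspace ::
  "'v::ab_group_add vertex_algebra \<Rightarrow> ('v \<Rightarrow> 'v) \<Rightarrow>
   ('v, 'w::ab_group_add, 'z) twisted_module_scheme \<Rightarrow> int \<Rightarrow> 'w set" where
  "C_subspace V g W n = module.span (wscale W)
     {wmode W u (\<alpha> - of_int n) 0 w | \<alpha> u w.
        \<alpha> \<in> spectrum_exponents V g \<and> u \<in> gen_eigenspace V g \<alpha> \<inter> V_plus V}"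

section \<open>Twisted intertwining operators\<close>

text \<open>\<open>I w1 n k w2\<close> is the coefficient of \<open>x\<^bsup>-n-1\<^esup>(log x)\<^bsup>k\<^esup>\<close> in the intertwining operator applied
  to \<open>w1\<close> and \<open>w2\<close>.\<close>

definition YI ::
  "('w1 \<Rightarrow> complex \<Rightarrow> nat \<Rightarrow> 'w2 \<Rightarrow> 'w3::ab_group_add) \<Rightarrow> 'w1 \<Rightarrow> fvar \<Rightarrow> 'w2 \<Rightarrow> 'w3 series" where
  "YI I w1 x w2 = log_series (\<lambda>n k. I w1 n k w2) x"

locale twisted_intertwining_operator =
  M1: weak_twisted_module V g1 W1 + M2: weak_twisted_module V g2 W2 +
  M3: weak_twisted_module V "g1 \<circ> g2" W3
  for V :: "'v::ab_group_add vertex_algebra" and g1 g2 :: "'v \<Rightarrow> 'v"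
    and W1 :: "('v, 'w1::ab_group_add, 'z1) twisted_module_scheme"
    and W2 :: "('v, 'w2::ab_group_add, 'z2) twisted_module_scheme"
    and W3 :: "('v, 'w3::ab_group_add, 'z3) twisted_module_scheme" +
  fixes I :: "'w1 \<Rightarrow> complex \<Rightarrow> nat \<Rightarrow> 'w2 \<Rightarrow> 'w3"
  assumes commuting: "g1 \<circ> g2 = g2 \<circ> g1"
    and I_linear_left: "Vector_Spaces.linear (wscale W1) (wscale W3) (\<lambda>w1. I w1 n k w2)"
    and I_linear_right: "Vector_Spaces.linear (wscale W2) (wscale W3) (I w1 n k)"
    and I_log_polynomial: "\<exists>K. \<forall>k>K. \<forall>n. I w1 n k w2 = 0"
    and I_truncation: "\<exists>N::real. \<forall>n k. Re n \<ge> N \<longrightarrow> I w1 n k w2 = 0"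
    and I_jacobi:
      "smul (wscale W3) (delta X1 (-1) X2 1 X0)
         ((\<lambda>v'. YW W3 v' X1 \<odot> YI I w1 X2 w2) \<odot> quotient_pow_L V g1 X1 (-1) X2 X0 v)
       - smul (wscale W3) (delta X2 (-1) X1 (-1) X0)
         ((\<lambda>v'. YI I w1 X2 \<odot> YW W2 v' X1 w2) \<odot>
            (\<lambda>m. exp_L V g1 (pi * \<i>) (quotient_pow_L V g1 X2 (-1) X1 X0 v m)))
       = smul (wscale W3) (delta X2 1 X0 1 X1)
         ((\<lambda>w'. YI I w' X2 w2) \<odot> (\<lambda>v'. YW W1 v' X0 w1) \<odot> quotient_pow_L V g2 X2 1 X0 X1 v)"
    and I_L0_commutator:
      "(\<lambda>m. LW0 W3 (YI I w1 x w2 m)) - YI I w1 x (LW0 W2 w2)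
       = smul (wscale W3) (single (xpow x 1)) (fderiv (wscale W3) x (YI I w1 x w2))
         + YI I (LW0 W1 w1) x w2"
    and I_L_neg1_derivative: "fderiv (wscale W3) x (YI I w1 x w2) = YI I (LW_neg1 W1 w1) x w2"
    and I_L_neg1_commutator:
      "YI I (LW_neg1 W1 w1) x w2
       = (\<lambda>m. LW_neg1 W3 (YI I w1 x w2 m)) - YI I w1 x (LW_neg1 W2 w2)"

definition surjective_operator ::
  "(complex \<Rightarrow> 'w3 \<Rightarrow> 'w3) \<Rightarrow> ('w1 \<Rightarrow> complex \<Rightarrow> nat \<Rightarrow> 'w2 \<Rightarrow> 'w3::ab_group_add) \<Rightarrow> bool" where
  "surjective_operator sc I \<longleftrightarrow> module.span sc {I w1 n k w2 | w1 n k w2. True} = UNIV"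

definition generalized_surjective_product ::
  "'v::ab_group_add vertex_algebra \<Rightarrow> ('v \<Rightarrow> 'v) \<Rightarrow> ('v \<Rightarrow> 'v) \<Rightarrow>
   ('v, 'w1::ab_group_add, 'z1) twisted_module_scheme \<Rightarrow>
   ('v, 'w2::ab_group_add, 'z2) twisted_module_scheme \<Rightarrow>
   ('v, 'w3::ab_group_add) graded_twisted_module \<Rightarrow> bool" where
  "generalized_surjective_product V g1 g2 W1 W2 W3 \<longleftrightarrow>
     generalized_twisted_module V (g1 \<circ> g2) W3 \<and>
     (\<exists>I. twisted_intertwining_operator V g1 g2 W1 W2 W3 I \<and> surjective_operator (wscale W3) I)"

end

theory Submission
  imports Defs "HOL-Computational_Algebra.Formal_Power_Series"
    "HOL-Computational_Algebra.Fundamental_Theorem_Algebra"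
begin

text \<open>On homogeneous vectors, evaluate an intertwining operator at \<open>x = 1\<close>, \<open>log x = 0\<close>; the result
  \<open>T(w\<^sub>1, w\<^sub>2)\<close> is a family with one component in each weight space of \<open>W\<^sub>3\<close>.  For a joint generalized
  eigenvector \<open>v\<close> of \<open>g\<^sub>1\<close> and \<open>g\<^sub>2\<close>, the logarithm-free coefficients of the Jacobi identity express
  \<open>T(v\<^bsub>\<alpha>-p\<^esub> w\<^sub>1, w\<^sub>2)\<close> and \<open>T(w\<^sub>1, v\<^bsub>\<beta>-q\<^esub> w\<^sub>2)\<close>, modulo families with values in \<open>C\<^bsub>min(p,q)\<^esub>(W\<^sub>3)\<close>, by values
  of \<open>T\<close> of lower total weight.  Hence, if \<open>A\<close> and \<open>B\<close> are homogeneous bases of \<open>W\<^sub>1\<close> and \<open>W\<^sub>2\<close> modulo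
  \<open>C\<^sub>p\<close> and \<open>C\<^sub>q\<close>, then all values of \<open>T\<close> lie in the span of the \<open>T(a, b)\<close> modulo such families.  Since
  \<open>L(0) T(w\<^sub>1, w\<^sub>2)\<close> is again a sum of values of \<open>T\<close>, the span of the values is stable under \<open>L(0)\<close>, so the
  components at finitely many weights can be separated; by surjectivity, every element of
  \<open>W\<^sub>3 / C\<^bsub>min(p,q)\<^esub>(W\<^sub>3)\<close> is then accounted for by the \<open>T(a, b)\<close>.\<close>

section \<open>Generalized eigenspaces\<close>

text \<open>The bound contains no factor for the number of weights of \<open>W3\<close>, although a
  pair \<open>(w1, w2)\<close> yields coefficients in possibly infinitely many weight spaces. Hence
  values are families and not vectors: one relation, read off at all exponents of the third
  variable, treats every weight component with the same scalars. The logarithm-free part of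
  \<open>((x2 + x0) / x1)^L v\<close> starts with \<open>v\<close> itself, so the leading terms are
  pure modes of \<open>v\<close> even if the automorphisms are not semisimple. The modes acting on
  \<open>W3\<close> have indices \<alpha> + \<beta> + m + n - k with k \<ge> 0. Since \<alpha> +
  \<beta> may leave the strip 0 \<le> Re < 1, a carry of 0 or 1 is subtracted to get an exponent of
  \<open>g1 \<circ> g2\<close>; taking (m, n) = (-p, -carry) for \<open>W1\<close> and (-carry, -q)
  for \<open>W2\<close> then leaves only the defining modes of \<open>C_p\<close> or
  \<open>C_q\<close> and modes below them. That these lower modes stay in the subspace is less
  immediate with logarithms: differentiation couples the coefficients of consecutive powers of log
  x, and equivariance must control the positive powers.\<close>

definition geig :: "('a::field \<Rightarrow> 'b::ab_group_add \<Rightarrow> 'b) \<Rightarrow> ('b \<Rightarrow> 'b) \<Rightarrow> 'a \<Rightarrow> 'b set" where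
  "geig sc f c = {v. \<exists>k. ((\<lambda>u. f u - sc c u) ^^ k) v = 0}"

lemma (in vector_space) linear_endoI:
  assumes "\<And>x y. h (x + y) = h x + h y" "\<And>c x. h (c *s x) = c *s h x"
  shows "Vector_Spaces.linear scale scale h"
  using assms
  by (intro Vector_Spaces.linear.intro vector_space_axioms module_hom.intro module_hom_axioms.intro
      module_axioms)

lemma (in vector_space) subspace_scaleD:
  assumes "subspace S" "c *s x \<in> S" "c \<noteq> 0" shows "x \<in> S"
  using subspace_scale[OF assms(1,2), of "inverse c"] assms(3) by simp

locale endomorphism = vector_space scale
  for scale :: "'a::field \<Rightarrow> 'b::ab_group_add \<Rightarrow> 'b" (infixr \<open>*s\<close> 75) +
  fixes f :: "'b \<Rightarrow> 'b"
  assumes linear: "Vector_Spaces.linear scale scale f"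
begin

lemma map_add: "f (x + y) = f x + f y"
  and map_scale: "f (c *s x) = c *s f x"
  and map_zero [simp]: "f 0 = 0"
  and map_diff: "f (x - y) = f x - f y"
  and map_sum: "f (sum h A) = (\<Sum>i\<in>A. f (h i))"
proof -
  interpret l: Vector_Spaces.linear scale scale f by (fact linear)
  show "f (x + y) = f x + f y" "f (c *s x) = c *s f x" "f 0 = 0" "f (x - y) = f x - f y"
    "f (sum h A) = (\<Sum>i\<in>A. f (h i))"
    by (fact l.add l.scale l.zero l.diff l.sum)+
qed

lemma linear_funpow: "Vector_Spaces.linear scale scale (f ^^ k)"
proof (induction k)
  case 0
  then show ?case by (simp add: id_def linear_ident)
next
  case (Suc k)
  then show ?case
    using Vector_Spaces.linear_compose[OF Suc linear] by (simp add: o_def)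
qed

abbreviation shift :: "'a \<Rightarrow> 'b \<Rightarrow> 'b" where
  "shift c \<equiv> (\<lambda>u. f u - c *s u)"

lemma linear_shift: "Vector_Spaces.linear scale scale (shift c)"
  by (rule linear_endoI)
    (simp_all add: map_add map_scale algebra_simps scale_right_distrib scale_right_diff_distrib
      scale_left_commute)

lemma endomorphism_shift: "endomorphism scale (shift c)"
  by (intro endomorphism.intro endomorphism_axioms.intro linear_shift vector_space_axioms)

lemma shift_funpow_add: "(shift c ^^ k) (x + y) = (shift c ^^ k) x + (shift c ^^ k) y"
  and shift_funpow_scale: "(shift c ^^ k) (b *s x) = b *s (shift c ^^ k) x"
  and shift_funpow_zero [simp]: "(shift c ^^ k) 0 = 0"
proof -
  interpret s: endomorphism scale "shift c" by (rule endomorphism_shift)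
  interpret l: Vector_Spaces.linear scale scale "shift c ^^ k" by (rule s.linear_funpow)
  show "(shift c ^^ k) (x + y) = (shift c ^^ k) x + (shift c ^^ k) y" by (rule l.add)
  show "(shift c ^^ k) (b *s x) = b *s (shift c ^^ k) x" by (rule l.scale)
  show "(shift c ^^ k) 0 = 0" by (rule l.zero)
qed

lemma shift_funpow_mono: "(shift c ^^ k) x = 0 \<Longrightarrow> k \<le> m \<Longrightarrow> (shift c ^^ m) x = 0"
  using funpow_add[of "m - k" k "shift c"] by simp

lemma subspace_geig: "subspace (geig scale f c)"
proof (rule subspaceI)
  show "0 \<in> geig scale f c"
    by (auto simp: geig_def intro: exI[of _ 0])
next
  fix x y assume "x \<in> geig scale f c" "y \<in> geig scale f c"
  then obtain k m where "(shift c ^^ k) x = 0" "(shift c ^^ m) y = 0"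
    by (auto simp: geig_def)
  then have "(shift c ^^ max k m) x = 0" "(shift c ^^ max k m) y = 0"
    by (auto elim: shift_funpow_mono)
  then have "(shift c ^^ max k m) (x + y) = 0"
    by (simp only: shift_funpow_add add_0_left)
  then show "x + y \<in> geig scale f c" by (auto simp: geig_def)
next
  fix b x assume "x \<in> geig scale f c"
  then show "b *s x \<in> geig scale f c"
    by (force simp: geig_def shift_funpow_scale)
qed

lemma geig_shiftD: "f v - c *s v \<in> geig scale f c \<Longrightarrow> v \<in> geig scale f c"
proof -
  assume "f v - c *s v \<in> geig scale f c"
  then obtain k where "(shift c ^^ k) (shift c v) = 0" by (auto simp: geig_def)
  then have "(shift c ^^ Suc k) v = 0" by (simp only: funpow_Suc_right comp_apply)
  then show ?thesis unfolding geig_def by blast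
qed

lemma geig_commute:
  assumes h: "Vector_Spaces.linear scale scale h" and comm: "\<And>v. h (f v) = f (h v)"
    and v: "v \<in> geig scale f c"
  shows "h v \<in> geig scale f c"
proof -
  interpret h: Vector_Spaces.linear scale scale h by fact
  have "h ((shift c ^^ k) v) = (shift c ^^ k) (h v)" for k
    by (induction k) (simp_all add: h.diff h.scale comm)
  moreover obtain k where "(shift c ^^ k) v = 0" using v by (auto simp: geig_def)
  ultimately have "(shift c ^^ k) (h v) = 0" by (metis h.zero)
  then show ?thesis by (auto simp: geig_def)
qed

lemma geig_self: "v \<in> geig scale f c \<Longrightarrow> f v \<in> geig scale f c"
  by (rule geig_commute[OF linear]) auto

lemma eigenvector_geig: "f v = c *s v \<Longrightarrow> v \<in> geig scale f c"
  unfolding geig_def by (auto intro!: exI[of _ "Suc 0"])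

lemma geig_eigenvector:
  assumes "v \<in> geig scale f c" "v \<noteq> 0"
  obtains u where "u \<noteq> 0" "f u = c *s u"
proof -
  obtain k where "(shift c ^^ k) v = 0" using assms by (auto simp: geig_def)
  then have "\<exists>u. u \<noteq> 0 \<and> f u = c *s u" using assms(2)
  proof (induction k arbitrary: v)
    case (Suc k)
    show ?case
    proof (cases "shift c v = 0")
      case True
      then show ?thesis using Suc.prems by auto
    next
      case False
      then show ?thesis using Suc.IH[of "shift c v"] Suc.prems
        by (simp add: funpow_Suc_right del: funpow.simps)
    qed
  qed simp
  then show ?thesis using that by blast
qed

text \<open>If the sum lies in \<open>Y\<close>, then so does its image under \<open>f - \<lambda>\<^sub>j\<close>, in which the \<open>j\<close>-th summand
  has a lower nilpotency order; hence \<open>Y\<close> contains \<open>(f - \<lambda>\<^sub>j) x\<^sub>i\<close> for all \<open>i\<close> and \<open>j\<close>, and two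
  different \<open>j\<close> give \<open>x\<^sub>i\<close>.\<close>

lemma geig_separation_aux:
  assumes Y: "subspace Y" and fY: "\<And>y. y \<in> Y \<Longrightarrow> f y \<in> Y"
    and I: "finite I" "inj_on lam I"
  shows "\<lbrakk>\<And>i. i \<in> I \<Longrightarrow> (shift (lam i) ^^ K i) (x i) = 0; (\<Sum>i\<in>I. x i) \<in> Y; i \<in> I\<rbrakk> \<Longrightarrow> x i \<in> Y"
proof (induction "\<Sum>i\<in>I. K i" arbitrary: K x i rule: less_induct)
  case less
  have step: "shift (lam j) (x i) \<in> Y" if j: "j \<in> I" "K j > 0" and i: "i \<in> I" for i j
  proof (rule less.hyps[of "K(j := K j - 1)" "\<lambda>i. shift (lam j) (x i)"])
    show "sum (K(j := K j - 1)) I < sum K I"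
      using j I by (intro sum_strict_mono_ex1) auto
    fix i assume i: "i \<in> I"
    show "(shift (lam i) ^^ (K(j := K j - 1)) i) (shift (lam j) (x i)) = 0"
    proof (cases "i = j")
      case True
      then show ?thesis using less.prems(1)[OF i] j
        by (cases "K j") (simp_all add: funpow_Suc_right del: funpow.simps)
    next
      case False
      interpret s: endomorphism scale "shift (lam j)" by (rule endomorphism_shift)
      have swap: "shift a (shift b v) = shift b (shift a v)" for a b v
        by (simp add: map_diff map_scale scale_right_diff_distrib scale_left_commute)
      have comm: "shift (lam j) ((shift (lam i) ^^ m) v) = (shift (lam i) ^^ m) (shift (lam j) v)" for m v
      proof (induction m)
        case (Suc m)
        show ?case
          using swap[where a = "lam j" and b = "lam i" and v = "(shift (lam i) ^^ m) v"] Suc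
          by (simp only: funpow.simps comp_apply)
      qed simp
      have "shift (lam j) ((shift (lam i) ^^ K i) (x i)) = 0"
        unfolding less.prems(1)[OF i] by simp
      moreover have "(K(j := K j - 1)) i = K i" using False by simp
      ultimately show ?thesis unfolding comm by metis
    qed
  next
    have "(\<Sum>i\<in>I. shift (lam j) (x i)) = shift (lam j) (\<Sum>i\<in>I. x i)"
      by (simp add: map_sum scale_sum_right sum_subtractf)
    also have "\<dots> \<in> Y" using Y fY less.prems(2) by (simp add: subspace_diff subspace_scale)
    finally show "(\<Sum>i\<in>I. shift (lam j) (x i)) \<in> Y" .
  qed (use i in auto)
  show ?case
  proof (cases "K i = 0")
    case True
    then show ?thesis using less.prems(1)[OF less.prems(3)] subspace_0[OF Y] by simp
  next
    case Ki: False
    show ?thesis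
    proof (cases "\<exists>j\<in>I. j \<noteq> i \<and> K j > 0")
      case True
      then obtain j where j: "j \<in> I" "j \<noteq> i" "K j > 0" by blast
      have "shift (lam i) (x i) - shift (lam j) (x i) \<in> Y"
        using Ki less.prems(3) j by (intro subspace_diff[OF Y, of "shift _ _" "shift _ _"] step) auto
      moreover have "shift (lam i) (x i) - shift (lam j) (x i) = (lam j - lam i) *s x i"
        by (simp add: scale_left_diff_distrib)
      ultimately have "(lam j - lam i) *s x i \<in> Y" by metis
      moreover have "lam j - lam i \<noteq> 0"
        using I(2) j less.prems(3) by (auto dest: inj_onD)
      ultimately show ?thesis by (rule subspace_scaleD[OF Y])
    next
      case False
      then have "x j = 0" if "j \<in> I - {i}" for j
        using that less.prems(1)[of j] by fastforce
      then have "(\<Sum>i\<in>I. x i) = x i"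
        using less.prems(3) I(1) by (simp add: sum.remove)
      then show ?thesis using less.prems(2) by simp
    qed
  qed
qed

lemma geig_separation:
  assumes "subspace Y" "\<And>y. y \<in> Y \<Longrightarrow> f y \<in> Y" "finite I" "inj_on lam I"
    and x: "\<And>i. i \<in> I \<Longrightarrow> x i \<in> geig scale f (lam i)" and "(\<Sum>i\<in>I. x i) \<in> Y" "i \<in> I"
  shows "x i \<in> Y"
proof -
  have "\<forall>i\<in>I. \<exists>k. (shift (lam i) ^^ k) (x i) = 0" using x by (auto simp: geig_def)
  then obtain K where "\<forall>i\<in>I. (shift (lam i) ^^ K i) (x i) = 0" by metis
  then show ?thesis using geig_separation_aux[OF assms(1-4), of K x i] assms by blast
qed

lemma geig_independent:
  assumes "finite I" "inj_on lam I" "\<And>i. i \<in> I \<Longrightarrow> x i \<in> geig scale f (lam i)" "(\<Sum>i\<in>I. x i) = 0" "i \<in> I"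
  shows "x i = 0"
  using geig_separation[of "{0}" I lam x i] assms by auto

text \<open>On the generalized eigenspace for \<open>d\<close>, \<open>f - c\<close> is the nonzero
  scalar \<open>d - c\<close> plus the locally nilpotent \<open>f - d\<close>, hence invertible. The
  induction solves \<open>(f - c) z = (f - d) y\<close>, whose right side has lower nilpotency
  order; then \<open>(f - c)(y - z) = (d - c) y\<close>.\<close>

lemma geig_shift_surj:
  assumes "c \<noteq> d" "y \<in> geig scale f d"
  shows "\<exists>z\<in>geig scale f d. shift c z = y"
proof -
  obtain k where "(shift d ^^ k) y = 0" using assms by (auto simp: geig_def)
  then show ?thesis using assms(2)
  proof (induction k arbitrary: y)
    case 0
    then show ?case by (auto intro!: bexI[of _ 0] subspace_0 subspace_geig)
  next
    case (Suc k)
    have "shift d y \<in> geig scale f d"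
      using Suc.prems subspace_geig by (blast intro: subspace_diff geig_self subspace_scale)
    then obtain z where z: "z \<in> geig scale f d" "shift c z = shift d y"
      using Suc.IH[of "shift d y"] Suc.prems by (auto simp: funpow_Suc_right simp del: funpow.simps)
    have "(inverse (d - c)) *s (y - z) \<in> geig scale f d"
      using z Suc.prems subspace_geig by (blast intro: subspace_diff subspace_scale)
    moreover have "shift c (inverse (d - c) *s (y - z)) = inverse (d - c) *s (shift c y - shift c z)"
      by (simp add: map_diff map_scale scale_right_diff_distrib scale_left_commute algebra_simps)
    moreover have "shift c y - shift c z = (d - c) *s y"
      unfolding z by (simp add: scale_left_diff_distrib)
    ultimately show ?case using assms(1) by force
  qed
qed

text \<open>\<open>f - c\<close> maps each generalized eigenspace with \<open>d \<noteq> c\<close>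
  onto itself, so every \<open>x\<close> in the span is \<open>(f - c) z\<close> up to an element of
  the space for \<open>c\<close>. For \<open>x = (f - c) v\<close> this places \<open>v - z\<close>
  in the space for \<open>c\<close>. The lemma removes one linear factor of an annihilating
  polynomial.\<close>

lemma geig_span_shiftD:
  assumes "shift c v \<in> span (\<Union>d. geig scale f d)"
  shows "v \<in> span (\<Union>d. geig scale f d)"
proof -
  have "\<exists>z\<in>span (\<Union>d. geig scale f d). x - shift c z \<in> geig scale f c"
    if "x \<in> span (\<Union>d. geig scale f d)" for x
    using that
  proof (induction rule: span_induct_alt)
    case base
    then show ?case
      by (auto intro!: bexI[of _ 0] span_zero simp: subspace_0 subspace_geig)
  next
    case (step b x y)
    then obtain d z where x: "x \<in> geig scale f d"
      and z: "z \<in> span (\<Union>d. geig scale f d)" "y - shift c z \<in> geig scale f c" by auto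
    show ?case
    proof (cases "d = c")
      case True
      then have "b *s x + (y - shift c z) \<in> geig scale f c"
        using x z by (intro subspace_add subspace_scale subspace_geig) auto
      then show ?thesis using z(1) by (auto simp: algebra_simps)
    next
      case False
      then obtain t where t: "t \<in> geig scale f d" "shift c t = x"
        using geig_shift_surj[of c d x] x by auto
      have "b *s x + y - shift c (b *s t + z) = y - shift c z"
        by (simp add: t(2)[symmetric] map_add map_scale scale_right_diff_distrib scale_right_distrib
            scale_left_commute algebra_simps)
      moreover have "b *s t + z \<in> span (\<Union>d. geig scale f d)"
        using t z by (auto intro!: span_add span_scale intro: span_base)
      ultimately show ?thesis using z(2) by metis
    qed
  qed
  from this[OF assms] obtain z where z: "z \<in> span (\<Union>d. geig scale f d)"
    "shift c v - shift c z \<in> geig scale f c" by blast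
  then have "shift c (v - z) \<in> geig scale f c"
    by (simp add: map_diff scale_right_diff_distrib algebra_simps)
  then have "v - z \<in> span (\<Union>d. geig scale f d)"
    by (auto intro!: span_base dest: geig_shiftD)
  then show ?thesis using span_add[OF _ z(1)] by fastforce
qed

end


section \<open>Power series of locally nilpotent operators\<close>

text \<open>The sum over the nonzero iterates is finite when \<open>f\<close> is nilpotent on
  \<open>v\<close>, which is the intended situation; any bound on the nilpotency order then gives
  the same value.\<close>

definition fps_eval ::
  "('a::field \<Rightarrow> 'b::ab_group_add \<Rightarrow> 'b) \<Rightarrow> 'a fps \<Rightarrow> ('b \<Rightarrow> 'b) \<Rightarrow> 'b \<Rightarrow> 'b" where
  "fps_eval sc F f v = (\<Sum>k | (f ^^ k) v \<noteq> 0. sc (fps_nth F k) ((f ^^ k) v))"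

context endomorphism
begin

lemma funpow_zero [simp]: "(f ^^ k) 0 = 0"
  by (induction k) auto

lemma funpow_vanish_mono: "(f ^^ k) x = 0 \<Longrightarrow> k \<le> m \<Longrightarrow> (f ^^ m) x = 0"
  using funpow_add[of "m - k" k f] by simp

lemma funpow_scale: "(f ^^ k) (c *s x) = c *s (f ^^ k) x"
  and funpow_sum: "(f ^^ k) (sum h A) = (\<Sum>i\<in>A. (f ^^ k) (h i))"
  by (induction k) (simp_all add: map_scale map_sum)

lemma fps_eval_eq:
  assumes "(f ^^ K) v = 0"
  shows "fps_eval scale F f v = (\<Sum>k<K. fps_nth F k *s (f ^^ k) v)"
  unfolding fps_eval_def
proof (rule sum.mono_neutral_left)
  show "{k. (f ^^ k) v \<noteq> 0} \<subseteq> {..<K}"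
    using funpow_vanish_mono[OF assms] by (auto simp: not_less[symmetric])
qed auto

lemma fps_eval_vanish:
  assumes "(f ^^ K) v = 0" shows "(f ^^ K) (fps_eval scale F f v) = 0"
proof -
  have "(f ^^ K) (fps_eval scale F f v) = (\<Sum>k<K. fps_nth F k *s (f ^^ K) ((f ^^ k) v))"
    unfolding fps_eval_eq[OF assms] by (simp add: funpow_sum funpow_scale)
  moreover have "(f ^^ K) ((f ^^ k) v) = 0" for k
    using funpow_add[of K k f] funpow_vanish_mono[OF assms, of "K + k"] by simp
  ultimately show ?thesis by simp
qed

lemma fps_eval_mult:
  assumes "(f ^^ K) v = 0"
  shows "fps_eval scale (F * G) f v = fps_eval scale F f (fps_eval scale G f v)"
proof -
  have vanish: "i + j < K" if "(f ^^ (i + j)) v \<noteq> 0" for i j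
    using funpow_vanish_mono[OF assms] that by (meson not_le)
  have "fps_eval scale F f (fps_eval scale G f v)
      = (\<Sum>i<K. fps_nth F i *s (\<Sum>j<K. fps_nth G j *s (f ^^ (i + j)) v))"
    unfolding fps_eval_eq[OF fps_eval_vanish[OF assms]]
    by (simp add: fps_eval_eq[OF assms] funpow_sum funpow_scale funpow_add)
  also have "\<dots> = (\<Sum>(i, j)\<in>{..<K} \<times> {..<K}. (fps_nth F i * fps_nth G j) *s (f ^^ (i + j)) v)"
    by (simp add: scale_sum_right sum.cartesian_product)
  also have "\<dots> = (\<Sum>(i, j)\<in>{(i, j). i + j < K}. (fps_nth F i * fps_nth G j) *s (f ^^ (i + j)) v)"
    by (intro sum.mono_neutral_right) (use vanish in force)+
  also have "\<dots> = (\<Sum>n<K. \<Sum>i\<le>n. (fps_nth F i * fps_nth G (n - i)) *s (f ^^ (i + (n - i))) v)"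
    by (rule sum.triangle_reindex)
  also have "\<dots> = fps_eval scale (F * G) f v"
    by (simp add: fps_eval_eq[OF assms] fps_mult_nth scale_sum_left atLeast0AtMost)
  finally show ?thesis by simp
qed

lemma fps_eval_1: assumes "(f ^^ K) v = 0" shows "fps_eval scale 1 f v = v"
proof -
  have "fps_eval scale 1 f v = (\<Sum>k<Suc K. fps_nth 1 k *s (f ^^ k) v)"
    by (rule fps_eval_eq) (simp add: assms)
  also have "\<dots> = v" by (simp add: sum.lessThan_Suc_shift del: sum.lessThan_Suc)
  finally show ?thesis .
qed

lemma fps_eval_X: assumes "(f ^^ K) v = 0" shows "fps_eval scale fps_X f v = f v"
proof -
  have "fps_eval scale fps_X f v = (\<Sum>k<Suc (Suc K). fps_nth fps_X k *s (f ^^ k) v)"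
    by (rule fps_eval_eq) (simp add: assms)
  also have "\<dots> = f v" by (simp add: sum.lessThan_Suc_shift del: sum.lessThan_Suc)
  finally show ?thesis .
qed

lemma fps_eval_diff:
  assumes "(f ^^ K) v = 0"
  shows "fps_eval scale (F - G) f v = fps_eval scale F f v - fps_eval scale G f v"
  by (simp add: fps_eval_eq[OF assms] sum_subtractf scale_left_diff_distrib)

lemma fps_eval_power:
  assumes "(f ^^ K) v = 0"
  shows "fps_eval scale (G ^ i) f v = (fps_eval scale G f ^^ i) v"
  by (induction i) (simp_all add: fps_eval_1[OF assms] fps_eval_mult[OF assms])

text \<open>The power \<open>G ^ i\<close> has no terms of degree below \<open>i\<close>, and the
  iterates of degree at least \<open>K\<close> kill \<open>v\<close>. For the same reason the outer
  series of a composition can be cut off at \<open>K\<close>.\<close>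

lemma fps_eval_nilpotent:
  assumes v: "(f ^^ K) v = 0" and G: "fps_nth G 0 = 0" and i: "K \<le> i"
  shows "(fps_eval scale G f ^^ i) v = 0"
proof -
  have "fps_eval scale (G ^ i) f v = 0"
    unfolding fps_eval_eq[OF v] using startsby_zero_power_prefix[OF G] i
    by (intro sum.neutral) auto
  then show ?thesis by (simp add: fps_eval_power[OF v])
qed

lemma fps_eval_compose:
  assumes v: "(f ^^ K) v = 0" and G: "fps_nth G 0 = 0"
  shows "fps_eval scale (F oo G) f v = (\<Sum>i<K. fps_nth F i *s (fps_eval scale G f ^^ i) v)"
proof -
  have "fps_eval scale (F oo G) f v
      = (\<Sum>k<K. \<Sum>i<K. (fps_nth F i * fps_nth (G ^ i) k) *s (f ^^ k) v)"
    unfolding fps_eval_eq[OF v] fps_compose_nth scale_sum_left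
    using startsby_zero_power_prefix[OF G]
    by (intro sum.cong sum.mono_neutral_left) (auto simp: not_le)
  also have "\<dots> = (\<Sum>i<K. fps_nth F i *s (\<Sum>k<K. fps_nth (G ^ i) k *s (f ^^ k) v))"
    by (subst sum.swap) (simp add: scale_sum_right)
  also have "\<dots> = (\<Sum>i<K. fps_nth F i *s (fps_eval scale G f ^^ i) v)"
    by (simp add: fps_eval_eq[OF v, symmetric] fps_eval_power[OF v])
  finally show ?thesis .
qed

lemma linear_fps_eval:
  assumes nil: "\<And>v. \<exists>K. (f ^^ K) v = 0"
  shows "Vector_Spaces.linear scale scale (fps_eval scale F f)"
proof (rule linear_endoI)
  fix x y
  obtain K L where "(f ^^ K) x = 0" "(f ^^ L) y = 0" using nil by metis
  then have K: "(f ^^ max K L) x = 0" "(f ^^ max K L) y = 0"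
    by (auto elim: funpow_vanish_mono)
  interpret l: Vector_Spaces.linear scale scale "f ^^ k" for k by (rule linear_funpow)
  have "(f ^^ max K L) (x + y) = 0" using K by (simp add: l.add)
  then show "fps_eval scale F f (x + y) = fps_eval scale F f x + fps_eval scale F f y"
    using K by (simp add: fps_eval_eq[of "max K L"] l.add scale_right_distrib sum.distrib)
next
  fix c x
  obtain K where K: "(f ^^ K) x = 0" using nil by metis
  then have "(f ^^ K) (c *s x) = 0" by (simp add: funpow_scale)
  then show "fps_eval scale F f (c *s x) = c *s fps_eval scale F f x"
    using K by (simp add: fps_eval_eq[of K] funpow_scale scale_sum_right mult.commute)
qed

text \<open>Polynomials in \<open>f\<close> are coefficient sums of explicit length, one longer on
  the left because of the extra factor. This form allows an annihilating polynomial to be divided by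
  a linear factor without tracking degrees.\<close>

lemma poly_factor_action:
  assumes "\<And>i. i \<ge> n \<Longrightarrow> coeff q i = 0"
  shows "(\<Sum>i<Suc n. coeff ([:- c, 1:] * q) i *s (f ^^ i) v) = (\<Sum>i<n. coeff q i *s (f ^^ i) (shift c v))"
proof -
  interpret l: Vector_Spaces.linear scale scale "f ^^ k" for k by (rule linear_funpow)
  have "(\<Sum>i<Suc n. coeff ([:- c, 1:] * q) i *s (f ^^ i) v)
      = (\<Sum>i<Suc n. coeff (pCons 0 q) i *s (f ^^ i) v) - (\<Sum>i<Suc n. (c * coeff q i) *s (f ^^ i) v)"
    by (simp add: scale_left_diff_distrib sum_subtractf del: sum.lessThan_Suc)
  also have "(\<Sum>i<Suc n. coeff (pCons 0 q) i *s (f ^^ i) v) = (\<Sum>i<n. coeff q i *s (f ^^ i) (f v))"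
    by (simp add: sum.lessThan_Suc_shift funpow_Suc_right del: sum.lessThan_Suc funpow.simps)
  also have "(\<Sum>i<Suc n. (c * coeff q i) *s (f ^^ i) v) = (\<Sum>i<n. coeff q i *s (f ^^ i) (c *s v))"
    by (simp add: assms funpow_scale mult.commute)
  finally show ?thesis by (simp add: l.diff scale_right_diff_distrib sum_subtractf)
qed

text \<open>The first \<open>card B + 1\<close> iterates of \<open>v\<close> lie in the span of
  \<open>B\<close>. Either two of them coincide, which gives a difference of two monomials, or they
  form a set too large to be independent.\<close>

lemma poly_relation:
  assumes U: "\<And>y. y \<in> U \<Longrightarrow> f y \<in> U" "U \<subseteq> span B" "finite B" and v: "v \<in> U"
  shows "\<exists>p n. p \<noteq> 0 \<and> (\<forall>i\<ge>n. coeff p i = 0) \<and> (\<Sum>i<n. coeff p i *s (f ^^ i) v) = 0"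
proof -
  define n where "n = Suc (card B)"
  have inU: "(f ^^ i) v \<in> U" for i by (induction i) (auto simp: v U(1))
  show ?thesis
  proof (cases "inj_on (\<lambda>i. (f ^^ i) v) {..<n}")
    case False
    then obtain i j where ij: "i < n" "j < n" "i \<noteq> j" "(f ^^ i) v = (f ^^ j) v"
      by (auto simp: inj_on_def)
    let ?p = "monom 1 i - monom 1 j :: 'a poly"
    have "coeff ?p i \<noteq> 0" using ij by simp
    then have "?p \<noteq> 0" by (metis coeff_0)
    moreover have "(\<Sum>k<n. coeff ?p k *s (f ^^ k) v)
        = (\<Sum>k<n. if k = i then (f ^^ k) v else 0) - (\<Sum>k<n. if k = j then (f ^^ k) v else 0)"
      unfolding sum_subtractf[symmetric] by (intro sum.cong) (auto simp: scale_left_diff_distrib)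
    then have "(\<Sum>k<n. coeff ?p k *s (f ^^ k) v) = 0"
      using ij by simp
    ultimately show ?thesis using ij by (intro exI[of _ ?p] exI[of _ n]) auto
  next
    case True
    let ?S = "(\<lambda>i. (f ^^ i) v) ` {..<n}"
    have "dependent ?S"
    proof (rule ccontr)
      assume "independent ?S"
      moreover have "?S \<subseteq> span B" using inU U(2) by blast
      ultimately have "card ?S \<le> card B" using independent_span_bound[OF U(3)] by blast
      then show False using card_image[OF True] by (simp add: n_def)
    qed
    then obtain u where u: "\<exists>x\<in>?S. u x \<noteq> 0" "(\<Sum>x\<in>?S. u x *s x) = 0"
      using dependent_finite[of ?S] by auto
    let ?p = "Abs_poly (\<lambda>i. if i < n then u ((f ^^ i) v) else 0)"
    have c: "coeff ?p = (\<lambda>i. if i < n then u ((f ^^ i) v) else 0)"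
      by (rule coeff_Abs_poly[of n]) auto
    obtain i where i: "i < n" "u ((f ^^ i) v) \<noteq> 0" using u by auto
    then have "coeff ?p i \<noteq> 0" using c by simp
    then have "?p \<noteq> 0" by (metis coeff_0)
    moreover have "(\<Sum>i<n. coeff ?p i *s (f ^^ i) v) = 0"
      using u(2) by (simp add: sum.reindex[OF True] c)
    ultimately show ?thesis using c by (intro exI[of _ ?p] exI[of _ n]) auto
  qed
qed

end

text \<open>A nonzero polynomial annihilates \<open>v\<close>; over the complex numbers it is a
  product of linear factors, which are removed one at a time by \<open>geig_span_shiftD\<close>
  until a nonzero constant forces the vector to vanish.\<close>

lemma finite_dim_geig_span:
  fixes sc :: "complex \<Rightarrow> 'b::ab_group_add \<Rightarrow> 'b"
  assumes endo: "endomorphism sc f" and U: "\<And>y. y \<in> U \<Longrightarrow> f y \<in> U" "U \<subseteq> module.span sc B" "finite B"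
    and v: "v \<in> U"
  shows "v \<in> module.span sc (\<Union>c. geig sc f c)"
proof -
  interpret endomorphism sc f by fact
  have "v \<in> span (\<Union>c. geig sc f c)"
    if "p \<noteq> 0" "\<And>i. i \<ge> n \<Longrightarrow> coeff p i = 0" "(\<Sum>i<n. sc (coeff p i) ((f ^^ i) v)) = 0" for p n v
    using that
  proof (induction n arbitrary: p v)
    case 0
    then show ?case by (simp add: poly_eq_iff)
  next
    case (Suc n)
    show ?case
    proof (cases "\<exists>z. poly p z = 0")
      case True
      then obtain c q where p: "p = [:- c, 1:] * q" by (auto simp: poly_eq_0_iff_dvd dvd_def)
      have q: "coeff q i = 0" if "i \<ge> n" for i
      proof (cases "q = 0")
        case False
        have "degree p = Suc (degree q)" unfolding p using False by (subst degree_mult_eq) auto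
        moreover have "degree p < Suc n" using Suc.prems(1,2)
          by (metis leading_coeff_0_iff not_le)
        ultimately show ?thesis using that by (intro coeff_eq_0) simp
      qed simp
      have "(\<Sum>i<n. sc (coeff q i) ((f ^^ i) (shift c v))) = 0"
        using Suc.prems(3) poly_factor_action[of n q c v] q unfolding p by simp
      then have "shift c v \<in> span (\<Union>c. geig sc f c)"
        using Suc.IH[of q "shift c v"] q Suc.prems(1) p by (metis mult_zero_right)
      then show ?thesis by (rule geig_span_shiftD)
    next
      case False
      then obtain a where a: "a \<noteq> 0" "p = [:a:]"
        using fundamental_theorem_of_algebra_alt[of p] by blast
      have "(\<Sum>i<Suc n. sc (coeff p i) ((f ^^ i) v)) = sc a v"
        unfolding a(2) sum.lessThan_Suc_shift by (simp add: coeff_pCons)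
      then show ?thesis using Suc.prems(3) a(1) span_zero by simp
    qed
  qed
  then show ?thesis using poly_relation[OF U v] by blast
qed


section \<open>Decompositions into generalized eigenspaces\<close>

locale direct_sum_decomposition = vector_space scale
  for scale :: "complex \<Rightarrow> 'b::ab_group_add \<Rightarrow> 'b" (infixr \<open>*s\<close> 75) +
  fixes I :: "'i set" and U :: "'i \<Rightarrow> 'b set"
  assumes direct_sum: "is_direct_sum scale I U"
begin

abbreviation comp :: "'b \<Rightarrow> 'i \<Rightarrow> 'b" where "comp \<equiv> component I U"

lemma subspace_summand: "i \<in> I \<Longrightarrow> subspace (U i)"
  using direct_sum by (simp add: is_direct_sum_def)

lemma comp_decomposition: "is_decomposition I U v (comp v)"
  unfolding component_def using direct_sum by (simp add: is_direct_sum_def theI')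

lemma comp_in: "i \<in> I \<Longrightarrow> comp v i \<in> U i"
  and comp_out: "i \<notin> I \<Longrightarrow> comp v i = 0"
  and finite_comp: "finite {i. comp v i \<noteq> 0}"
  and sum_comp: "(\<Sum>i | comp v i \<noteq> 0. comp v i) = v"
  using comp_decomposition[of v] by (auto simp: is_decomposition_def)

lemma sum_comp_superset:
  assumes "finite S" "{i. comp v i \<noteq> 0} \<subseteq> S" shows "(\<Sum>i\<in>S. comp v i) = v"
proof -
  have "(\<Sum>i\<in>S. comp v i) = (\<Sum>i | comp v i \<noteq> 0. comp v i)"
    using assms by (intro sum.mono_neutral_right) auto
  then show ?thesis by (simp add: sum_comp)
qed

lemma comp_eqI:
  assumes "\<And>i. i \<in> I \<Longrightarrow> h i \<in> U i" "\<And>i. i \<notin> I \<Longrightarrow> h i = 0"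
    and S: "finite S" "\<And>i. i \<notin> S \<Longrightarrow> h i = 0" and v: "(\<Sum>i\<in>S. h i) = v"
  shows "comp v = h"
proof -
  have sub: "{i. h i \<noteq> 0} \<subseteq> S" using S(2) by blast
  then have "(\<Sum>i | h i \<noteq> 0. h i) = (\<Sum>i\<in>S. h i)"
    using S by (intro sum.mono_neutral_left) auto
  then have "is_decomposition I U v h"
    using assms finite_subset[OF sub] by (auto simp: is_decomposition_def)
  then show ?thesis
    using comp_decomposition[of v] direct_sum by (auto simp: is_direct_sum_def)
qed

lemma comp_of_summand: "v \<in> U i \<Longrightarrow> i \<in> I \<Longrightarrow> comp v = (\<lambda>j. if j = i then v else 0)"
  by (rule comp_eqI[of _ "{i}"]) (auto intro: subspace_0 subspace_summand)

lemma comp_self: "v \<in> U i \<Longrightarrow> i \<in> I \<Longrightarrow> comp v i = v"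
  by (simp add: comp_of_summand)

lemma comp_zero [simp]: "comp 0 i = 0"
proof -
  have "comp 0 = (\<lambda>_. 0)"
    by (rule comp_eqI[of _ "{}"]) (auto intro: subspace_0 subspace_summand)
  then show ?thesis by simp
qed

lemma comp_add: "comp (x + y) i = comp x i + comp y i"
proof -
  let ?S = "{i. comp x i \<noteq> 0} \<union> {i. comp y i \<noteq> 0}"
  have "comp (x + y) = (\<lambda>i. comp x i + comp y i)"
  proof (rule comp_eqI[of _ ?S])
    show "(\<Sum>i\<in>?S. comp x i + comp y i) = x + y"
      by (simp add: sum.distrib sum_comp_superset finite_comp)
  qed (auto simp: comp_in comp_out finite_comp subspace_add subspace_summand)
  then show ?thesis by simp
qed

lemma comp_scale: "comp (c *s x) i = c *s comp x i"
proof -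
  have "comp (c *s x) = (\<lambda>i. c *s comp x i)"
  proof (rule comp_eqI[of _ "{i. comp x i \<noteq> 0}"])
    show "(\<Sum>i | comp x i \<noteq> 0. c *s comp x i) = c *s x"
      by (simp add: sum_comp flip: scale_sum_right)
  qed (auto simp: comp_in comp_out finite_comp subspace_scale subspace_summand)
  then show ?thesis by simp
qed

lemma linear_comp: "Vector_Spaces.linear scale scale (\<lambda>v. comp v i)"
  by (rule linear_endoI comp_add comp_scale)+

lemma span_summands: "span (\<Union>i\<in>I. U i) = UNIV"
proof -
  have "v \<in> span (\<Union>i\<in>I. U i)" for v
  proof -
    have "(\<Sum>i | comp v i \<noteq> 0. comp v i) \<in> span (\<Union>i\<in>I. U i)"
      by (rule span_sum) (use comp_in comp_out in \<open>blast intro: span_base\<close>)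
    then show ?thesis by (simp add: sum_comp)
  qed
  then show ?thesis by blast
qed

lemma comp_span:
  assumes G: "\<And>i. i \<in> I \<Longrightarrow> G i \<subseteq> U i" and x: "x \<in> span (\<Union>i\<in>I. G i)" and i: "i \<in> I"
  shows "comp x i \<in> span (G i)"
  using x
proof (induction rule: span_induct_alt)
  case base
  then show ?case by (simp add: span_zero)
next
  case (step c x y)
  then obtain j where j: "j \<in> I" "x \<in> G j" by blast
  then have "comp x i = (if i = j then x else 0)"
    using G[of j] comp_of_summand[of x j] by auto
  then have "comp x i \<in> span (G i)"
    using j by (simp add: span_base span_zero)
  then show ?case using step by (simp add: comp_add comp_scale span_add span_scale)
qed

text \<open>Inside each summand a basis \<open>B0 i\<close> of the span of \<open>G i\<close>,
  chosen in \<open>G i\<close>, is extended to a basis \<open>B i\<close> of \<open>U i\<close>; the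
  added vectors form \<open>A\<close>. They are independent modulo the whole span because that span
  is graded. The size of \<open>A\<close> is controlled through its finite subsets since the
  quotient may have infinite dimension.\<close>

lemma homogeneous_basis:
  assumes G: "\<And>i. i \<in> I \<Longrightarrow> G i \<subseteq> U i"
  obtains A wt where "\<And>i. i \<in> I \<Longrightarrow> U i \<subseteq> span ({a \<in> A. wt a = i} \<union> G i)"
    and "\<And>a. a \<in> A \<Longrightarrow> wt a \<in> I \<and> a \<in> U (wt a)"
    and "\<And>F. finite F \<Longrightarrow> F \<subseteq> A \<Longrightarrow> enat (card F) \<le> quotient_dim scale (span (\<Union>i\<in>I. G i))"
proof -
  have "\<forall>i\<in>I. \<exists>B0. B0 \<subseteq> G i \<and> independent B0 \<and> G i \<subseteq> span B0"
    by (metis maximal_independent_subset)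
  then obtain B0 where B0: "\<And>i. i \<in> I \<Longrightarrow> B0 i \<subseteq> G i \<and> independent (B0 i) \<and> G i \<subseteq> span (B0 i)"
    by metis
  have "\<forall>i\<in>I. \<exists>B. B0 i \<subseteq> B \<and> B \<subseteq> U i \<and> independent B \<and> U i \<subseteq> span B"
    using B0 G by (metis maximal_independent_subset_extend subset_trans)
  then obtain B where B: "\<And>i. i \<in> I \<Longrightarrow> B0 i \<subseteq> B i \<and> B i \<subseteq> U i \<and> independent (B i) \<and> U i \<subseteq> span (B i)"
    by metis
  define A where "A = (\<Union>i\<in>I. B i - B0 i)"
  define wt where "wt a = (THE i. comp a i \<noteq> 0)" for a
  have wt: "wt a = i" if "i \<in> I" "a \<in> B i" for i a
  proof -
    have "a \<noteq> 0" using B[OF that(1)] that(2) dependent_zero by blast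
    then show ?thesis
      using B[OF that(1)] that comp_of_summand[of a i] by (auto simp: wt_def)
  qed
  show ?thesis
  proof (rule that[of A wt])
    fix i assume i: "i \<in> I"
    have "B i \<subseteq> {a \<in> A. wt a = i} \<union> G i"
      using B0[OF i] wt[OF i] i by (auto simp: A_def)
    then show "U i \<subseteq> span ({a \<in> A. wt a = i} \<union> G i)"
      using B[OF i] span_mono by blast
  next
    fix a assume "a \<in> A"
    then show "wt a \<in> I \<and> a \<in> U (wt a)" using wt B unfolding A_def by fastforce
  next
    fix F assume F: "finite F" "F \<subseteq> A"
    have "\<forall>b\<in>F. c b = 0" if c: "(\<Sum>b\<in>F. c b *s b) \<in> span (\<Union>i\<in>I. G i)" for c
    proof
      fix a assume a: "a \<in> F"
      then obtain i where i: "i \<in> I" "a \<in> B i - B0 i" using F by (auto simp: A_def)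
      let ?F = "{b \<in> F. wt b = i}"
      have "comp b i = (if wt b = i then b else 0)" if b: "b \<in> F" for b
      proof -
        obtain j where j: "j \<in> I" "b \<in> B j" using F b by (auto simp: A_def)
        then show ?thesis using B[OF j(1)] wt[OF j] comp_of_summand[of b j] by auto
      qed
      moreover interpret l: Vector_Spaces.linear scale scale "\<lambda>v. comp v i" by (rule linear_comp)
      have "comp (\<Sum>b\<in>F. c b *s b) i = (\<Sum>b\<in>F. c b *s comp b i)"
        by (simp add: l.sum l.scale)
      ultimately have "comp (\<Sum>b\<in>F. c b *s b) i = (\<Sum>b\<in>F. if wt b = i then c b *s b else 0)"
        by (auto intro: sum.cong)
      also have "\<dots> = (\<Sum>b\<in>?F. c b *s b)" using F by (simp add: sum.inter_filter)
      finally have "(\<Sum>b\<in>?F. c b *s b) \<in> span (G i)"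
        using comp_span[OF G c i(1)] by simp
      then have inB0: "(\<Sum>b\<in>?F. c b *s b) \<in> span (B0 i)"
        using B0[OF i(1)] span_minimal[of "G i" "span (B0 i)"] by auto
      have FB: "?F \<subseteq> B i - B0 i"
      proof
        fix b assume "b \<in> ?F"
        moreover then obtain j where "j \<in> I" "b \<in> B j - B0 j" using F by (auto simp: A_def)
        ultimately show "b \<in> B i - B0 i" using wt by auto
      qed
      show "c a = 0"
      proof (rule ccontr)
        assume ca: "c a \<noteq> 0"
        have aF: "a \<in> ?F" using a i wt by auto
        \<comment> \<open>If \<open>c a\<close> were nonzero, \<open>a\<close> would lie in the span
          of the other elements of the basis \<open>B i\<close>: the full sum is in the span of
          \<open>B0 i\<close>, which does not contain \<open>a\<close>.\<close>
        have "c a *s a = (\<Sum>b\<in>?F. c b *s b) - (\<Sum>b\<in>?F - {a}. c b *s b)"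
          using F(1) aF by (simp add: sum.remove)
        also have "\<dots> \<in> span (B i - {a})"
        proof (rule span_diff)
          have "B0 i \<subseteq> B i - {a}" using B[OF i(1)] i(2) by blast
          then show "(\<Sum>b\<in>?F. c b *s b) \<in> span (B i - {a})" using inB0 span_mono by blast
          show "(\<Sum>b\<in>?F - {a}. c b *s b) \<in> span (B i - {a})"
            using FB by (intro span_sum span_scale span_base) auto
        qed
        finally have "a \<in> span (B i - {a})" by (rule subspace_scaleD[OF subspace_span _ ca])
        then show False using B[OF i(1)] i(2) dependent_def by blast
      qed
    qed
    then show "enat (card F) \<le> quotient_dim scale (span (\<Union>i\<in>I. G i))"
      unfolding quotient_dim_def using F by (intro SUP_upper) auto
  qed
qed

end

text \<open>Covers the weight grading of \<open>V\<close>, the exponents of an automorphism, and the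
  weight grading of a generalized twisted module. The index need not be the eigenvalue, hence the
  map \<open>lam\<close>.\<close>

locale eigen_decomposition = direct_sum_decomposition scale I U + endomorphism scale f
  for scale :: "complex \<Rightarrow> 'b::ab_group_add \<Rightarrow> 'b" (infixr \<open>*s\<close> 75)
    and I :: "'i set" and U :: "'i \<Rightarrow> 'b set" and f :: "'b \<Rightarrow> 'b" +
  fixes lam :: "'i \<Rightarrow> complex"
  assumes inj_lam: "inj_on lam I" and summand_geig: "i \<in> I \<Longrightarrow> U i \<subseteq> geig scale f (lam i)"
begin

lemma comp_stable:
  assumes Y: "subspace Y" "\<And>y. y \<in> Y \<Longrightarrow> f y \<in> Y" and v: "v \<in> Y"
  shows "comp v i \<in> Y"
proof (cases "comp v i = 0")
  case True
  then show ?thesis using Y by (simp add: subspace_0)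
next
  case False
  have sub: "{i. comp v i \<noteq> 0} \<subseteq> I" using comp_out by blast
  show ?thesis
  proof (rule geig_separation[OF Y finite_comp[of v] inj_on_subset[OF inj_lam sub]])
    show "comp v j \<in> geig scale f (lam j)" if "j \<in> {i. comp v i \<noteq> 0}" for j
      using that sub comp_in summand_geig by blast
  qed (use False v in \<open>auto simp: sum_comp\<close>)
qed

text \<open>A generalized eigenvector minus its own decomposition is a vanishing sum of generalized
  eigenvectors, so its component at \<open>i\<close> is everything. Membership in a weight space
  thus becomes a statement about \<open>L(0)\<close> alone, the form in which all weight
  computations are done.\<close>

lemma summand_eq_geig: assumes i: "i \<in> I" shows "U i = geig scale f (lam i)"
proof
  show "geig scale f (lam i) \<subseteq> U i"
  proof
    fix v assume v: "v \<in> geig scale f (lam i)"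
    let ?J = "insert i {j. comp v j \<noteq> 0}" and ?x = "\<lambda>j. comp v j - (if j = i then v else 0)"
    have J: "finite ?J" "?J \<subseteq> I" using finite_comp[of v] comp_out i by auto
    have "?x i = 0"
    proof (rule geig_independent[OF J(1) inj_on_subset[OF inj_lam J(2)], where x = ?x])
      show "?x j \<in> geig scale f (lam j)" if "j \<in> ?J" for j
        using that J(2) comp_in summand_geig[of j] v
        by (auto intro!: subspace_diff subspace_geig simp: subspace_0)
      have "(\<Sum>j\<in>?J. ?x j) = (\<Sum>j\<in>?J. comp v j) - v"
        using J(1) by (simp add: sum_subtractf del: insert_Collect)
      also have "(\<Sum>j\<in>?J. comp v j) = v" by (rule sum_comp_superset) (use J in auto)
      finally show "(\<Sum>j\<in>?J. ?x j) = 0" by simp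
    qed simp
    then show "v \<in> U i" using comp_in[OF i, of v] by simp
  qed
qed (rule summand_geig[OF i])

end

lemma is_direct_sum_geig:
  fixes sc :: "complex \<Rightarrow> 'b::ab_group_add \<Rightarrow> 'b"
  assumes endo: "endomorphism sc f" and inj: "inj_on lam I"
    and span: "module.span sc (\<Union>i\<in>I. geig sc f (lam i)) = UNIV"
  shows "is_direct_sum sc I (\<lambda>i. geig sc f (lam i))"
proof -
  interpret endomorphism sc f by fact
  let ?U = "\<lambda>i. geig sc f (lam i)"
  have ex: "\<exists>h. is_decomposition I ?U v h" if "v \<in> span (\<Union>i\<in>I. ?U i)" for v
    using that
  proof (induction rule: span_induct_alt)
    case base
    have "is_decomposition I ?U 0 (\<lambda>_. 0)"
      by (auto simp: is_decomposition_def subspace_0 subspace_geig)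
    then show ?case by blast
  next
    case (step c x y)
    then obtain i h where i: "i \<in> I" "x \<in> ?U i" and h: "is_decomposition I ?U y h" by blast
    let ?h = "\<lambda>j. (if j = i then sc c x else 0) + h j"
    let ?S = "insert i {j. h j \<noteq> 0}"
    have S: "finite ?S" using h by (simp add: is_decomposition_def)
    have "(\<Sum>j | ?h j \<noteq> 0. ?h j) = (\<Sum>j\<in>?S. ?h j)"
      using S by (intro sum.mono_neutral_left) auto
    also have "\<dots> = (\<Sum>j\<in>?S. if j = i then sc c x else 0) + (\<Sum>j\<in>?S. h j)"
      by (rule sum.distrib)
    also have "(\<Sum>j\<in>?S. h j) = (\<Sum>j | h j \<noteq> 0. h j)"
      using S by (intro sum.mono_neutral_right) auto
    also have "\<dots> = y" using h by (simp add: is_decomposition_def)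
    also have "(\<Sum>j\<in>?S. if j = i then sc c x else 0) = sc c x" using S by simp
    finally have "(\<Sum>j | ?h j \<noteq> 0. ?h j) = sc c x + y" .
    moreover have "finite {j. ?h j \<noteq> 0}" by (rule finite_subset[OF _ S]) auto
    ultimately have "is_decomposition I ?U (sc c x + y) ?h"
      using h i by (auto simp: is_decomposition_def subspace_geig intro!: subspace_add subspace_scale)
    then show ?case by blast
  qed
  have "h = h'" if h: "is_decomposition I ?U v h" "is_decomposition I ?U v h'" for v h h'
  proof
    fix i
    let ?S = "{j. h j \<noteq> 0} \<union> {j. h' j \<noteq> 0}"
    have S: "finite ?S" "?S \<subseteq> I" using h by (auto simp: is_decomposition_def)
    have "(\<Sum>j\<in>?S. h j) = (\<Sum>j | h j \<noteq> 0. h j)" "(\<Sum>j\<in>?S. h' j) = (\<Sum>j | h' j \<noteq> 0. h' j)"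
      by (rule sum.mono_neutral_right[OF S(1)]; auto)+
    then have sum0: "(\<Sum>j\<in>?S. h j - h' j) = 0"
      using h by (simp add: sum_subtractf is_decomposition_def)
    have "h i - h' i = 0"
    proof (cases "i \<in> ?S")
      case True
      show ?thesis
      proof (rule geig_independent[where x = "\<lambda>j. h j - h' j", OF S(1) inj_on_subset[OF inj S(2)] _ sum0 True])
        show "h j - h' j \<in> geig sc f (lam j)" if "j \<in> ?S" for j
          using that S(2) h by (intro subspace_diff subspace_geig) (auto simp: is_decomposition_def)
      qed
    qed simp
    then show "h i = h' i" by simp
  qed
  then show ?thesis using ex span by (auto simp: is_direct_sum_def subspace_geig)
qed


section \<open>The logarithm of an automorphism\<close>

lemma exp_of_int_2pi_i: "exp (of_int k * (2 * pi * \<i>)) = (1 :: complex)"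
proof -
  have "exp (of_int k * (2 * pi * \<i>)) = cis (2 * pi * of_int k)"
    by (simp add: cis_conv_exp mult_ac)
  then show ?thesis by (simp add: cis_multiple_2pi)
qed

lemma exp_2pi_surj:
  fixes c :: complex
  assumes "c \<noteq> 0"
  obtains \<alpha> where "0 \<le> Re \<alpha>" "Re \<alpha> < 1" "exp (2 * pi * \<i> * \<alpha>) = c"
proof -
  define w where "w = of_real (ln (cmod c)) + \<i> * of_real (Arg c)"
  have "exp w = of_real (exp (ln (cmod c))) * cis (Arg c)"
    by (simp add: w_def exp_add cis_conv_exp exp_of_real)
  then have w: "exp w = c"
    using assms rcis_cmod_Arg[of c] by (simp add: rcis_def)
  define b where "b = w / (2 * pi * \<i>)"
  define \<alpha> where "\<alpha> = b - of_int \<lfloor>Re b\<rfloor>"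
  have "2 * pi * \<i> * \<alpha> = w - of_int \<lfloor>Re b\<rfloor> * (2 * pi * \<i>)"
    by (simp add: \<alpha>_def b_def field_simps)
  then have "exp (2 * pi * \<i> * \<alpha>) = c" by (simp only: exp_diff exp_of_int_2pi_i w) simp
  moreover have "0 \<le> Re \<alpha>" "Re \<alpha> < 1"
    by (simp_all add: \<alpha>_def) linarith
  ultimately show ?thesis using that by blast
qed

lemma exp_2pi_eqD:
  fixes a b :: complex
  assumes "exp (2 * pi * \<i> * a) = exp (2 * pi * \<i> * b)"
  shows "\<exists>k::int. a = b + of_int k"
proof -
  define w where "w = 2 * pi * \<i> * (a - b)"
  have "exp w = 1" using assms by (simp add: w_def algebra_simps exp_diff)
  then have "cmod (exp w) = 1" "Re (exp w) = 1" by simp_all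
  then have "Re w = 0" "cos (Im w) = 1" by (simp_all add: Re_exp)
  then obtain k :: int where "Im w = of_int k * 2 * pi" "Re w = 0"
    using cos_one_2pi_int by blast
  then have "Re (a - b) = of_int k" "Im (a - b) = 0"
    by (simp_all add: w_def)
  then have "a - b = of_int k" by (simp add: complex_eq_iff)
  then show ?thesis by (intro exI[of _ k]) (simp add: algebra_simps)
qed

lemma exp_2pi_inj:
  fixes a b :: complex
  assumes "exp (2 * pi * \<i> * a) = exp (2 * pi * \<i> * b)"
    and "0 \<le> Re a" "Re a < 1" "0 \<le> Re b" "Re b < 1"
  shows "a = b"
proof -
  obtain k :: int where k: "a = b + of_int k" using exp_2pi_eqD[OF assms(1)] by blast
  then have "Re a = Re b + of_int k" by simp
  then have "k = 0" using assms(2-5) by linarith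
  then show ?thesis using k by simp
qed

context endomorphism
begin

lemma fps_eval_commute:
  assumes h: "Vector_Spaces.linear scale scale h" and comm: "\<And>v. h (f v) = f (h v)"
    and v: "(f ^^ K) v = 0"
  shows "h (fps_eval scale F f v) = fps_eval scale F f (h v)"
proof -
  interpret h: Vector_Spaces.linear scale scale h by fact
  have pow: "h ((f ^^ k) v) = (f ^^ k) (h v)" for k
    by (induction k) (simp_all add: comm)
  have "(f ^^ K) (h v) = 0" unfolding pow[symmetric] by (simp add: v)
  then show ?thesis by (simp add: fps_eval_eq[of K] v h.sum h.scale pow)
qed

end

context direct_sum_decomposition
begin

definition blockwise :: "('i \<Rightarrow> 'b \<Rightarrow> 'b) \<Rightarrow> 'b \<Rightarrow> 'b" where
  "blockwise h v = (\<Sum>i | comp v i \<noteq> 0. h i (comp v i))"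

lemma comp_ext: "(\<And>i. comp x i = comp y i) \<Longrightarrow> x = y"
proof -
  assume "\<And>i. comp x i = comp y i"
  then have "comp x = comp y" by blast
  then show "x = y" by (metis sum_comp)
qed

context
  fixes h :: "'i \<Rightarrow> 'b \<Rightarrow> 'b"
  assumes h: "\<And>i. i \<in> I \<Longrightarrow> Vector_Spaces.linear scale scale (h i)"
    and hU: "\<And>i x. i \<in> I \<Longrightarrow> x \<in> U i \<Longrightarrow> h i x \<in> U i"
begin

lemma comp_blockwise: "comp (blockwise h v) i = (if i \<in> I then h i (comp v i) else 0)"
proof -
  have "comp (blockwise h v) = (\<lambda>i. if comp v i \<noteq> 0 then h i (comp v i) else 0)"
  proof (rule comp_eqI[of _ "{i. comp v i \<noteq> 0}"])
    show "(\<Sum>i | comp v i \<noteq> 0. if comp v i \<noteq> 0 then h i (comp v i) else 0) = blockwise h v"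
      unfolding blockwise_def by (intro sum.cong) auto
  qed (auto simp: finite_comp hU comp_in comp_out subspace_0 subspace_summand)
  moreover have "h i 0 = 0" if "i \<in> I"
  proof -
    interpret l: Vector_Spaces.linear scale scale "h i" by (rule h[OF that])
    show ?thesis by simp
  qed
  ultimately show ?thesis by (simp add: comp_out)
qed

lemma linear_blockwise: "Vector_Spaces.linear scale scale (blockwise h)"
proof (rule linear_endoI; rule comp_ext)
  fix x y i
  show "comp (blockwise h (x + y)) i = comp (blockwise h x + blockwise h y) i"
  proof (cases "i \<in> I")
    case True
    interpret l: Vector_Spaces.linear scale scale "h i" by (rule h[OF True])
    show ?thesis by (simp add: comp_blockwise comp_add l.add)
  qed (simp add: comp_out)
next
  fix c x i
  show "comp (blockwise h (c *s x)) i = comp (c *s blockwise h x) i"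
  proof (cases "i \<in> I")
    case True
    interpret l: Vector_Spaces.linear scale scale "h i" by (rule h[OF True])
    show ?thesis by (simp add: comp_blockwise comp_scale l.scale)
  qed (simp add: comp_out)
qed

lemma blockwise_summand: "v \<in> U i \<Longrightarrow> i \<in> I \<Longrightarrow> blockwise h v = h i v"
proof (rule comp_ext)
  fix j assume v: "v \<in> U i" "i \<in> I"
  have "h j 0 = 0" if "j \<in> I"
  proof -
    interpret l: Vector_Spaces.linear scale scale "h j" by (rule h[OF that])
    show ?thesis by simp
  qed
  then show "comp (blockwise h v) j = comp (h i v) j"
    using v by (simp add: comp_blockwise comp_of_summand[OF v] comp_of_summand[OF hU[OF v(2,1)] v(2)])
qed

end

end

context grading_restricted_vertex_algebra
begin

sublocale vs: vector_space "vscale V" by (rule vector_space)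

sublocale V0: eigen_decomposition "vscale V" UNIV "vgrade V" "LV0 V" of_int
proof (intro eigen_decomposition.intro direct_sum_decomposition.intro
    direct_sum_decomposition_axioms.intro endomorphism.intro endomorphism_axioms.intro
    eigen_decomposition_axioms.intro vector_space grading L0_linear)
  fix i show "vgrade V i \<subseteq> geig (vscale V) (LV0 V) (of_int i)"
    by (auto intro: endomorphism.eigenvector_geig endomorphism.intro endomorphism_axioms.intro
        vector_space L0_linear L0_grade)
qed (auto simp: inj_on_def)

lemma vgrade_stable:
  assumes "Vector_Spaces.linear (vscale V) (vscale V) h" "\<And>v. h (LV0 V v) = LV0 V (h v)" "v \<in> vgrade V n"
  shows "h v \<in> vgrade V n"
  using V0.geig_commute[OF assms(1,2)] assms(3) V0.summand_eq_geig[of n] by auto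

end

context vertex_algebra_automorphism
begin

sublocale G: endomorphism "vscale V" g
  by (intro endomorphism.intro endomorphism_axioms.intro vector_space aut_linear)

lemma gen_eigenspace_geig: "gen_eigenspace V g \<alpha> = geig (vscale V) g (exp (2 * pi * \<i> * \<alpha>))"
  by (simp add: gen_eigenspace_def geig_def)

lemma aut_vgrade: "v \<in> vgrade V n \<Longrightarrow> g v \<in> vgrade V n"
  by (rule vgrade_stable[OF aut_linear aut_L0])

text \<open>Bijectivity of \<open>g\<close> excludes the eigenvalue 0, and every other complex
  number is \<open>exp (2 * pi * \<i> * \<alpha>)\<close> for some \<alpha> with real part in [0,
  1).\<close>

lemma geig_spectrum:
  assumes "v \<in> geig (vscale V) g c" "v \<noteq> 0"
  shows "\<exists>\<alpha>\<in>spectrum_exponents V g. exp (2 * pi * \<i> * \<alpha>) = c"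
proof -
  obtain u where u: "u \<noteq> 0" "g u = vscale V c u" using G.geig_eigenvector[OF assms] .
  have "g u \<noteq> g 0" using aut_bij u(1) by (metis bij_def injD)
  then have "c \<noteq> 0" using u(2) by auto
  then obtain \<alpha> where "0 \<le> Re \<alpha>" "Re \<alpha> < 1" "exp (2 * pi * \<i> * \<alpha>) = c" by (rule exp_2pi_surj)
  then show ?thesis using u by (intro bexI[of _ \<alpha>]) (auto simp: spectrum_exponents_def)
qed

text \<open>Although \<open>V\<close> is infinite-dimensional and \<open>g\<close> may have infinite
  order, \<open>g\<close> preserves the finite-dimensional weight spaces, and each of these is
  spanned by generalized eigenvectors.\<close>

lemma span_gen_eigenspaces:
  "vs.span (\<Union>\<alpha>\<in>spectrum_exponents V g. geig (vscale V) g (exp (2 * pi * \<i> * \<alpha>))) = UNIV"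
  (is "vs.span ?G = UNIV")
proof -
  have "(\<Union>c. geig (vscale V) g c) \<subseteq> vs.span ?G"
  proof
    fix v assume "v \<in> (\<Union>c. geig (vscale V) g c)"
    then obtain c where c: "v \<in> geig (vscale V) g c" by blast
    show "v \<in> vs.span ?G"
    proof (cases "v = 0")
      case False
      then show ?thesis using geig_spectrum[OF c] c by (auto intro!: vs.span_base)
    qed (simp add: vs.span_zero)
  qed
  then have sub: "vs.span (\<Union>c. geig (vscale V) g c) \<subseteq> vs.span ?G"
    by (rule vs.span_minimal) simp
  have "(\<Union>n. vgrade V n) \<subseteq> vs.span ?G"
  proof
    fix v assume "v \<in> (\<Union>n. vgrade V n)"
    then obtain n where n: "v \<in> vgrade V n" by blast
    obtain B where B: "finite B" "vgrade V n \<subseteq> vs.span B" using grade_finite_dim by blast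
    then have "v \<in> vs.span (\<Union>c. geig (vscale V) g c)"
      using finite_dim_geig_span[OF G.endomorphism_axioms, of "vgrade V n"] aut_vgrade n by blast
    then show "v \<in> vs.span ?G" using sub by blast
  qed
  then have "vs.span (\<Union>n. vgrade V n) \<subseteq> vs.span ?G" by (rule vs.span_minimal) simp
  then show ?thesis using V0.span_summands by auto
qed

lemma spectrum_exponents_inj: "inj_on (\<lambda>\<alpha>. exp (2 * pi * \<i> * \<alpha>)) (spectrum_exponents V g)"
  by (auto simp: inj_on_def spectrum_exponents_def intro: exp_2pi_inj)

sublocale Gdec: eigen_decomposition "vscale V" "spectrum_exponents V g" "gen_eigenspace V g" g
  "\<lambda>\<alpha>. exp (2 * pi * \<i> * \<alpha>)"
proof (intro eigen_decomposition.intro direct_sum_decomposition.intro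
    direct_sum_decomposition_axioms.intro G.endomorphism_axioms
    eigen_decomposition_axioms.intro vector_space spectrum_exponents_inj)
  show "is_direct_sum (vscale V) (spectrum_exponents V g) (gen_eigenspace V g)"
    unfolding gen_eigenspace_geig[abs_def]
    by (rule is_direct_sum_geig[OF G.endomorphism_axioms spectrum_exponents_inj span_gen_eigenspaces])
qed (simp add: gen_eigenspace_geig)

lemma eigencomponent_eq: "eigencomponent V g = Gdec.comp"
  by (simp add: eigencomponent_def)

lemma semisimple_part_eq: "semisimple_part V g = Gdec.blockwise (vscale V)"
  by (rule ext) (simp add: semisimple_part_def Gdec.blockwise_def eigencomponent_eq)

lemma linear_semisimple_part: "Vector_Spaces.linear (vscale V) (vscale V) (semisimple_part V g)"
  and comp_semisimple_part: "Gdec.comp (semisimple_part V g v) \<alpha> = vscale V \<alpha> (Gdec.comp v \<alpha>)"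
proof -
  have l: "Vector_Spaces.linear (vscale V) (vscale V) (vscale V i)" for i
    by (rule vs.linear_scale_self)
  have s: "vscale V i x \<in> gen_eigenspace V g i" if "i \<in> spectrum_exponents V g" "x \<in> gen_eigenspace V g i" for i x
    using that Gdec.subspace_summand by (blast intro: vs.subspace_scale)
  show "Vector_Spaces.linear (vscale V) (vscale V) (semisimple_part V g)"
    unfolding semisimple_part_eq by (rule Gdec.linear_blockwise[OF l s])
  show "Gdec.comp (semisimple_part V g v) \<alpha> = vscale V \<alpha> (Gdec.comp v \<alpha>)"
    unfolding semisimple_part_eq by (subst Gdec.comp_blockwise[OF l s]) (auto simp: Gdec.comp_out)
qed

lemma exp_SN_eq:
  assumes N: "endomorphism (vscale V) N" and nil: "\<And>v. \<exists>k. (N ^^ k) v = 0"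
  shows "exp_SN V g N c v = (\<Sum>\<alpha> | Gdec.comp v \<alpha> \<noteq> 0.
      vscale V (exp (c * \<alpha>)) (fps_eval (vscale V) (fps_exp c) N (Gdec.comp v \<alpha>)))"
proof -
  interpret N: endomorphism "vscale V" N by fact
  have fin: "finite {k. (N ^^ k) x \<noteq> 0}" for x
  proof -
    obtain K where "(N ^^ K) x = 0" using nil by blast
    then have "k \<le> K" if "(N ^^ k) x \<noteq> 0" for k
      using N.funpow_vanish_mono that by (meson linear)
    then have "{k. (N ^^ k) x \<noteq> 0} \<subseteq> {..K}" by blast
    then show ?thesis by (rule finite_subset) simp
  qed
  have "{(\<alpha>, k). (N ^^ k) (Gdec.comp v \<alpha>) \<noteq> 0}
      = Sigma {\<alpha>. Gdec.comp v \<alpha> \<noteq> 0} (\<lambda>\<alpha>. {k. (N ^^ k) (Gdec.comp v \<alpha>) \<noteq> 0})"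
    by auto
  then show ?thesis
    using sum.Sigma[of "{\<alpha>. Gdec.comp v \<alpha> \<noteq> 0}" "\<lambda>\<alpha>. {k. (N ^^ k) (Gdec.comp v \<alpha>) \<noteq> 0}"
        "\<lambda>\<alpha> k. vscale V (exp (c * \<alpha>) * c ^ k / fact k) ((N ^^ k) (Gdec.comp v \<alpha>))"] fin
    by (simp add: exp_SN_def eigencomponent_eq Gdec.finite_comp fps_eval_def vs.scale_sum_right)
qed

end

text \<open>This is the series log(1 + X) / c, as the compositional inverse of e^(cX) - 1.\<close>

abbreviation (input) log_fps :: "complex \<Rightarrow> complex fps" where
  "log_fps c \<equiv> fps_inv (fps_exp c - 1)"

context vertex_algebra_automorphism
begin

text \<open>On the summand of exponent \<alpha>, \<open>U\<close> is e^(-2 pi i \<alpha>) g - 1,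
  that is, the unipotent part of \<open>g\<close> minus the identity. It is locally nilpotent, so
  its logarithm \<open>N\<close>, divided by 2 pi i, is defined vector by vector, and e^(2 pi i N)
  returns the unipotent part.\<close>

lemma nilpotent_part_exists:
  "\<exists>N. Vector_Spaces.linear (vscale V) (vscale V) N \<and>
        (\<forall>v. \<exists>k. (N ^^ k) v = 0) \<and>
        (\<forall>v. N (semisimple_part V g v) = semisimple_part V g (N v)) \<and>
        (\<forall>v. g v = exp_SN V g N (2 * pi * \<i>) v)"
proof -
  define h where "h \<alpha> x = vscale V (exp (- (2 * pi * \<i> * \<alpha>))) (g x) - x" for \<alpha> x
  have h_shift: "h \<alpha> x = vscale V (exp (- (2 * pi * \<i> * \<alpha>))) (G.shift (exp (2 * pi * \<i> * \<alpha>)) x)" for \<alpha> x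
    by (simp add: h_def vs.scale_right_diff_distrib exp_minus)
  have lin: "Vector_Spaces.linear (vscale V) (vscale V) (h \<alpha>)" for \<alpha>
    unfolding h_def
    by (rule vs.linear_endoI)
      (simp_all add: G.map_add G.map_scale vs.scale_right_distrib vs.scale_right_diff_distrib mult.commute)
  have stab: "h \<alpha> x \<in> gen_eigenspace V g \<alpha>" if "\<alpha> \<in> spectrum_exponents V g" "x \<in> gen_eigenspace V g \<alpha>" for \<alpha> x
    using that unfolding h_def gen_eigenspace_geig
    by (intro vs.subspace_diff vs.subspace_scale G.subspace_geig G.geig_self)
  define U where "U = Gdec.blockwise h"
  have U_lin: "Vector_Spaces.linear (vscale V) (vscale V) U"
    unfolding U_def by (rule Gdec.linear_blockwise[OF lin stab])
  have comp_U: "Gdec.comp (U v) \<alpha> = h \<alpha> (Gdec.comp v \<alpha>)" for v \<alpha>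
    unfolding U_def by (subst Gdec.comp_blockwise[OF lin stab]) (auto simp: Gdec.comp_out h_def)
  interpret U: endomorphism "vscale V" U
    by (intro endomorphism.intro endomorphism_axioms.intro vector_space U_lin)
  have comp_U_pow: "Gdec.comp ((U ^^ k) v) \<alpha>
      = vscale V (exp (- (2 * pi * \<i> * \<alpha>)) ^ k) ((G.shift (exp (2 * pi * \<i> * \<alpha>)) ^^ k) (Gdec.comp v \<alpha>))" for k v \<alpha>
    by (induction k) (simp_all add: comp_U h_shift G.map_scale vs.scale_right_diff_distrib mult_ac)
  have U_nil: "\<exists>k. (U ^^ k) v = 0" for v
  proof -
    have "\<exists>k. (G.shift (exp (2 * pi * \<i> * \<alpha>)) ^^ k) (Gdec.comp v \<alpha>) = 0" for \<alpha>
    proof (cases "\<alpha> \<in> spectrum_exponents V g")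
      case True
      then show ?thesis using Gdec.comp_in[OF True, of v] by (simp add: gen_eigenspace_def)
    qed (auto simp: Gdec.comp_out intro: exI[of _ 0])
    then obtain K where K: "(G.shift (exp (2 * pi * \<i> * \<alpha>)) ^^ K \<alpha>) (Gdec.comp v \<alpha>) = 0" for \<alpha> by metis
    \<comment> \<open>A vector has finitely many nonzero components, so the sum of their nilpotency
      orders is a common order.\<close>
    define M where "M = (\<Sum>\<alpha> | Gdec.comp v \<alpha> \<noteq> 0. K \<alpha>)"
    have "(U ^^ M) v = 0"
    proof (rule Gdec.comp_ext)
      fix \<alpha>
      have "(G.shift (exp (2 * pi * \<i> * \<alpha>)) ^^ M) (Gdec.comp v \<alpha>) = 0"
      proof (cases "Gdec.comp v \<alpha> = 0")
        case False
        then have "K \<alpha> \<le> M" unfolding M_def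
          by (intro member_le_sum) (auto simp: Gdec.finite_comp)
        then show ?thesis by (rule G.shift_funpow_mono[OF K])
      qed simp
      then show "Gdec.comp ((U ^^ M) v) \<alpha> = Gdec.comp 0 \<alpha>" by (simp add: comp_U_pow)
    qed
    then show ?thesis by blast
  qed
  define c where "c = 2 * pi * \<i>"
  have c: "c \<noteq> 0" by (simp add: c_def)
  define L where "L = log_fps c"
  have L0: "fps_nth L 0 = 0" by (simp add: L_def fps_inv_def)
  define N where "N = fps_eval (vscale V) L U"
  have N_lin: "Vector_Spaces.linear (vscale V) (vscale V) N"
    unfolding N_def by (rule U.linear_fps_eval) (rule U_nil)
  interpret N: endomorphism "vscale V" N
    by (intro endomorphism.intro endomorphism_axioms.intro vector_space N_lin)
  have N_nil: "\<exists>k. (N ^^ k) v = 0" for v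
    using U_nil[of v] U.fps_eval_nilpotent[OF _ L0] unfolding N_def by blast
  have "N (semisimple_part V g v) = semisimple_part V g (N v)" for v
  proof -
    have "semisimple_part V g (U v) = U (semisimple_part V g v)" for v
    proof (rule Gdec.comp_ext)
      fix \<alpha>
      interpret h: Vector_Spaces.linear "vscale V" "vscale V" "h \<alpha>" by (rule lin)
      show "Gdec.comp (semisimple_part V g (U v)) \<alpha> = Gdec.comp (U (semisimple_part V g v)) \<alpha>"
        by (simp add: comp_semisimple_part comp_U h.scale)
    qed
    moreover obtain K where "(U ^^ K) v = 0" using U_nil by blast
    ultimately show ?thesis
      unfolding N_def using U.fps_eval_commute[OF linear_semisimple_part] by metis
  qed
  moreover have "g v = exp_SN V g N (2 * pi * \<i>) v" for v
  proof -
    have block: "vscale V (exp (c * \<alpha>)) (fps_eval (vscale V) (fps_exp c) N (Gdec.comp v \<alpha>)) = g (Gdec.comp v \<alpha>)"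
      (is "?l = ?r") for \<alpha>
    proof (cases "\<alpha> \<in> spectrum_exponents V g")
      case True
      define x where "x = Gdec.comp v \<alpha>"
      have x: "x \<in> gen_eigenspace V g \<alpha>" unfolding x_def by (rule Gdec.comp_in[OF True])
      obtain K where K: "(U ^^ K) x = 0" using U_nil by blast
      then have NK: "(N ^^ K) x = 0" unfolding N_def by (rule U.fps_eval_nilpotent[OF _ L0]) simp
      have "fps_eval (vscale V) (fps_exp c oo L) U x = fps_eval (vscale V) (fps_exp c) N x"
        by (simp add: U.fps_eval_compose[OF K L0] N.fps_eval_eq[OF NK]) (simp add: N_def)
      moreover have "fps_exp c oo L = fps_X + 1"
        using fps_inv_fps_exp_compose(2)[OF c] unfolding L_def
        by (simp add: fps_compose_sub_distrib algebra_simps)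
      moreover have "fps_eval (vscale V) (fps_X + 1) U x = U x + x"
        using U.fps_eval_diff[OF K, of "fps_X + 1" 1]
        by (simp add: U.fps_eval_1[OF K] U.fps_eval_X[OF K])
      moreover have "U x = h \<alpha> x"
        unfolding U_def by (rule Gdec.blockwise_summand[OF lin stab x True])
      ultimately have "fps_eval (vscale V) (fps_exp c) N x = vscale V (exp (- (c * \<alpha>))) (g x)"
        by (simp add: h_def c_def)
      then show ?thesis by (simp add: x_def exp_minus)
    next
      case False
      then show ?thesis by (simp add: Gdec.comp_out fps_eval_def)
    qed
    have "g v = g (\<Sum>\<alpha> | Gdec.comp v \<alpha> \<noteq> 0. Gdec.comp v \<alpha>)" by (simp add: Gdec.sum_comp)
    then show ?thesis
      using exp_SN_eq[OF N.endomorphism_axioms N_nil, of c v] block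
      by (simp add: G.map_sum c_def)
  qed
  ultimately show ?thesis using N_lin N_nil by blast
qed

lemma nilpotent_part: "Vector_Spaces.linear (vscale V) (vscale V) (nilpotent_part V g)"
    "\<exists>k. (nilpotent_part V g ^^ k) v = 0"
    "nilpotent_part V g (semisimple_part V g v) = semisimple_part V g (nilpotent_part V g v)"
    "g v = exp_SN V g (nilpotent_part V g) (2 * pi * \<i>) v"
  using someI_ex[OF nilpotent_part_exists] unfolding nilpotent_part_def[symmetric] by blast+

sublocale N: endomorphism "vscale V" "nilpotent_part V g"
  by (intro endomorphism.intro endomorphism_axioms.intro vector_space nilpotent_part(1))

lemma exp_L_eq:
  assumes "\<alpha> \<in> spectrum_exponents V g" "v \<in> gen_eigenspace V g \<alpha>"
  shows "exp_L V g c v = vscale V (exp (c * \<alpha>)) (fps_eval (vscale V) (fps_exp c) (nilpotent_part V g) v)"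
proof (cases "v = 0")
  case True
  then show ?thesis by (simp add: exp_L_def exp_SN_def eigencomponent_eq fps_eval_def)
next
  case False
  have "{\<beta>. Gdec.comp v \<beta> \<noteq> 0} = {\<alpha>}"
    using False by (auto simp: Gdec.comp_of_summand[OF assms(2,1)])
  then show ?thesis
    unfolding exp_L_def using exp_SN_eq[OF N.endomorphism_axioms nilpotent_part(2), of c v]
    by (simp add: Gdec.comp_self[OF assms(2,1)])
qed

lemma exp_L_zero [simp]: "exp_L V g c 0 = 0"
  by (simp add: exp_L_def exp_SN_def eigencomponent_eq)

text \<open>On a generalized eigenspace, \<open>N\<close> is a polynomial in \<open>g\<close>: it is the logarithm of the unipotent
  part of \<open>g\<close>.\<close>

lemma nilpotent_part_stable:
  assumes \<alpha>: "\<alpha> \<in> spectrum_exponents V g"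
    and Y: "vs.subspace Y" "\<And>y. y \<in> Y \<Longrightarrow> g y \<in> Y" "Y \<subseteq> gen_eigenspace V g \<alpha>" and v: "v \<in> Y"
  shows "nilpotent_part V g v \<in> Y"
proof -
  let ?N = "nilpotent_part V g"
  define c where "c = 2 * pi * \<i>"
  have c: "c \<noteq> 0" by (simp add: c_def)
  define E where "E = fps_exp c - 1"
  have E0: "fps_nth E 0 = 0" by (simp add: E_def)
  have E: "fps_eval (vscale V) E ?N x \<in> Y" if x: "x \<in> Y" for x
  proof -
    obtain K where K: "(?N ^^ K) x = 0" using nilpotent_part(2) by blast
    have "g x = vscale V (exp (c * \<alpha>)) (fps_eval (vscale V) (fps_exp c) ?N x)"
      using nilpotent_part(4)[of x] exp_L_eq[OF \<alpha>, of x c] Y(3) x by (auto simp: exp_L_def c_def)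
    then have "fps_eval (vscale V) E ?N x = vscale V (exp (- (c * \<alpha>))) (g x) - x"
      by (simp add: E_def N.fps_eval_diff[OF K] N.fps_eval_1[OF K] exp_minus)
    then show ?thesis using Y x by (simp add: vs.subspace_diff vs.subspace_scale)
  qed
  have pow: "(fps_eval (vscale V) E ?N ^^ i) v \<in> Y" for i
    by (induction i) (simp_all add: v E)
  obtain K where K: "(?N ^^ K) v = 0" using nilpotent_part(2) by blast
  have "?N v = fps_eval (vscale V) (log_fps c oo E) ?N v"
    using fps_inv_fps_exp_compose(1)[OF c] by (simp add: E_def N.fps_eval_X[OF K])
  also have "\<dots> \<in> Y"
    unfolding N.fps_eval_compose[OF K E0] using pow Y(1)
    by (auto intro: vs.subspace_sum vs.subspace_scale)
  finally show ?thesis .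
qed

lemma fps_eval_nilpotent_part_stable:
  assumes \<alpha>: "\<alpha> \<in> spectrum_exponents V g"
    and Y: "vs.subspace Y" "\<And>y. y \<in> Y \<Longrightarrow> g y \<in> Y" "Y \<subseteq> gen_eigenspace V g \<alpha>" and v: "v \<in> Y"
  shows "(nilpotent_part V g ^^ k) v \<in> Y" "fps_eval (vscale V) F (nilpotent_part V g) v \<in> Y"
proof -
  have pow: "(nilpotent_part V g ^^ k) v \<in> Y" for k
    by (induction k) (simp_all add: v nilpotent_part_stable[OF \<alpha> Y])
  then show "(nilpotent_part V g ^^ k) v \<in> Y" .
  show "fps_eval (vscale V) F (nilpotent_part V g) v \<in> Y"
    unfolding fps_eval_def using pow Y(1) by (auto intro: vs.subspace_sum vs.subspace_scale)
qed

lemma exp_L_stable: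
  assumes "\<alpha> \<in> spectrum_exponents V g"
    and "vs.subspace Y" "\<And>y. y \<in> Y \<Longrightarrow> g y \<in> Y" "Y \<subseteq> gen_eigenspace V g \<alpha>" and "v \<in> Y"
  shows "exp_L V g c v \<in> Y"
  using assms fps_eval_nilpotent_part_stable(2)[OF assms]
  by (simp add: exp_L_eq[OF assms(1)] subset_iff vs.subspace_scale)

text \<open>The inverse is e^(-cL). The Jacobi identity produces modes of e^(pi i L) v on
  \<open>W2\<close>; to reach a prescribed vector, \<open>v\<close> has to be replaced by its
  preimage within the same joint generalized eigenspace.\<close>

lemma exp_L_surj:
  assumes \<alpha>: "\<alpha> \<in> spectrum_exponents V g"
    and Y: "vs.subspace Y" "\<And>y. y \<in> Y \<Longrightarrow> g y \<in> Y" "Y \<subseteq> gen_eigenspace V g \<alpha>" and v: "v \<in> Y"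
  shows "\<exists>u\<in>Y. exp_L V g c u = v"
proof
  let ?N = "nilpotent_part V g"
  let ?u = "fps_eval (vscale V) (fps_exp (- c)) ?N (vscale V (exp (- (c * \<alpha>))) v)"
  have v': "vscale V (exp (- (c * \<alpha>))) v \<in> Y" using Y(1) v by (rule vs.subspace_scale)
  then show u: "?u \<in> Y" using fps_eval_nilpotent_part_stable(2)[OF \<alpha> Y] by blast
  obtain K where K: "(?N ^^ K) (vscale V (exp (- (c * \<alpha>))) v) = 0" using nilpotent_part(2) by blast
  have "fps_eval (vscale V) (fps_exp c) ?N ?u = vscale V (exp (- (c * \<alpha>))) v"
    using N.fps_eval_mult[OF K, of "fps_exp c" "fps_exp (- c)"] fps_exp_add_mult[of c "- c"]
    by (simp add: N.fps_eval_1[OF K])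
  then show "exp_L V g c ?u = v"
    using exp_L_eq[OF \<alpha>, of ?u c] u Y(3) by (auto simp: exp_minus)
qed

end


section \<open>Formal series\<close>

lemma formal_sum_nonzero:
  assumes "formal_sum \<mu> c m \<noteq> 0" shows "\<exists>i. \<mu> i = m \<and> c i \<noteq> 0"
proof (rule ccontr)
  assume "\<not> ?thesis"
  then have "{i. \<mu> i = m \<and> c i \<noteq> 0} = {}" by blast
  then have "formal_sum \<mu> c m = 0" by (simp only: formal_sum_def sum.empty)
  then show False using assms by contradiction
qed

lemma formal_sum_reindex:
  assumes "finite S" "inj_on h S" "\<And>s. s \<in> S \<Longrightarrow> \<mu> (h s) = m"
    and "\<And>i. \<mu> i = m \<Longrightarrow> c i \<noteq> 0 \<Longrightarrow> i \<in> h ` S"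
  shows "formal_sum \<mu> c m = (\<Sum>s\<in>S. c (h s))"
proof -
  have "formal_sum \<mu> c m = (\<Sum>i\<in>h ` S. c i)"
    unfolding formal_sum_def using assms by (intro sum.mono_neutral_left) auto
  then show ?thesis by (simp add: sum.reindex[OF assms(2)])
qed

lemma formal_sum_unique:
  assumes "\<mu> p = m" "\<And>i. \<mu> i = m \<Longrightarrow> c i \<noteq> 0 \<Longrightarrow> i = p"
  shows "formal_sum \<mu> c m = c p"
  using formal_sum_reindex[of "{()}" "\<lambda>_. p" \<mu> m c] assms by auto

lemma (in vector_space) formal_sum_in_subspace:
  assumes "subspace Y" "\<And>i. \<mu> i = m \<Longrightarrow> c i \<in> Y"
  shows "formal_sum \<mu> c m \<in> Y"
  unfolding formal_sum_def using assms by (auto intro!: subspace_sum)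

lemma monomial_add_zero_log:
  fixes m1 m2 :: monomial
  shows "snd (m1 + m2) = 0 \<longleftrightarrow> snd m1 = 0 \<and> snd m2 = 0"
  by (auto simp: fun_eq_iff)

lemma log_series_apply:
  "log_series f t (e, l) = (if e = 0(t := e t) \<and> l = 0(t := l t) then f (- e t - 1) (l t) else 0)"
proof (cases "e = 0(t := e t) \<and> l = 0(t := l t)")
  case True
  have "log_series f t (e, l) = (case (- e t - 1, l t) of (n, k) \<Rightarrow> f n k)"
    unfolding log_series_def
  proof (rule formal_sum_unique)
    show "(case (- e t - 1, l t) of (n, k) \<Rightarrow> xpow t (- n - 1) + logpow t k) = (e, l)"
      using True by (auto simp: xpow_def logpow_def)
    fix i assume "(case i of (n, k) \<Rightarrow> xpow t (- n - 1) + logpow t k) = (e, l)"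
    then show "i = (- e t - 1, l t)"
      by (auto simp: xpow_def logpow_def split: prod.splits)
  qed
  then show ?thesis using True by simp
next
  case False
  have "log_series f t (e, l) = 0"
  proof (rule ccontr)
    assume "log_series f t (e, l) \<noteq> 0"
    then obtain n k where "xpow t (- n - 1) + logpow t k = (e, l)"
      unfolding log_series_def by (auto dest!: formal_sum_nonzero)
    then have "e = 0(t := - n - 1)" "l = 0(t := k)"
      by (auto simp: xpow_def logpow_def)
    then show False using False by auto
  qed
  then show ?thesis by (simp only: if_not_P[OF False])
qed

lemma log_series_coeff: "log_series f t (0(t := a), 0(t := k)) = f (- a - 1) k"
  by (simp add: log_series_apply)


lemma smul_single_coeff:
  fixes sc :: "complex \<Rightarrow> 'a::ab_group_add \<Rightarrow> 'a"
  assumes "vector_space sc"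
  shows "smul sc (single (xpow t a)) F (e, l) = F (e(t := e t - a), l)"
proof -
  interpret sc: vector_space sc by fact
  let ?p = "(xpow t a, (e(t := e t - a), l))"
  let ?c = "\<lambda>(m, n). sc (single (xpow t a) m) (F n)"
  have "formal_sum (\<lambda>(m, n). m + n) ?c (e, l) = ?c ?p"
  proof (rule formal_sum_unique)
    show "(case ?p of (m, n) \<Rightarrow> m + n) = (e, l)" by (auto simp: xpow_def fun_eq_iff)
    fix i assume "(case i of (m, n) \<Rightarrow> m + n) = (e, l)" "?c i \<noteq> 0"
    then show "i = ?p"
      by (force simp: single_def xpow_def fun_eq_iff eq_diff_eq add.commute split: if_splits prod.splits)
  qed
  then show ?thesis by (simp add: smul_def single_def)
qed

lemma fderiv_log_series:
  "fderiv sc t (log_series f t) (0(t := - n - 2), 0(t := k))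
    = sc (- n - 1) (f n k) + sc (of_nat (k + 1)) (f n (k + 1))"
  by (simp add: fderiv_def log_series_coeff diff_diff_eq2 minus_diff_commute)

section \<open>Coefficients of products at monomials without logarithms\<close>

definition exps :: "fvar \<Rightarrow> fvar \<Rightarrow> complex \<Rightarrow> complex \<Rightarrow> complex \<Rightarrow> monomial" where
  "exps z x a b c = (0(X2 := c, x := b, z := a), 0)"

text \<open>Two terms of the Jacobi identity contain a binomial in \<open>X2\<close> and another
  variable \<open>z\<close>, divided by the third variable \<open>x\<close>. They differ by
  exchanging \<open>X0\<close> and \<open>X1\<close>, so both are treated with \<open>z\<close> and
  \<open>x\<close> as parameters.\<close>

locale fvar_pair =
  fixes z x :: fvar
  assumes zx: "z \<noteq> x" "z \<noteq> X2" "x \<noteq> X2"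
begin

lemma exps_eq_iff: "exps z x a b c = exps z x a' b' c' \<longleftrightarrow> a = a' \<and> b = b' \<and> c = c'"
proof
  assume eq: "exps z x a b c = exps z x a' b' c'"
  show "a = a' \<and> b = b' \<and> c = c'"
    using arg_cong[OF eq, of "\<lambda>m. fst m z"] arg_cong[OF eq, of "\<lambda>m. fst m x"]
      arg_cong[OF eq, of "\<lambda>m. fst m X2"] zx by (simp add: exps_def)
qed simp

lemma exps_add: "exps z x a b c + exps z x a' b' c' = exps z x (a + a') (b + b') (c + c')"
  by (auto simp: exps_def fun_eq_iff)

lemma exps_surj: "snd m = 0 \<Longrightarrow> \<exists>a b c. m = exps z x a b c"
proof -
  assume "snd m = 0"
  moreover have "fst m = 0(X2 := fst m X2, x := fst m x, z := fst m z)"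
  proof
    fix t show "fst m t = (0(X2 := fst m X2, x := fst m x, z := fst m z)) t"
      using zx by (cases t; cases z; cases x) auto
  qed
  ultimately have "m = exps z x (fst m z) (fst m x) (fst m X2)"
    by (simp add: exps_def prod_eq_iff)
  then show ?thesis by blast
qed

lemma snd_exps [simp]: "snd (exps z x a b c) = 0"
  by (simp add: exps_def)

lemma exps_add_eqD:
  assumes "m1 + m2 = exps z x a b c"
  obtains a1 b1 c1 where "m1 = exps z x a1 b1 c1" "m2 = exps z x (a - a1) (b - b1) (c - c1)"
proof -
  have "snd m1 = 0" "snd m2 = 0"
    using monomial_add_zero_log[of m1 m2] by (simp_all add: assms)
  then obtain a1 b1 c1 a2 b2 c2 where "m1 = exps z x a1 b1 c1" "m2 = exps z x a2 b2 c2"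
    using exps_surj by metis
  then show ?thesis using that assms by (auto simp: exps_add exps_eq_iff)
qed

text \<open>Factors of a logarithm-free monomial are logarithm-free, so the factorizations that
  contribute are given by triples of exponents. The set \<open>S\<close> enumerates those where the
  summand may be nonzero, each once.\<close>

lemma pair_sum_exps:
  fixes f :: "monomial \<Rightarrow> monomial \<Rightarrow> 'b::comm_monoid_add"
  assumes "finite S" and inj: "inj_on (\<lambda>j. (u j, v j, w j)) S"
    and supp: "\<And>a1 b1 c1. f (exps z x a1 b1 c1) (exps z x (a - a1) (b - b1) (c - c1)) \<noteq> 0 \<Longrightarrow>
      \<exists>j\<in>S. a1 = u j \<and> b1 = v j \<and> c1 = w j"
  shows "formal_sum (\<lambda>(m1, m2). m1 + m2) (\<lambda>(m1, m2). f m1 m2) (exps z x a b c)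
    = (\<Sum>j\<in>S. f (exps z x (u j) (v j) (w j)) (exps z x (a - u j) (b - v j) (c - w j)))"
proof -
  let ?h = "\<lambda>j. (exps z x (u j) (v j) (w j), exps z x (a - u j) (b - v j) (c - w j))"
  have "formal_sum (\<lambda>(m1, m2). m1 + m2) (\<lambda>(m1, m2). f m1 m2) (exps z x a b c)
      = (\<Sum>j\<in>S. case ?h j of (m1, m2) \<Rightarrow> f m1 m2)"
  proof (rule formal_sum_reindex[OF assms(1)])
    show "inj_on ?h S" using inj by (auto simp: inj_on_def exps_eq_iff)
    fix p assume p: "(case p of (m1, m2) \<Rightarrow> m1 + m2) = exps z x a b c"
      "(case p of (m1, m2) \<Rightarrow> f m1 m2) \<noteq> 0"
    obtain m1 m2 where m: "p = (m1, m2)" by (cases p)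
    then obtain a1 b1 c1 where 1: "m1 = exps z x a1 b1 c1" "m2 = exps z x (a - a1) (b - b1) (c - c1)"
      using p(1) by (auto elim: exps_add_eqD)
    show "p \<in> ?h ` S" using supp[of a1 b1 c1] p(2) unfolding m 1 by auto
  qed (simp add: exps_add)
  then show ?thesis by simp
qed

lemma pair_sum_exps_0:
  assumes "\<And>a1 b1 c1. f (exps z x a1 b1 c1) (exps z x (a - a1) (b - b1) (c - c1)) = 0"
  shows "formal_sum (\<lambda>(m1, m2). m1 + m2) (\<lambda>(m1, m2). f m1 m2) (exps z x a b c) = 0"
  by (subst pair_sum_exps[where S = "{} :: nat set"]) (simp_all add: assms)

lemma xpow_exps: "xpow z a = exps z x a 0 0" "xpow x b = exps z x 0 b 0" "xpow X2 c = exps z x 0 0 c"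
  using zx by (auto simp: xpow_def exps_def fun_eq_iff)

lemma log_series_exps:
  "log_series f z (exps z x a b c) = (if b = 0 \<and> c = 0 then f (- a - 1) 0 else 0)"
  "log_series f X2 (exps z x a b c) = (if a = 0 \<and> b = 0 then f (- c - 1) 0 else 0)"
proof -
  have "0(X2 := c, x := b, z := a) = 0(z := a) \<longleftrightarrow> b = 0 \<and> c = 0"
    "0(X2 := c, x := b, z := a) = 0(X2 := c) \<longleftrightarrow> a = 0 \<and> b = 0"
    using exps_eq_iff[of a b c a 0 0] exps_eq_iff[of a b c 0 0 c] xpow_exps(1)[of a] xpow_exps(3)[of c]
    by (simp_all add: exps_def xpow_def)
  then show "log_series f z (exps z x a b c) = (if b = 0 \<and> c = 0 then f (- a - 1) 0 else 0)"
    "log_series f X2 (exps z x a b c) = (if a = 0 \<and> b = 0 then f (- c - 1) 0 else 0)"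
    using zx by (auto simp: exps_def log_series_apply fun_upd_idem)
qed

lemma delta_exps:
  "delta X2 \<epsilon> z \<eta> x (exps z x (of_nat i) (- of_int n - 1) (of_int n - of_nat i))
    = \<eta> powi (- n) * (of_int n gchoose i) * \<epsilon> ^ i"
  unfolding delta_def xpow_exps exps_add
  by (subst formal_sum_unique[of _ "(n, i)"]) (auto simp: exps_eq_iff)

lemma delta_nonzero:
  assumes "delta X2 \<epsilon> z \<eta> x (exps z x a b c) \<noteq> 0"
  obtains n :: int and i :: nat where "a = of_nat i" "b = - of_int n - 1" "c = of_int n - of_nat i"
  using assms unfolding delta_def xpow_exps exps_add
  by (auto dest!: formal_sum_nonzero simp: exps_eq_iff)

text \<open>The delta series has only integral exponents of \<open>x\<close>, and \<open>F\<close>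
  only the exponent \<beta>. Hence the exponent of \<open>x\<close> in the product fixes
  \<open>n\<close>, and only the expansion index \<open>i\<close> of the binomial remains;
  truncation of \<open>F\<close> in \<open>z\<close> bounds it.\<close>

lemma smul_delta:
  fixes sc :: "complex \<Rightarrow> 'b::ab_group_add \<Rightarrow> 'b"
  assumes sc: "vector_space sc"
    and F: "\<And>a b c. F (exps z x a b c) \<noteq> 0 \<Longrightarrow> b = \<beta>"
    and K: "\<And>i. i \<ge> K \<Longrightarrow> F (exps z x (a - of_nat i) \<beta> (c - of_int n + of_nat i)) = 0"
  shows "smul sc (delta X2 \<epsilon> z \<eta> x) F (exps z x a (\<beta> - of_int n - 1) c)
    = (\<Sum>i<K. sc (\<eta> powi (- n) * (of_int n gchoose i) * \<epsilon> ^ i)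
        (F (exps z x (a - of_nat i) \<beta> (c - of_int n + of_nat i))))"
proof -
  interpret vector_space sc by fact
  have "smul sc (delta X2 \<epsilon> z \<eta> x) F (exps z x a (\<beta> - of_int n - 1) c)
    = (\<Sum>i<K. sc (delta X2 \<epsilon> z \<eta> x (exps z x (of_nat i) (- of_int n - 1) (of_int n - of_nat i)))
        (F (exps z x (a - of_nat i) (\<beta> - of_int n - 1 - (- of_int n - 1)) (c - (of_int n - of_nat i)))))"
    unfolding smul_def
  proof (rule pair_sum_exps)
    fix a1 b1 c1
    assume "sc (delta X2 \<epsilon> z \<eta> x (exps z x a1 b1 c1))
      (F (exps z x (a - a1) (\<beta> - of_int n - 1 - b1) (c - c1))) \<noteq> 0"
    then have nz: "delta X2 \<epsilon> z \<eta> x (exps z x a1 b1 c1) \<noteq> 0"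
      "F (exps z x (a - a1) (\<beta> - of_int n - 1 - b1) (c - c1)) \<noteq> 0" by auto
    obtain k i where ki: "a1 = of_nat i" "b1 = - of_int k - 1" "c1 = of_int k - of_nat i"
      using delta_nonzero[OF nz(1)] by metis
    have "real_of_int k = real_of_int n"
      using arg_cong[OF ki(2), of Re] arg_cong[OF F[OF nz(2)], of Re] by simp
    then have k: "k = n" by (simp only: of_int_eq_iff)
    have "F (exps z x (a - of_nat i) \<beta> (c - of_int n + of_nat i)) \<noteq> 0"
      using nz(2) unfolding ki k by (simp add: algebra_simps)
    then have "i < K" using K[of i] by (meson not_le)
    then show "\<exists>i\<in>{..<K}. a1 = of_nat i \<and> b1 = - of_int n - 1 \<and> c1 = of_int n - of_nat i"
      using ki unfolding k by blast
  qed (auto simp: inj_on_def)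
  then show ?thesis by (simp add: delta_exps algebra_simps)
qed

text \<open>In the application \<open>Q\<close> is the expansion of a quotient raised to the power
  \<open>L\<close>, applied to a vector of exponent \<gamma>, with \<open>B j\<close> its
  coefficient at the \<open>j\<close>-th power of \<open>z\<close>. The arguments of
  \<open>h\<close> are the mode indices read off from the exponents of \<open>z\<close> and
  \<open>X2\<close>.\<close>

lemma series_apply_exps:
  fixes Q :: "'a::ab_group_add series" and Inn :: "'a \<Rightarrow> 'b::ab_group_add series"
  assumes Q: "\<And>a b c. Q (exps z x a b c) \<noteq> 0 \<Longrightarrow> \<exists>j::nat. a = of_nat j \<and> b = - \<gamma> \<and> c = \<gamma> - of_nat j"
    and B: "\<And>j. Q (exps z x (of_nat j) (- \<gamma>) (\<gamma> - of_nat j)) = B j"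
    and Inn: "\<And>v a b c. Inn v (exps z x a b c) = (if b = 0 then h v (- a - 1) (- c - 1) else 0)"
    and Inn0: "\<And>m. Inn 0 m = 0"
    and K: "\<And>j. j \<ge> K \<Longrightarrow> h (B j) (of_nat j - a - 1) (\<gamma> - of_nat j - c - 1) = 0"
  shows "(Inn \<odot> Q) (exps z x a b c)
    = (if b = - \<gamma> then \<Sum>j<K. h (B j) (of_nat j - a - 1) (\<gamma> - of_nat j - c - 1) else 0)"
proof -
  have supp: "b = - \<gamma> \<and> (\<exists>j<K. a1 = of_nat j \<and> b1 = - \<gamma> \<and> c1 = \<gamma> - of_nat j)"
    if nz: "Inn (Q (exps z x a1 b1 c1)) (exps z x (a - a1) (b - b1) (c - c1)) \<noteq> 0" for a1 b1 c1
  proof -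
    have "Q (exps z x a1 b1 c1) \<noteq> 0" using nz by (metis Inn0)
    then obtain j where j: "a1 = of_nat j" "b1 = - \<gamma>" "c1 = \<gamma> - of_nat j" using Q by blast
    have b: "b = b1" using nz unfolding Inn by (auto split: if_splits)
    have "h (B j) (of_nat j - a - 1) (\<gamma> - of_nat j - c - 1) \<noteq> 0"
      using nz unfolding Inn b j B by (simp add: algebra_simps)
    then have "j < K" using K[of j] by (meson not_le)
    then show ?thesis using b j by blast
  qed
  show ?thesis
  proof (cases "b = - \<gamma>")
    case True
    have "(Inn \<odot> Q) (exps z x a b c) = (\<Sum>j<K. Inn (Q (exps z x (of_nat j) (- \<gamma>) (\<gamma> - of_nat j)))
        (exps z x (a - of_nat j) (b - - \<gamma>) (c - (\<gamma> - of_nat j))))"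
      unfolding series_apply_def
      by (rule pair_sum_exps) (simp, simp add: inj_on_def, use supp in blast)
    then show ?thesis using True by (simp add: B Inn algebra_simps)
  next
    case False
    have "(Inn \<odot> Q) (exps z x a b c) = 0"
      unfolding series_apply_def by (rule pair_sum_exps_0) (use supp False in blast)
    then show ?thesis using False by simp
  qed
qed

text \<open>Truncation concerns only the mode index belonging to \<open>z\<close>, so one bound
  \<open>M\<close> serves all exponents \<open>c\<close> of \<open>X2\<close>. This uniformity
  allows the identity to be read later as a relation between families.\<close>

lemma smul_delta_double:
  fixes sc :: "complex \<Rightarrow> 'b::ab_group_add \<Rightarrow> 'b"
  assumes sc: "vector_space sc"
    and F: "\<And>a b c K. (\<And>j. K \<le> j \<Longrightarrow> N \<le> Re (of_nat j - a - 1)) \<Longrightarrow> F (exps z x a b c)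
      = (if b = - \<gamma> then \<Sum>j<K. H j (of_nat j - a - 1) (\<gamma> - of_nat j - c - 1) else 0)"
    and N: "\<And>j m n. N \<le> Re m \<Longrightarrow> H j m n = 0"
  shows "\<exists>M>0. \<forall>c. smul sc (delta X2 \<epsilon> z \<eta> x) F (exps z x a (- \<gamma> - of_int n - 1) c)
    = (\<Sum>i<M. \<Sum>j<M. sc (\<eta> powi (- n) * (of_int n gchoose i) * \<epsilon> ^ i)
        (H j (of_nat i + of_nat j - a - 1) (\<gamma> + of_int n - of_nat i - of_nat j - c - 1)))"
proof -
  interpret vector_space sc by fact
  \<comment> \<open>From this bound on, either index alone pushes the mode index past the truncation
    bound \<open>N\<close>. The successor keeps the leading term (0, 0) inside the range.\<close>
  define M where "M = Suc (nat \<lceil>N + Re a + 1\<rceil>)"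
  have M: "N \<le> real i + real j - Re a - 1" if "M \<le> i \<or> M \<le> j" for i j
    using that unfolding M_def by linarith
  have Fval: "F (exps z x (a - of_nat i) b c)
      = (if b = - \<gamma> then \<Sum>j<M. H j (of_nat i + of_nat j - a - 1) (\<gamma> - of_nat j - c - 1) else 0)" for i b c
    using M[of i] by (subst F[of M]) (simp_all add: algebra_simps)
  have supp: "b = - \<gamma>" if nz: "F (exps z x a' b c) \<noteq> 0" for a' b c
  proof (rule ccontr)
    assume b: "b \<noteq> - \<gamma>"
    define K where "K = nat \<lceil>N + Re a' + 1\<rceil>"
    have "N \<le> Re (of_nat j - a' - 1)" if "K \<le> j" for j
      using that unfolding K_def by simp linarith
    then show False using F[of K a' b c] nz b by simp
  qed
  have "smul sc (delta X2 \<epsilon> z \<eta> x) F (exps z x a (- \<gamma> - of_int n - 1) c)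
    = (\<Sum>i<M. sc (\<eta> powi (- n) * (of_int n gchoose i) * \<epsilon> ^ i)
        (F (exps z x (a - of_nat i) (- \<gamma>) (c - of_int n + of_nat i))))" for c
  proof (rule smul_delta[OF sc supp])
    show "F (exps z x (a - of_nat i) (- \<gamma>) (c - of_int n + of_nat i)) = 0" if "M \<le> i" for i
      unfolding Fval using M[of i] that by (auto intro!: sum.neutral N)
  qed
  then have "smul sc (delta X2 \<epsilon> z \<eta> x) F (exps z x a (- \<gamma> - of_int n - 1) c)
    = (\<Sum>i<M. \<Sum>j<M. sc (\<eta> powi (- n) * (of_int n gchoose i) * \<epsilon> ^ i)
        (H j (of_nat i + of_nat j - a - 1) (\<gamma> + of_int n - of_nat i - of_nat j - c - 1)))" for c
    by (simp add: Fval scale_sum_right algebra_simps)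
  then show ?thesis by (intro exI[of _ M]) (simp add: M_def)
qed

end


section \<open>Expansion of a quotient raised to the power of the logarithm of an
  automorphism\<close>

lemma single_zero_log: "single (logpow t 1) (e, 0) = 0"
proof -
  have "(0 :: fvar \<Rightarrow> nat) \<noteq> 0(t := 1)" by (metis fun_upd_same zero_fun_apply zero_neq_one)
  then show ?thesis by (simp add: single_def logpow_def)
qed

lemma log_quotient_support:
  assumes "log_quotient y \<epsilon> z x m \<noteq> 0" "snd m = 0"
  shows "\<exists>i. m = xpow y (- of_nat (Suc i)) + xpow z (of_nat (Suc i))"
proof -
  obtain e where m: "m = (e, 0)" using assms(2) by (cases m) auto
  have "formal_sum (\<lambda>i::nat. xpow y (- of_nat (Suc i)) + xpow z (of_nat (Suc i)))
         (\<lambda>i. (-1) ^ i * \<epsilon> ^ Suc i / of_nat (Suc i)) m \<noteq> 0"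
    using assms(1) unfolding log_quotient_def m by (simp only: plus_fun_apply minus_apply single_zero_log) simp
  from formal_sum_nonzero[OF this] show ?thesis by metis
qed

lemma xpow_add: "xpow t a + xpow t b = xpow t (a + b)"
  by (auto simp: xpow_def fun_eq_iff)

lemma snd_xpow [simp]: "snd (xpow t a) = 0"
  by (simp add: xpow_def)

lemma xpow_zero [simp]: "xpow t 0 = 0"
  by (auto simp: xpow_def fun_eq_iff zero_prod_def)

lemma smul_nonzero:
  fixes f h :: "complex series"
  assumes "smul (*) f h m \<noteq> 0"
  obtains m1 m2 where "m = m1 + m2" "f m1 \<noteq> 0" "h m2 \<noteq> 0"
  using assms unfolding smul_def by (auto dest!: formal_sum_nonzero)

lemma smul_unique:
  fixes f h :: "complex series"
  assumes "\<And>m1 m2. m1 + m2 = a + b \<Longrightarrow> h m2 \<noteq> 0 \<Longrightarrow> m2 = b"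
  shows "smul (*) f h (a + b) = f a * h b"
proof -
  have "smul (*) f h (a + b) = (case (a, b) of (m1, m2) \<Rightarrow> f m1 * h m2)"
    unfolding smul_def
  proof (rule formal_sum_unique)
    fix p assume p: "(case p of (m1, m2) \<Rightarrow> m1 + m2) = a + b" "(case p of (m1, m2) \<Rightarrow> f m1 * h m2) \<noteq> 0"
    obtain m1 m2 where m: "p = (m1, m2)" by (cases p)
    then have "m2 = b" using assms[of m1 m2] p by simp
    then show "p = (a, b)" using p(1) m by simp
  qed simp
  then show ?thesis by simp
qed

text \<open>Without its logarithmic summands, the logarithm of the quotient is log(1 + \<epsilon> z
  / y), which has no constant term. Its \<open>k\<close>-th power therefore starts in degree
  \<open>k\<close> of z / y, so the terms with a positive power of the nilpotent part do not reach
  the leading coefficient.\<close>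

lemma series_power_support:
  "series_power (log_quotient y \<epsilon> z x) k m \<noteq> 0 \<Longrightarrow> snd m = 0 \<Longrightarrow>
    \<exists>i\<ge>k. m = xpow y (- of_nat i) + xpow z (of_nat i)"
proof (induction k arbitrary: m)
  case 0
  then have "m = 0" by (auto simp: series_power_def single_def split: if_splits)
  then show ?case by (intro exI[of _ 0]) simp
next
  case (Suc k)
  let ?f = "log_quotient y \<epsilon> z x"
  have "smul (*) ?f (series_power ?f k) m \<noteq> 0"
    using Suc.prems(1) by (simp add: series_power_def)
  then obtain m1 m2 where m: "m = m1 + m2" "?f m1 \<noteq> 0" "series_power ?f k m2 \<noteq> 0"
    by (rule smul_nonzero)
  then have "snd m1 = 0" "snd m2 = 0" using Suc.prems(2) monomial_add_zero_log m(1) by blast+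
  then obtain i j where ij: "m1 = xpow y (- of_nat (Suc i)) + xpow z (of_nat (Suc i))"
    "j \<ge> k" "m2 = xpow y (- of_nat j) + xpow z (of_nat j)"
    using log_quotient_support m(2) Suc.IH[OF m(3)] by blast
  have "m = (xpow y (- of_nat (Suc i)) + xpow y (- of_nat j)) + (xpow z (of_nat (Suc i)) + xpow z (of_nat j))"
    unfolding m(1) ij by (simp add: add_ac)
  then have "m = xpow y (- of_nat (Suc i + j)) + xpow z (of_nat (Suc i + j))"
    unfolding xpow_add by (simp add: algebra_simps)
  then show ?case using ij(2) by (intro exI[of _ "Suc i + j"]) auto
qed

definition quotient_pow_coeff ::
  "fvar \<Rightarrow> complex \<Rightarrow> fvar \<Rightarrow> fvar \<Rightarrow> complex \<Rightarrow> nat \<Rightarrow> complex series" where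
  "quotient_pow_coeff y \<epsilon> z x \<alpha> k =
     smul (*) (smul (*) (binomial_series y \<epsilon> z \<alpha>) (single (xpow x (- \<alpha>))))
       (series_power (log_quotient y \<epsilon> z x) k)"

lemma quotient_pow_coeff_support:
  assumes "quotient_pow_coeff y \<epsilon> z x \<alpha> k m \<noteq> 0" "snd m = 0"
  shows "\<exists>i\<ge>k. m = xpow y (\<alpha> - of_nat i) + xpow z (of_nat i) + xpow x (- \<alpha>)"
proof -
  let ?A = "smul (*) (binomial_series y \<epsilon> z \<alpha>) (single (xpow x (- \<alpha>)))"
  obtain m1 m2 where m: "m = m1 + m2" "?A m1 \<noteq> 0" "series_power (log_quotient y \<epsilon> z x) k m2 \<noteq> 0"
    using assms(1) unfolding quotient_pow_coeff_def by (rule smul_nonzero)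
  then have "snd m1 = 0" "snd m2 = 0" using assms(2) monomial_add_zero_log m(1) by blast+
  then obtain i where i: "i \<ge> k" "m2 = xpow y (- of_nat i) + xpow z (of_nat i)"
    using series_power_support[OF m(3)] by blast
  obtain n1 n2 where n: "m1 = n1 + n2" "binomial_series y \<epsilon> z \<alpha> n1 \<noteq> 0" "single (xpow x (- \<alpha>)) n2 \<noteq> 0"
    using m(2) by (rule smul_nonzero)
  have n2: "n2 = xpow x (- \<alpha>)" using n(3) by (simp add: single_def split: if_splits)
  from n(2) obtain j where j: "n1 = xpow y (\<alpha> - of_nat j) + xpow z (of_nat j)"
    unfolding binomial_series_def by (blast dest: formal_sum_nonzero)
  have "m = (xpow y (\<alpha> - of_nat j) + xpow y (- of_nat i)) + (xpow z (of_nat j) + xpow z (of_nat i)) + xpow x (- \<alpha>)"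
    unfolding m(1) n(1) n2 i(2) j by (simp add: add_ac)
  then have "m = xpow y (\<alpha> - of_nat (i + j)) + xpow z (of_nat (i + j)) + xpow x (- \<alpha>)"
    unfolding xpow_add by (simp add: algebra_simps)
  then show ?thesis using i(1) by (intro exI[of _ "i + j"]) auto
qed

lemma quotient_pow_coeff_lead:
  assumes "y \<noteq> z"
  shows "quotient_pow_coeff y \<epsilon> z x \<alpha> k (xpow y \<alpha> + xpow x (- \<alpha>)) = (if k = 0 then 1 else 0)"
proof (cases "k = 0")
  case True
  have inj: "i = 0" if "xpow y (\<alpha> - of_nat i) + xpow z (of_nat i) = xpow y \<alpha>" for i :: nat
    using arg_cong[OF that, of "\<lambda>m. fst m z"] assms by (simp add: xpow_def)
  have b: "binomial_series y \<epsilon> z \<alpha> (xpow y \<alpha>) = 1"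
    unfolding binomial_series_def by (subst formal_sum_unique[of _ 0]) (auto dest: inj)
  let ?A = "smul (*) (binomial_series y \<epsilon> z \<alpha>) (single (xpow x (- \<alpha>)))"
  have 1: "?A (xpow y \<alpha> + xpow x (- \<alpha>)) = 1"
    by (subst smul_unique) (simp_all add: b single_def split: if_splits)
  have "smul (*) ?A (single 0) (m + 0) = ?A m * single 0 0" for m
    by (rule smul_unique) (simp add: single_def split: if_splits)
  then have "smul (*) ?A (single 0) m = ?A m" for m by (simp add: single_def)
  then show ?thesis using True 1 by (simp add: quotient_pow_coeff_def series_power_def)
next
  case False
  have "quotient_pow_coeff y \<epsilon> z x \<alpha> k (xpow y \<alpha> + xpow x (- \<alpha>)) = 0"
  proof (rule ccontr)
    assume "\<not> ?thesis"
    then obtain i where i: "i \<ge> k"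
      "xpow y \<alpha> + xpow x (- \<alpha>) = xpow y (\<alpha> - of_nat i) + xpow z (of_nat i) + xpow x (- \<alpha>)"
      by (blast dest: quotient_pow_coeff_support intro: monomial_add_zero_log[THEN iffD2] snd_xpow)
    then have "xpow y \<alpha> = xpow y (\<alpha> - of_nat i) + xpow z (of_nat i)" by simp
    from arg_cong[OF this, of "\<lambda>m. fst m z"] have "i = 0" using assms by (simp add: xpow_def)
    then show False using i(1) False by simp
  qed
  then show ?thesis using False by simp
qed

context vertex_algebra_automorphism
begin

lemma quotient_pow_L_eq:
  assumes "\<alpha> \<in> spectrum_exponents V g" "v \<in> gen_eigenspace V g \<alpha>"
  shows "quotient_pow_L V g y \<epsilon> z x v m
    = (\<Sum>k | (nilpotent_part V g ^^ k) v \<noteq> 0.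
        vscale V (quotient_pow_coeff y \<epsilon> z x \<alpha> k m / fact k) ((nilpotent_part V g ^^ k) v))"
proof -
  let ?N = "nilpotent_part V g"
  have "{(\<beta>, k). (?N ^^ k) (Gdec.comp v \<beta>) \<noteq> 0} = (\<lambda>k. (\<alpha>, k)) ` {k. (?N ^^ k) v \<noteq> 0}"
    by (auto simp: Gdec.comp_of_summand[OF assms(2,1)] split: if_splits)
  moreover have "inj_on (\<lambda>k. (\<alpha>, k)) {k. (?N ^^ k) v \<noteq> 0}" by (auto simp: inj_on_def)
  ultimately show ?thesis
    by (simp add: quotient_pow_L_def eigencomponent_eq Let_def sum.reindex quotient_pow_coeff_def
        Gdec.comp_self[OF assms(2,1)])
qed

lemma quotient_pow_L_support:
  assumes \<alpha>: "\<alpha> \<in> spectrum_exponents V g" "v \<in> gen_eigenspace V g \<alpha>"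
    and nz: "quotient_pow_L V g y \<epsilon> z x v m \<noteq> 0" and m: "snd m = 0"
  shows "\<exists>i. m = xpow y (\<alpha> - of_nat i) + xpow z (of_nat i) + xpow x (- \<alpha>)"
proof -
  obtain k where "quotient_pow_coeff y \<epsilon> z x \<alpha> k m \<noteq> 0"
  proof (rule ccontr)
    assume "\<not> thesis"
    then have "quotient_pow_coeff y \<epsilon> z x \<alpha> k m = 0" for k using that by blast
    then show False using nz by (simp add: quotient_pow_L_eq[OF \<alpha>])
  qed
  then show ?thesis using quotient_pow_coeff_support m by blast
qed

lemma quotient_pow_L_lead:
  assumes \<alpha>: "\<alpha> \<in> spectrum_exponents V g" "v \<in> gen_eigenspace V g \<alpha>" and "y \<noteq> z"
  shows "quotient_pow_L V g y \<epsilon> z x v (xpow y \<alpha> + xpow x (- \<alpha>)) = v"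
proof -
  let ?N = "nilpotent_part V g"
  obtain K where K: "(?N ^^ K) v = 0" using nilpotent_part(2) by blast
  have "quotient_pow_L V g y \<epsilon> z x v (xpow y \<alpha> + xpow x (- \<alpha>))
      = fps_eval (vscale V) 1 ?N v"
    unfolding quotient_pow_L_eq[OF \<alpha>] quotient_pow_coeff_lead[OF assms(3)] fps_eval_def
    by (intro sum.cong) auto
  then show ?thesis by (simp add: N.fps_eval_1[OF K])
qed

text \<open>Every coefficient is a combination of iterates of the nilpotent part on
  \<open>v\<close>. Applied to joint spaces, this keeps all vectors in the expansion at the weight
  and the two exponents of \<open>v\<close>.\<close>

lemma quotient_pow_L_stable:
  assumes \<alpha>: "\<alpha> \<in> spectrum_exponents V g"
    and Y: "vs.subspace Y" "\<And>y. y \<in> Y \<Longrightarrow> g y \<in> Y" "Y \<subseteq> gen_eigenspace V g \<alpha>" and v: "v \<in> Y"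
  shows "quotient_pow_L V g y \<epsilon> z x v m \<in> Y"
proof -
  have "v \<in> gen_eigenspace V g \<alpha>" using Y v by blast
  then show ?thesis
    unfolding quotient_pow_L_eq[OF \<alpha> \<open>v \<in> gen_eigenspace V g \<alpha>\<close>]
    using fps_eval_nilpotent_part_stable(1)[OF \<alpha> Y v]
    by (intro vs.subspace_sum[OF Y(1)] vs.subspace_scale[OF Y(1)])
qed

end

lemma (in fvar_pair) quotient_pow_L_exps:
  assumes aut: "vertex_algebra_automorphism V g"
    and \<alpha>: "\<alpha> \<in> spectrum_exponents V g" "v \<in> gen_eigenspace V g \<alpha>"
  shows "quotient_pow_L V g X2 \<epsilon> z x v (exps z x a b c) \<noteq> 0 \<Longrightarrow>
      \<exists>j::nat. a = of_nat j \<and> b = - \<alpha> \<and> c = \<alpha> - of_nat j"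
    and "quotient_pow_L V g X2 \<epsilon> z x v (exps z x (of_nat 0) (- \<alpha>) (\<alpha> - of_nat 0)) = v"
proof -
  interpret vertex_algebra_automorphism V g by fact
  show "\<exists>j::nat. a = of_nat j \<and> b = - \<alpha> \<and> c = \<alpha> - of_nat j"
    if nz: "quotient_pow_L V g X2 \<epsilon> z x v (exps z x a b c) \<noteq> 0"
    using quotient_pow_L_support[OF \<alpha> nz] by (simp add: xpow_exps exps_add exps_eq_iff)
  show "quotient_pow_L V g X2 \<epsilon> z x v (exps z x (of_nat 0) (- \<alpha>) (\<alpha> - of_nat 0)) = v"
    using quotient_pow_L_lead[OF \<alpha>, of X2 z \<epsilon> x] zx by (simp add: xpow_exps exps_add)
qed

text \<open>With \<open>L\<close> standing for all three operators, (L - \<alpha> - \<beta> - h)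
  applied to \<open>J k a b\<close> gives \<open>J k\<close> with \<open>L - \<alpha>\<close> on
  \<open>a\<close>, plus \<open>J k\<close> with \<open>L - \<beta>\<close> on \<open>b\<close>,
  plus (k + 1) \<open>J (k + 1) a b\<close>. Induction on the sum of the nilpotency orders handles
  the first two, downward induction on the power of the logarithm the last. The lemma yields the
  weights both of module modes and of intertwining operators.\<close>

lemma geig_bilinear:
  fixes J :: "nat \<Rightarrow> 'a::ab_group_add \<Rightarrow> 'b::ab_group_add \<Rightarrow> 'c::ab_group_add"
    and sa :: "complex \<Rightarrow> 'a \<Rightarrow> 'a" and sb :: "complex \<Rightarrow> 'b \<Rightarrow> 'b" and sc :: "complex \<Rightarrow> 'c \<Rightarrow> 'c"
  assumes La: "endomorphism sa La" and Lb: "endomorphism sb Lb" and Lc: "endomorphism sc Lc"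
    and left: "\<And>k b. Vector_Spaces.linear sa sc (\<lambda>a. J k a b)"
    and right: "\<And>k a. Vector_Spaces.linear sb sc (J k a)"
    and log: "\<And>a b. \<exists>K. \<forall>k>K. J k a b = 0"
    and comm: "\<And>k a b. Lc (J k a b) - J k a (Lb b)
        = sc h (J k a b) + sc (of_nat (k + 1)) (J (k + 1) a b) + J k (La a) b"
    and a: "a \<in> geig sa La \<alpha>" and b: "b \<in> geig sb Lb \<beta>"
  shows "J k a b \<in> geig sc Lc (\<alpha> + \<beta> + h)"
proof -
  interpret La: endomorphism sa La by fact
  interpret Lb: endomorphism sb Lb by fact
  interpret Lc: endomorphism sc Lc by fact
  interpret l: Vector_Spaces.linear sa sc "\<lambda>a. J k a y" for k y by (rule left)
  interpret r: Vector_Spaces.linear sb sc "J k y" for k y by (rule right)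
  let ?G = "geig sc Lc (\<alpha> + \<beta> + h)"
  obtain A where A: "(La.shift \<alpha> ^^ A) a = 0" using a by (auto simp: geig_def)
  obtain B where B: "(Lb.shift \<beta> ^^ B) b = 0" using b by (auto simp: geig_def)
  have "J k a b \<in> ?G" if "(La.shift \<alpha> ^^ A) a = 0" "(Lb.shift \<beta> ^^ B) b = 0" for A B a b k
    using that
  proof (induction "A + B" arbitrary: A B a b k rule: less_induct)
    case less
    have A: "J k (La.shift \<alpha> a) b \<in> ?G" for k
    proof (cases A)
      case 0
      then have "a = 0" using less.prems by simp
      then show ?thesis by (simp add: l.zero Lc.subspace_0 Lc.subspace_geig)
    next
      case (Suc A')
      then show ?thesis
        using less.prems by (intro less.hyps[of A' B]) (simp_all add: funpow_Suc_right del: funpow.simps)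
    qed
    have B: "J k a (Lb.shift \<beta> b) \<in> ?G" for k
    proof (cases B)
      case 0
      then have "b = 0" using less.prems by simp
      then show ?thesis by (simp add: r.zero Lc.subspace_0 Lc.subspace_geig)
    next
      case (Suc B')
      then show ?thesis
        using less.prems by (intro less.hyps[of A B']) (simp_all add: funpow_Suc_right del: funpow.simps)
    qed
    obtain K where K: "\<And>k. k > K \<Longrightarrow> J k a b = 0" using log by blast
    have step: "J k a b \<in> ?G" if "J (k + 1) a b \<in> ?G" for k
    proof (rule Lc.geig_shiftD)
      have "Lc (J k a b) - sc (\<alpha> + \<beta> + h) (J k a b)
          = J k (La.shift \<alpha> a) b + J k a (Lb.shift \<beta> b) + sc (of_nat (k + 1)) (J (k + 1) a b)"
        using comm[of k a b]
        by (simp add: l.diff l.scale r.diff r.scale Lc.scale_left_distrib diff_eq_eq algebra_simps del: of_nat_Suc of_nat_add)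
      then show "Lc (J k a b) - sc (\<alpha> + \<beta> + h) (J k a b) \<in> ?G"
        using A B that by (auto intro!: Lc.subspace_add Lc.subspace_scale Lc.subspace_geig)
    qed
    show ?case
    proof (cases "k > K")
      case True
      then show ?thesis by (simp add: K Lc.subspace_0 Lc.subspace_geig)
    next
      case False
      then have "k \<le> Suc K" by simp
      then show ?thesis
      proof (induction k rule: inc_induct)
        case base
        then show ?case by (simp add: K Lc.subspace_0 Lc.subspace_geig)
      next
        case (step k)
        then show ?case using \<open>\<And>k. J (k + 1) a b \<in> ?G \<Longrightarrow> J k a b \<in> ?G\<close> by simp
      qed
    qed
  qed
  then show ?thesis using A B by blast
qed


section \<open>Modes and weights\<close>

context grading_restricted_vertex_algebra
begin

lemma YV_coeff: "YV V u t v (0(t := - of_int n - 1), 0) = vmode V u n v"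
  unfolding YV_def
  by (subst formal_sum_unique[of _ n]) (auto simp: xpow_def dest!: fun_upd_eqD)

lemma YV_log_coeff: "l \<noteq> 0 \<Longrightarrow> YV V u t v (e, l) = 0"
  unfolding YV_def by (rule ccontr, drule formal_sum_nonzero) (auto simp: xpow_def)

lemma fderiv_YV_coeff:
  "fderiv (vscale V) t (YV V u t v) (0(t := - of_int n - 2), 0) = vscale V (- of_int n - 1) (vmode V u n v)"
proof -
  have "(0 :: fvar \<Rightarrow> nat)(t := 1) \<noteq> 0" by (metis fun_upd_same zero_fun_apply zero_neq_one)
  then show ?thesis
    using YV_coeff[of u t v n] by (simp add: fderiv_def YV_log_coeff diff_diff_eq2 minus_diff_commute)
qed

lemma LV_neg1_creation: "LV_neg1 V v = vmode V v (- 2) (vacuum V)"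
  using fun_cong[OF L_neg1_derivative[of X0 v "vacuum V"], of "(0(X0 := 0), 0)"]
    fderiv_YV_coeff[of X0 v "vacuum V" "- 2"] YV_coeff[of "LV_neg1 V v" X0 "vacuum V" "- 1"]
  by (simp add: creation_value)

text \<open>L(-1) v is the mode of index -2 of \<open>v\<close> applied to the vacuum; its weight
  then follows from the commutator formula for L(0), as the vacuum has weight 0.\<close>

lemma LV_neg1_vgrade: "v \<in> vgrade V n \<Longrightarrow> LV_neg1 V v \<in> vgrade V (n + 1)"
proof -
  assume v: "v \<in> vgrade V n"
  interpret l: Vector_Spaces.linear "vscale V" "vscale V" "\<lambda>u. vmode V u k w" for k w
    by (rule mode_linear_left)
  interpret r: Vector_Spaces.linear "vscale V" "vscale V" "vmode V u k" for k u
    by (rule mode_linear_right)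
  have vac: "LV0 V (vacuum V) = 0" using L0_grade[OF vacuum_grade] by simp
  have "LV0 V (vmode V v (- 2) (vacuum V)) = vmode V v (- 2) (vacuum V) + vmode V (LV0 V v) (- 2) (vacuum V)"
    using fun_cong[OF L0_commutator[where x = X0 and v = v and w = "vacuum V"], of "(0(X0 := 1), 0)"]
      fderiv_YV_coeff[of X0 v "vacuum V" "- 2"] YV_coeff[of _ X0 _ "- 2"]
    by (simp add: smul_single_coeff[OF vector_space] vac r.zero)
  then have "LV0 V (LV_neg1 V v) = vscale V (of_int (n + 1)) (LV_neg1 V v)"
    by (simp add: LV_neg1_creation L0_grade[OF v] l.scale vs.scale_left_distrib add.commute)
  then show ?thesis using V0.eigenvector_geig V0.summand_eq_geig by blast
qed

lemma V_plus_stable: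
  assumes h: "Vector_Spaces.linear (vscale V) (vscale V) h"
    and grade: "\<And>v n. v \<in> vgrade V n \<Longrightarrow> \<exists>m\<ge>n. h v \<in> vgrade V m" and v: "v \<in> V_plus V"
  shows "h v \<in> V_plus V"
proof -
  interpret h: Vector_Spaces.linear "vscale V" "vscale V" h by fact
  show ?thesis
    using v unfolding V_plus_def
  proof (induction rule: vs.span_induct_alt)
    case base
    then show ?case by (simp add: vs.span_zero)
  next
    case (step c x y)
    then obtain n where "n \<ge> 1" "x \<in> vgrade V n" by auto
    then obtain m where "m \<ge> 1" "h x \<in> vgrade V m" using grade by (meson order_trans)
    then have "h x \<in> vs.span (\<Union>n\<in>{1..}. vgrade V n)" by (auto intro: vs.span_base)
    then show ?case using step by (simp add: h.add h.scale vs.span_add vs.span_scale)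
  qed
qed

lemma LV_neg1_V_plus: "v \<in> V_plus V \<Longrightarrow> LV_neg1 V v \<in> V_plus V"
  using LV_neg1_vgrade by (intro V_plus_stable[OF L_neg1_linear]) (meson zle_add1_eq_le zless_add1_eq order_refl)

lemma V_plus_comp:
  assumes "v \<in> V_plus V" "V0.comp v n \<noteq> 0" shows "n \<ge> 1"
  using assms(1) assms(2) unfolding V_plus_def
proof (induction arbitrary: n rule: vs.span_induct_alt)
  case (step c x y)
  obtain m where m: "m \<ge> 1" "x \<in> vgrade V m" using step.hyps by auto
  show ?case
  proof (cases "V0.comp y n = 0")
    case True
    then have "V0.comp x n \<noteq> 0" using step.prems by (auto simp: V0.comp_add V0.comp_scale)
    then show ?thesis using m V0.comp_of_summand[OF m(2)] by (auto split: if_splits)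
  qed (use step.IH in auto)
qed simp

end

context vertex_algebra_automorphism
begin

lemma aut_V_plus: "v \<in> V_plus V \<Longrightarrow> g v \<in> V_plus V"
  using aut_vgrade by (intro V_plus_stable[OF aut_linear]) auto

lemma gen_eigenspace_LV_neg1: "v \<in> gen_eigenspace V g \<alpha> \<Longrightarrow> LV_neg1 V v \<in> gen_eigenspace V g \<alpha>"
  unfolding gen_eigenspace_geig by (rule G.geig_commute[OF L_neg1_linear]) (auto simp: aut_L_neg1)

lemma gen_eigenspace_LV0: "v \<in> gen_eigenspace V g \<alpha> \<Longrightarrow> LV0 V v \<in> gen_eigenspace V g \<alpha>"
  unfolding gen_eigenspace_geig by (rule G.geig_commute[OF L0_linear]) (auto simp: aut_L0)

lemma subspace_gen_eigenspace: "vs.subspace (gen_eigenspace V g \<alpha>)"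
  unfolding gen_eigenspace_geig by (rule G.subspace_geig)

lemma subspace_V_plus: "vs.subspace (V_plus V)"
  unfolding V_plus_def by (rule vs.subspace_span)

end

context weak_twisted_module
begin

sublocale ws: vector_space "wscale W" by (rule W_vector_space)

sublocale LW: endomorphism "wscale W" "LW0 W"
  by (intro endomorphism.intro endomorphism_axioms.intro W_vector_space LW0_linear)

sublocale mode_left: Vector_Spaces.linear "vscale V" "wscale W" "\<lambda>v. wmode W v n k w" for n k w
  by (rule W_mode_linear_left)

sublocale mode_right: Vector_Spaces.linear "wscale W" "wscale W" "wmode W v n k" for v n k
  by (rule W_mode_linear_right)

lemma mode_derivative:
  "wscale W (- n - 1) (wmode W v n k w) + wscale W (of_nat (k + 1)) (wmode W v n (k + 1) w)
    = wmode W (LV_neg1 V v) (n + 1) k w"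
  using fun_cong[OF W_L_neg1_derivative[of X0 v w], of "(0(X0 := - n - 2), 0(X0 := k))"]
  unfolding YW_def fderiv_log_series by (simp add: log_series_coeff add.commute[of 1])

lemma mode_L0_commutator:
  "LW0 W (wmode W v n k w) - wmode W v n k (LW0 W w)
    = wscale W (- n - 1) (wmode W v n k w) + wscale W (of_nat (k + 1)) (wmode W v n (k + 1) w)
      + wmode W (LV0 V v) n k w"
proof -
  have "(0(X0 := - n - 1 :: complex))(X0 := - n - 1 - 1) = 0(X0 := - n - 2)" by (simp add: fun_eq_iff)
  then show ?thesis
    using fun_cong[OF W_L0_commutator[where x = X0 and v = v and w = w], of "(0(X0 := - n - 1), 0(X0 := k))"]
      fderiv_log_series[of "wscale W" X0 "\<lambda>n k. wmode W v n k w" n k]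
    unfolding YW_def
    by (simp add: log_series_coeff smul_single_coeff[OF W_vector_space])
qed

lemma mode_weight:
  assumes "v \<in> vgrade V d" "w \<in> geig (wscale W) (LW0 W) \<beta>"
  shows "wmode W v n k w \<in> geig (wscale W) (LW0 W) (of_int d + \<beta> - n - 1)"
proof -
  have "wmode W v n k w \<in> geig (wscale W) (LW0 W) (of_int d + \<beta> + (- n - 1))"
  proof (rule geig_bilinear[where J = "\<lambda>k v w. wmode W v n k w"])
    show "\<exists>K. \<forall>k>K. wmode W v n k w = 0" for v w using W_log_polynomial[of v w] by blast
    show "v \<in> geig (vscale V) (LV0 V) (of_int d)" using V0.summand_geig assms(1) by blast
  qed (fact V0.endomorphism_axioms LW.endomorphism_axioms W_mode_linear_left W_mode_linear_right
      mode_L0_commutator assms(2))+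
  then show ?thesis by (simp add: algebra_simps)
qed

text \<open>The derivative property gives (L(-1) u)_{m+1,0} = (-m - 1) u_{m,0} + u_{m,1}, with the
  left side known by induction on \<open>i\<close>, so the coefficients with logarithms have to be
  put in the subspace separately. Modulo the subspace and by induction on the nilpotency order of
  \<open>v\<close>, equivariance says that the polynomial with coefficients v_{m,k} in log x is
  invariant under adding 2 pi i to log x, hence constant. No operator for \<open>g\<close> on
  \<open>W\<close> enters.\<close>

lemma C_subspace_lower_modes:
  assumes \<alpha>: "\<alpha> \<in> spectrum_exponents V g" and n: "n \<ge> 2"
    and u: "u \<in> gen_eigenspace V g \<alpha>" "u \<in> V_plus V"
  shows "wmode W u (\<alpha> - of_int n - of_nat i) 0 w \<in> C_subspace V g W n"
  using u
proof (induction i arbitrary: u)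
  case 0
  then show ?case unfolding C_subspace_def using \<alpha> by (auto intro!: ws.span_base)
next
  case (Suc i)
  let ?C = "C_subspace V g W n"
  have C: "ws.subspace ?C" unfolding C_subspace_def by (rule ws.subspace_span)
  define m where "m = \<alpha> - of_int n - of_nat (Suc i)"
  define c where "c = 2 * pi * \<i>"
  have c: "c \<noteq> 0" by (simp add: c_def)
  have deriv: "wmode W (LV_neg1 V v) (m + 1) 0 w \<in> ?C"
    if "v \<in> gen_eigenspace V g \<alpha>" "v \<in> V_plus V" for v
    using Suc.IH[of "LV_neg1 V v"] that
    by (simp add: m_def gen_eigenspace_LV_neg1 LV_neg1_V_plus algebra_simps)
  \<comment> \<open>Since m - \<alpha> is an integer, the monodromy factor of the power of x cancels
    the eigenvalue of \<open>g\<close> on \<open>v\<close>.\<close>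
  have e: "exp (c * (- m - 1)) = exp (- (c * \<alpha>))"
  proof -
    have "c * (- m - 1) = - (c * \<alpha>) + of_int (n + int i) * (2 * pi * \<i>)"
      by (simp add: m_def c_def algebra_simps)
    then show ?thesis by (simp only: exp_add exp_of_int_2pi_i mult_1_right)
  qed
  have key: "wmode W v m k w \<in> ?C"
    if "(G.shift (exp (c * \<alpha>)) ^^ r) v = 0" "v \<in> gen_eigenspace V g \<alpha>" "v \<in> V_plus V" for r v k
    using that
  proof (induction r arbitrary: v k)
    case 0
    then show ?case by (simp add: mode_left.zero ws.subspace_0[OF C])
  next
    case (Suc r)
    let ?F = "\<lambda>k. wmode W v m k w"
    define v' where "v' = G.shift (exp (c * \<alpha>)) v"
    have v': "v' \<in> gen_eigenspace V g \<alpha>" "v' \<in> V_plus V"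
      unfolding v'_def using Suc.prems G.geig_self aut_V_plus
      by (auto simp: gen_eigenspace_geig intro!: vs.subspace_diff vs.subspace_scale G.subspace_geig
          subspace_V_plus)
    have F': "wmode W v' m k w \<in> ?C" for k
      using Suc.prems(1) v' by (intro Suc.IH) (simp_all add: v'_def funpow_Suc_right del: funpow.simps)
    have gv: "g v = v' + vscale V (exp (c * \<alpha>)) v" by (simp add: v'_def)
    obtain K1 K2 where "\<forall>k>K1. \<forall>n. wmode W v n k w = 0" "\<forall>k>K2. \<forall>n. wmode W (g v) n k w = 0"
      using W_log_polynomial by metis
    then obtain K where K: "\<And>k. k > K \<Longrightarrow> ?F k = 0" "\<And>k. k > K \<Longrightarrow> wmode W (g v) m k w = 0"
      by (metis max_less_iff_conj)
    have K_le: "j \<le> K" if "wmode W (g v) m j w \<noteq> 0" for j using K(2) that by (meson not_le)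
    have mono: "(\<Sum>j=l..K. wscale W (exp (- (c * \<alpha>)) * of_nat (j choose l) * c ^ (j - l)) (wmode W (g v) m j w)) = ?F l" for l
    proof -
      have "(\<Sum>j | l \<le> j \<and> wmode W (g v) m j w \<noteq> 0.
          wscale W (exp (- (c * \<alpha>)) * of_nat (j choose l) * c ^ (j - l)) (wmode W (g v) m j w)) = ?F l"
        using fun_cong[OF W_equivariance[of X0 v w], of "(0(X0 := - m - 1), 0(X0 := l))"]
        unfolding e[symmetric] by (simp add: monodromy_def YW_def log_series_coeff c_def)
      moreover have "(\<Sum>j | l \<le> j \<and> wmode W (g v) m j w \<noteq> 0.
          wscale W (exp (- (c * \<alpha>)) * of_nat (j choose l) * c ^ (j - l)) (wmode W (g v) m j w))
        = (\<Sum>j=l..K. wscale W (exp (- (c * \<alpha>)) * of_nat (j choose l) * c ^ (j - l)) (wmode W (g v) m j w))"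
        by (intro sum.mono_neutral_left) (auto simp: K_le)
      ultimately show ?thesis by simp
    qed
    \<comment> \<open>The summand \<open>v'\<close> of \<open>g v\<close> has lower nilpotency
      order, so its modes lie in the subspace; what remains compares the polynomial with its
      translate by \<open>c\<close>.\<close>
    have diff: "(\<Sum>j=l..K. wscale W (of_nat (j choose l) * c ^ (j - l)) (?F j)) - ?F l \<in> ?C" for l
    proof -
      have scal: "exp (- (c * \<alpha>)) * of_nat (j choose l) * c ^ (j - l) * exp (c * \<alpha>)
          = of_nat (j choose l) * c ^ (j - l)" for j
        by (simp add: exp_minus)
      have "(\<Sum>j=l..K. wscale W (exp (- (c * \<alpha>)) * of_nat (j choose l) * c ^ (j - l)) (wmode W (g v) m j w))
        = (\<Sum>j=l..K. wscale W (exp (- (c * \<alpha>)) * of_nat (j choose l) * c ^ (j - l)) (wmode W v' m j w))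
        + (\<Sum>j=l..K. wscale W (of_nat (j choose l) * c ^ (j - l)) (?F j))"
        by (simp add: gv mode_left.add mode_left.scale ws.scale_right_distrib sum.distrib scal)
      then have "(\<Sum>j=l..K. wscale W (of_nat (j choose l) * c ^ (j - l)) (?F j)) - ?F l
        = - (\<Sum>j=l..K. wscale W (exp (- (c * \<alpha>)) * of_nat (j choose l) * c ^ (j - l)) (wmode W v' m j w))"
        using mono[of l] by (simp add: algebra_simps)
      also have "\<dots> \<in> ?C"
        using F' by (intro ws.subspace_neg[OF C] ws.subspace_sum[OF C] ws.subspace_scale[OF C])
      finally show ?thesis .
    qed
    \<comment> \<open>The degree \<open>l\<close> coefficient of translate minus polynomial is (l +
      1) c \<open>?F (Suc l)\<close> plus contributions of higher coefficients, known by downward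
      induction.\<close>
    have pos: "?F (Suc l) \<in> ?C" for l
    proof (induction "Suc K - Suc l" arbitrary: l rule: less_induct)
      case (less l)
      show ?case
      proof (cases "Suc l \<le> K")
        case False
        then show ?thesis by (simp add: K ws.subspace_0[OF C])
      next
        case True
        have higher: "?F j \<in> ?C" if "j > Suc l" "j \<le> K" for j
          using less.hyps[of "j - 1"] that by simp
        have "(\<Sum>j=l..K. wscale W (of_nat (j choose l) * c ^ (j - l)) (?F j))
          = ?F l + wscale W (of_nat (Suc l) * c) (?F (Suc l))
            + (\<Sum>j=Suc (Suc l)..K. wscale W (of_nat (j choose l) * c ^ (j - l)) (?F j))"
          using True by (simp add: sum.atLeast_Suc_atMost binomial_Suc_n add.assoc)
        then have "wscale W (of_nat (Suc l) * c) (?F (Suc l))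
          = ((\<Sum>j=l..K. wscale W (of_nat (j choose l) * c ^ (j - l)) (?F j)) - ?F l)
            - (\<Sum>j=Suc (Suc l)..K. wscale W (of_nat (j choose l) * c ^ (j - l)) (?F j))"
          by (simp add: algebra_simps)
        also have "\<dots> \<in> ?C"
          using higher
          by (intro ws.subspace_diff[OF C diff] ws.subspace_sum[OF C] ws.subspace_scale[OF C]) auto
        finally show ?thesis
          by (rule ws.subspace_scaleD[OF C]) (simp add: c del: of_nat_Suc)
      qed
    qed
    have "wscale W (- m - 1) (?F 0) = wmode W (LV_neg1 V v) (m + 1) 0 w - ?F (Suc 0)"
      using mode_derivative[of m v 0 w] by (simp add: algebra_simps)
    also have "\<dots> \<in> ?C" using deriv Suc.prems pos by (intro ws.subspace_diff[OF C]) auto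
    finally have "wscale W (- m - 1) (?F 0) \<in> ?C" .
    \<comment> \<open>Re m = Re \<alpha> - n - i - 1 is less than -2, because Re \<alpha> < 1 and n
      \<ge> 2.\<close>
    moreover have "- m - 1 \<noteq> 0"
    proof
      assume "- m - 1 = 0"
      then have "Re (- m - 1) = 0" by simp
      moreover have "Re \<alpha> < 1" using \<alpha> by (simp add: spectrum_exponents_def)
      ultimately show False using n by (simp add: m_def)
    qed
    ultimately have "?F 0 \<in> ?C" by (rule ws.subspace_scaleD[OF C])
    then show ?case using pos by (cases k) auto
  qed
  obtain r where "(G.shift (exp (c * \<alpha>)) ^^ r) u = 0"
    using Suc.prems(1) by (auto simp: gen_eigenspace_def c_def)
  then show ?case using key Suc.prems unfolding m_def by blast
qed

end


section \<open>Commuting automorphisms\<close>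

text \<open>The left side of the Jacobi identity involves the logarithm of \<open>g1\<close>, the
  right side that of \<open>g2\<close>. On these spaces both act with a single exponent, and all
  weights are explicit.\<close>

definition joint_space ::
  "'v::ab_group_add vertex_algebra \<Rightarrow> ('v \<Rightarrow> 'v) \<Rightarrow> ('v \<Rightarrow> 'v) \<Rightarrow> complex \<Rightarrow> complex \<Rightarrow> int \<Rightarrow> 'v set" where
  "joint_space V g h \<alpha> \<beta> d = gen_eigenspace V g \<alpha> \<inter> gen_eigenspace V h \<beta> \<inter> vgrade V d"

lemma joint_space_commute: "joint_space V g h \<alpha> \<beta> d = joint_space V h g \<beta> \<alpha> d"
  by (auto simp: joint_space_def)

text \<open>The integer that brings \<alpha> + \<beta> back to the strip 0 \<le> Re < 1 when
  \<alpha> and \<beta> lie in it, so that \<alpha> + \<beta> - carry is the exponent for the product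
  of the automorphisms.\<close>

definition carry :: "complex \<Rightarrow> complex \<Rightarrow> int" where
  "carry \<alpha> \<beta> = (if Re \<alpha> + Re \<beta> < 1 then 0 else 1)"

locale commuting_automorphisms =
  A: vertex_algebra_automorphism V g1 + B: vertex_algebra_automorphism V g2
  for V :: "'v::ab_group_add vertex_algebra" and g1 g2 :: "'v \<Rightarrow> 'v" +
  assumes commute: "g1 \<circ> g2 = g2 \<circ> g1"
begin

lemma commute': "g1 (g2 v) = g2 (g1 v)"
  using fun_cong[OF commute, of v] by simp

lemma subspace_joint: "A.vs.subspace (joint_space V g1 g2 \<alpha> \<beta> d)"
  unfolding joint_space_def
  by (intro A.vs.subspace_inter A.subspace_gen_eigenspace B.subspace_gen_eigenspace
      A.V0.subspace_summand) simp

lemma joint_stable: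
  assumes "v \<in> joint_space V g1 g2 \<alpha> \<beta> d"
  shows "g1 v \<in> joint_space V g1 g2 \<alpha> \<beta> d" "g2 v \<in> joint_space V g1 g2 \<alpha> \<beta> d"
proof -
  have "g2 v \<in> gen_eigenspace V g1 \<alpha>"
    using assms unfolding joint_space_def A.gen_eigenspace_geig
    by (intro A.G.geig_commute[OF B.aut_linear]) (auto simp: commute')
  moreover have "g1 v \<in> gen_eigenspace V g2 \<beta>"
    using assms unfolding joint_space_def B.gen_eigenspace_geig
    by (intro B.G.geig_commute[OF A.aut_linear]) (auto simp: commute')
  ultimately show "g1 v \<in> joint_space V g1 g2 \<alpha> \<beta> d" "g2 v \<in> joint_space V g1 g2 \<alpha> \<beta> d"
    using assms A.aut_vgrade B.aut_vgrade A.G.geig_self B.G.geig_self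
    by (auto simp: joint_space_def A.gen_eigenspace_geig B.gen_eigenspace_geig)
qed

text \<open>Generalized eigenspaces of \<open>g1\<close> are stable under L(0) and under
  \<open>g2\<close>, so taking weight components and then components for \<open>g2\<close> never
  leaves them.\<close>

lemma joint_span:
  assumes u: "u \<in> gen_eigenspace V g1 \<alpha>" "u \<in> V_plus V"
  shows "u \<in> A.vs.span (\<Union>\<beta>\<in>spectrum_exponents V g2. \<Union>d\<in>{1..}. joint_space V g1 g2 \<alpha> \<beta> d)"
    (is "_ \<in> A.vs.span ?J")
proof -
  have "A.V0.comp u d \<in> A.vs.span ?J" if d: "A.V0.comp u d \<noteq> 0" for d
  proof -
    let ?y = "A.V0.comp u d" and ?Y = "gen_eigenspace V g1 \<alpha> \<inter> vgrade V d"
    have Y: "A.vs.subspace ?Y"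
      by (intro A.vs.subspace_inter A.subspace_gen_eigenspace A.V0.subspace_summand) simp
    have "d \<ge> 1" using A.V_plus_comp u(2) d by blast
    have y: "?y \<in> ?Y"
      using A.V0.comp_stable[OF A.subspace_gen_eigenspace A.gen_eigenspace_LV0 u(1)] A.V0.comp_in by auto
    have gY: "g2 x \<in> ?Y" if "x \<in> ?Y" for x
      using that A.G.geig_commute[OF B.aut_linear, of x] B.aut_vgrade
      by (auto simp: A.gen_eigenspace_geig commute')
    have "B.Gdec.comp ?y \<beta> \<in> A.vs.span ?J" if \<beta>: "B.Gdec.comp ?y \<beta> \<noteq> 0" for \<beta>
    proof -
      have "\<beta> \<in> spectrum_exponents V g2" using B.Gdec.comp_out \<beta> by blast
      moreover have "B.Gdec.comp ?y \<beta> \<in> joint_space V g1 g2 \<alpha> \<beta> d"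
        using B.Gdec.comp_stable[OF Y gY y] B.Gdec.comp_in[OF calculation] by (simp add: joint_space_def)
      ultimately show ?thesis using \<open>d \<ge> 1\<close> by (auto intro!: A.vs.span_base)
    qed
    then have "(\<Sum>\<beta> | B.Gdec.comp ?y \<beta> \<noteq> 0. B.Gdec.comp ?y \<beta>) \<in> A.vs.span ?J"
      by (intro A.vs.span_sum) auto
    then show ?thesis by (simp add: B.Gdec.sum_comp)
  qed
  then have "(\<Sum>d | A.V0.comp u d \<noteq> 0. A.V0.comp u d) \<in> A.vs.span ?J"
    by (intro A.vs.span_sum) auto
  then show ?thesis by (simp add: A.V0.sum_comp)
qed

text \<open>For commuting maps, g1 g2 - a b = g2 (g1 - a) + a (g2 - b). Either factor in parentheses
  lowers one of the two nilpotency orders, and induction on their sum applies.\<close>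

lemma product_geig:
  assumes "v \<in> geig (vscale V) g1 a" "v \<in> geig (vscale V) g2 b"
  shows "v \<in> geig (vscale V) (g1 \<circ> g2) (a * b)"
proof -
  have lin: "Vector_Spaces.linear (vscale V) (vscale V) (g1 \<circ> g2)"
    by (rule Vector_Spaces.linear_compose[OF B.aut_linear A.aut_linear])
  interpret P: endomorphism "vscale V" "g1 \<circ> g2"
    by (intro endomorphism.intro endomorphism_axioms.intro A.vector_space lin)
  obtain k m where "(A.G.shift a ^^ k) v = 0" "(B.G.shift b ^^ m) v = 0"
    using assms by (auto simp: geig_def)
  then show ?thesis
  proof (induction "k + m" arbitrary: k m v rule: less_induct)
    case less
    show ?case
    proof (cases "v = 0")
      case True
      then show ?thesis by (simp add: A.vs.subspace_0 P.subspace_geig)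
    next
      case False
      then obtain k' m' where km: "k = Suc k'" "m = Suc m'" using less.prems by (cases k; cases m) auto
      interpret sa: endomorphism "vscale V" "A.G.shift a" by (rule A.G.endomorphism_shift)
      interpret sb: endomorphism "vscale V" "B.G.shift b" by (rule B.G.endomorphism_shift)
      have pow_commute: "(f ^^ i) (h x) = h ((f ^^ i) x)" if "\<And>x. f (h x) = h (f x)"
        for f h :: "'v \<Rightarrow> 'v" and i x
        by (induction i) (simp_all add: that)
      have "A.G.shift a v \<in> geig (vscale V) (g1 \<circ> g2) (a * b)"
      proof (rule less.hyps[of k' m])
        show "(A.G.shift a ^^ k') (A.G.shift a v) = 0"
          using less.prems(1) km by (simp only: funpow_Suc_right comp_apply)
        have "(B.G.shift b ^^ m) (A.G.shift a v) = A.G.shift a ((B.G.shift b ^^ m) v)"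
          by (rule pow_commute) (simp add: A.G.map_diff A.G.map_scale B.G.map_diff B.G.map_scale commute'
              A.vs.scale_right_diff_distrib A.vs.scale_left_commute)
        then show "(B.G.shift b ^^ m) (A.G.shift a v) = 0" unfolding less.prems(2) by simp
      qed (simp add: km)
      then have 1: "g2 (A.G.shift a v) \<in> geig (vscale V) (g1 \<circ> g2) (a * b)"
        by (intro P.geig_commute[OF B.aut_linear]) (auto simp: commute')
      have 2: "B.G.shift b v \<in> geig (vscale V) (g1 \<circ> g2) (a * b)"
      proof (rule less.hyps[of k m'])
        show "(B.G.shift b ^^ m') (B.G.shift b v) = 0"
          using less.prems(2) km by (simp only: funpow_Suc_right comp_apply)
        have "(A.G.shift a ^^ k) (B.G.shift b v) = B.G.shift b ((A.G.shift a ^^ k) v)"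
          by (rule pow_commute) (simp add: A.G.map_diff A.G.map_scale B.G.map_diff B.G.map_scale commute'
              A.vs.scale_right_diff_distrib A.vs.scale_left_commute)
        then show "(A.G.shift a ^^ k) (B.G.shift b v) = 0" unfolding less.prems(1) by simp
      qed (simp add: km)
      have "P.shift (a * b) v = g2 (A.G.shift a v) + vscale V a (B.G.shift b v)"
        by (simp add: B.G.map_diff B.G.map_scale commute' A.vs.scale_right_diff_distrib)
      then have "P.shift (a * b) v \<in> geig (vscale V) (g1 \<circ> g2) (a * b)"
        using 1 2 by (simp only:) (intro A.vs.subspace_add A.vs.subspace_scale P.subspace_geig)
      then show ?thesis by (rule P.geig_shiftD)
    qed
  qed
qed

lemma joint_product:
  assumes "v \<in> joint_space V g1 g2 \<alpha> \<beta> d"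
  shows "v \<in> gen_eigenspace V (g1 \<circ> g2) (\<alpha> + \<beta> - of_int (carry \<alpha> \<beta>))"
proof -
  have "exp (2 * pi * \<i> * (\<alpha> + \<beta> - of_int (carry \<alpha> \<beta>))) = exp (2 * pi * \<i> * \<alpha>) * exp (2 * pi * \<i> * \<beta>)"
    by (simp add: carry_def algebra_simps exp_add exp_diff)
  moreover have "v \<in> geig (vscale V) (g1 \<circ> g2) (exp (2 * pi * \<i> * \<alpha>) * exp (2 * pi * \<i> * \<beta>))"
    using assms by (intro product_geig) (auto simp: joint_space_def A.gen_eigenspace_geig B.gen_eigenspace_geig)
  ultimately show ?thesis by (simp add: gen_eigenspace_def geig_def)
qed

lemma carry_spectrum:
  assumes aut: "vertex_algebra_automorphism V (g1 \<circ> g2)"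
    and \<alpha>: "\<alpha> \<in> spectrum_exponents V g1" and \<beta>: "\<beta> \<in> spectrum_exponents V g2"
    and v: "v \<in> joint_space V g1 g2 \<alpha> \<beta> d" "v \<noteq> 0"
  shows "\<alpha> + \<beta> - of_int (carry \<alpha> \<beta>) \<in> spectrum_exponents V (g1 \<circ> g2)"
proof -
  interpret P: vertex_algebra_automorphism V "g1 \<circ> g2" by fact
  have "v \<in> geig (vscale V) (g1 \<circ> g2) (exp (2 * pi * \<i> * (\<alpha> + \<beta> - of_int (carry \<alpha> \<beta>))))"
    using joint_product[OF v(1)] by (simp only: P.gen_eigenspace_geig)
  then obtain u where "u \<noteq> 0"
    "(g1 \<circ> g2) u = vscale V (exp (2 * pi * \<i> * (\<alpha> + \<beta> - of_int (carry \<alpha> \<beta>)))) u"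
    using P.G.geig_eigenvector v(2) by metis
  moreover have "0 \<le> Re (\<alpha> + \<beta> - of_int (carry \<alpha> \<beta>))" "Re (\<alpha> + \<beta> - of_int (carry \<alpha> \<beta>)) < 1"
    using \<alpha> \<beta> by (auto simp: spectrum_exponents_def carry_def)
  ultimately show ?thesis unfolding spectrum_exponents_def by blast
qed

end

text \<open>The exponents occurring in a weight space are among those of the components of a finite
  spanning set. This is what keeps the weight drops of the reduction away from 0.\<close>

lemma (in vertex_algebra_automorphism) finite_exponents:
  "finite {\<alpha> \<in> spectrum_exponents V g. \<exists>v \<in> vgrade V d. v \<noteq> 0 \<and> v \<in> gen_eigenspace V g \<alpha>}"
proof -
  obtain B where B: "finite B" "vgrade V d \<subseteq> vs.span B" using grade_finite_dim by blast
  let ?S = "\<Union>b\<in>B. {\<alpha>. Gdec.comp b \<alpha> \<noteq> 0}"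
  have supp: "\<alpha> \<in> ?S" if "x \<in> vs.span B" "Gdec.comp x \<alpha> \<noteq> 0" for x \<alpha>
    using that
  proof (induction rule: vs.span_induct_alt)
    case (step c x y)
    then show ?case by (cases "Gdec.comp y \<alpha> = 0") (auto simp: Gdec.comp_add Gdec.comp_scale)
  qed simp
  have "{\<alpha> \<in> spectrum_exponents V g. \<exists>v \<in> vgrade V d. v \<noteq> 0 \<and> v \<in> gen_eigenspace V g \<alpha>} \<subseteq> ?S"
  proof
    fix \<alpha> assume "\<alpha> \<in> {\<alpha> \<in> spectrum_exponents V g. \<exists>v \<in> vgrade V d. v \<noteq> 0 \<and> v \<in> gen_eigenspace V g \<alpha>}"
    then obtain v where "\<alpha> \<in> spectrum_exponents V g" "v \<in> vgrade V d" "v \<noteq> 0" "v \<in> gen_eigenspace V g \<alpha>"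
      by blast
    then show "\<alpha> \<in> ?S" using supp[of v \<alpha>] B(2) by (auto simp: Gdec.comp_self)
  qed
  then show ?thesis by (rule finite_subset) (use B(1) Gdec.finite_comp in auto)
qed


section \<open>The logarithm-free part of the Jacobi identity\<close>

context fvar_pair
begin

lemma series_apply_pair:
  fixes S :: "'a::ab_group_add series" and Out :: "'a \<Rightarrow> 'b::ab_group_add series"
  assumes S: "\<And>a b c. S (exps z x a b c) = (if b = 0 \<and> c = 0 then t (- a - 1) else 0)"
    and Out: "\<And>w a b c. Out w (exps z x a b c) = (if a = 0 \<and> b = 0 then k w (- c - 1) else 0)"
    and Out0: "\<And>m. Out 0 m = 0"
  shows "(Out \<odot> S) (exps z x a b c) = (if b = 0 then k (t (- a - 1)) (- c - 1) else 0)"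
proof -
  have supp: "b = 0 \<and> a1 = a \<and> b1 = 0 \<and> c1 = 0"
    if nz: "Out (S (exps z x a1 b1 c1)) (exps z x (a - a1) (b - b1) (c - c1)) \<noteq> 0" for a1 b1 c1
  proof -
    have "S (exps z x a1 b1 c1) \<noteq> 0" using nz by (metis Out0)
    then show ?thesis using nz unfolding S Out by (auto split: if_splits)
  qed
  show ?thesis
  proof (cases "b = 0")
    case True
    have "(Out \<odot> S) (exps z x a b c)
        = (\<Sum>j\<in>{()}. Out (S (exps z x a 0 0)) (exps z x (a - a) (b - 0) (c - 0)))"
      unfolding series_apply_def by (rule pair_sum_exps) (simp, simp, use supp in blast)
    then show ?thesis using True by (simp add: S Out)
  next
    case False
    have "(Out \<odot> S) (exps z x a b c) = 0"
      unfolding series_apply_def by (rule pair_sum_exps_0) (use supp False in blast)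
    then show ?thesis using False by simp
  qed
qed

text \<open>The iterate on the right of the Jacobi identity: \<open>Inn\<close> is the action on
  \<open>W1\<close> in the variable \<open>z\<close>, \<open>Out\<close> the intertwining operator
  in \<open>X2\<close>, and \<open>Q\<close> the expanded power of the quotient. The truncation
  needed is that of the inner action.\<close>

lemma series_apply_nested:
  fixes Q :: "'a::ab_group_add series" and Inn :: "'a \<Rightarrow> 'b::ab_group_add series"
    and Out :: "'b \<Rightarrow> 'c::ab_group_add series"
  assumes Q: "\<And>a b c. Q (exps z x a b c) \<noteq> 0 \<Longrightarrow> \<exists>j::nat. a = of_nat j \<and> b = - \<gamma> \<and> c = \<gamma> - of_nat j"
    and B: "\<And>j. Q (exps z x (of_nat j) (- \<gamma>) (\<gamma> - of_nat j)) = B j"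
    and Inn: "\<And>v a b c. Inn v (exps z x a b c) = (if b = 0 \<and> c = 0 then h v (- a - 1) else 0)"
    and Inn0: "\<And>m. Inn 0 m = 0"
    and Out: "\<And>w a b c. Out w (exps z x a b c) = (if a = 0 \<and> b = 0 then k w (- c - 1) else 0)"
    and Out0: "\<And>m. Out 0 m = 0"
    and K: "\<And>j. j \<ge> K \<Longrightarrow> h (B j) (of_nat j - a - 1) = 0"
  shows "(Out \<odot> Inn \<odot> Q) (exps z x a b c)
    = (if b = - \<gamma> then \<Sum>j<K. k (h (B j) (of_nat j - a - 1)) (\<gamma> - of_nat j - c - 1) else 0)"
proof -
  have supp: "b = - \<gamma> \<and> b1 = - \<gamma> \<and> c1 = c \<and> (\<exists>j::nat. c = \<gamma> - of_nat j \<and> a1 = of_nat j)"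
    if nz: "Inn (Q (exps z x a1 b1 c1)) (exps z x (a - a1) (b - b1) (c - c1)) \<noteq> 0" for a1 b1 c1 a b c
  proof -
    have "Q (exps z x a1 b1 c1) \<noteq> 0" using nz by (metis Inn0)
    then obtain i where "a1 = of_nat i" "b1 = - \<gamma>" "c1 = \<gamma> - of_nat i" using Q by blast
    moreover have "b = b1" "c = c1" using nz unfolding Inn by (auto split: if_splits)
    ultimately show ?thesis by simp
  qed
  have R: "(Inn \<odot> Q) (exps z x a (- \<gamma>) (\<gamma> - of_nat j)) = h (B j) (of_nat j - a - 1)" for a and j :: nat
  proof -
    have "(Inn \<odot> Q) (exps z x a (- \<gamma>) (\<gamma> - of_nat j))
        = (\<Sum>i\<in>{()}. Inn (Q (exps z x (of_nat j) (- \<gamma>) (\<gamma> - of_nat j)))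
            (exps z x (a - of_nat j) (- \<gamma> - - \<gamma>) (\<gamma> - of_nat j - (\<gamma> - of_nat j))))"
      unfolding series_apply_def
    proof (rule pair_sum_exps)
      fix a1 b1 c1
      assume "Inn (Q (exps z x a1 b1 c1)) (exps z x (a - a1) (- \<gamma> - b1) (\<gamma> - of_nat j - c1)) \<noteq> 0"
      from supp[OF this] show "\<exists>i\<in>{()}. a1 = of_nat j \<and> b1 = - \<gamma> \<and> c1 = \<gamma> - of_nat j" by auto
    qed simp_all
    then show ?thesis by (simp add: B Inn)
  qed
  have R_supp: "b = - \<gamma> \<and> (\<exists>j::nat. c = \<gamma> - of_nat j)" if nz: "(Inn \<odot> Q) (exps z x a b c) \<noteq> 0" for a b c
    using nz pair_sum_exps_0[of "\<lambda>m1. Inn (Q m1)" a b c] supp unfolding series_apply_def by blast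
  have supp2: "b = - \<gamma> \<and> (\<exists>j<K. a1 = a \<and> b1 = - \<gamma> \<and> c1 = \<gamma> - of_nat j)"
    if nz: "Out ((Inn \<odot> Q) (exps z x a1 b1 c1)) (exps z x (a - a1) (b - b1) (c - c1)) \<noteq> 0" for a1 b1 c1
  proof -
    have nz': "(Inn \<odot> Q) (exps z x a1 b1 c1) \<noteq> 0" using nz by (metis Out0)
    then obtain j :: nat where j: "b1 = - \<gamma>" "c1 = \<gamma> - of_nat j" using R_supp by blast
    have ab: "a1 = a" "b = b1" using nz unfolding Out by (auto split: if_splits)
    have "h (B j) (of_nat j - a - 1) \<noteq> 0" using nz' unfolding j ab R .
    then have "j < K" using K[of j] by (meson not_le)
    then show ?thesis using ab j by blast
  qed
  show ?thesis
  proof (cases "b = - \<gamma>")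
    case True
    have "(Out \<odot> Inn \<odot> Q) (exps z x a b c) = (\<Sum>j<K. Out ((Inn \<odot> Q) (exps z x a (- \<gamma>) (\<gamma> - of_nat j)))
        (exps z x (a - a) (b - - \<gamma>) (c - (\<gamma> - of_nat j))))"
      unfolding series_apply_def[of Out]
      by (rule pair_sum_exps) (simp, simp add: inj_on_def, use supp2 in blast)
    then show ?thesis using True by (simp add: R Out algebra_simps)
  next
    case False
    have "(Out \<odot> Inn \<odot> Q) (exps z x a b c) = 0"
      unfolding series_apply_def[of Out] by (rule pair_sum_exps_0) (use supp2 False in blast)
    then show ?thesis using False by simp
  qed
qed

end

interpretation v01: fvar_pair X0 X1 by unfold_locales auto
interpretation v10: fvar_pair X1 X0 by unfold_locales auto

lemma (in vector_space) series_apply_in_subspace: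
  assumes "subspace C" "\<And>m1 m2. m1 + m2 = m \<Longrightarrow> F (S m1) m2 \<in> C"
  shows "(F \<odot> S) m \<in> C"
  unfolding series_apply_def using assms(2)
  by (intro formal_sum_in_subspace[OF assms(1)]) (auto split: prod.splits)

lemma log_series_zero: "log_series (\<lambda>n k. 0) t m = 0"
  by (cases m) (simp add: log_series_apply)

lemma exps_swap: "exps X0 X1 a b c = exps X1 X0 b a c"
  by (simp add: exps_def fun_upd_twist)

lemma log_series_v10: "log_series f X1 (exps X0 X1 a b c) = (if a = 0 \<and> c = 0 then f (- b - 1) 0 else 0)"
  unfolding exps_swap by (rule v10.log_series_exps)

text \<open>Truncation is given for each vector separately, whereas an expansion has infinitely many
  coefficient vectors. They all lie in one finite-dimensional weight space, so a spanning set
  supplies a common bound.\<close>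

lemma (in weak_twisted_module) uniform_truncation:
  "\<exists>N. \<forall>v m k. v \<in> vgrade V d \<longrightarrow> N \<le> Re m \<longrightarrow> wmode W v m k w = 0"
proof -
  obtain B where B: "finite B" "vgrade V d \<subseteq> vs.span B" using grade_finite_dim by blast
  have "\<forall>b\<in>B. \<exists>N. \<forall>m k. N \<le> Re m \<longrightarrow> wmode W b m k w = 0" using W_truncation by blast
  then obtain N where N: "\<And>b m k. b \<in> B \<Longrightarrow> N b \<le> Re m \<Longrightarrow> wmode W b m k w = 0" by metis
  define M where "M = (\<Sum>b\<in>B. \<bar>N b\<bar>)"
  have "wmode W v m k w = 0" if "v \<in> vs.span B" "M \<le> Re m" for v m k
    using that(1)
  proof (induction rule: vs.span_induct_alt)
    case base
    then show ?case by (simp add: mode_left.zero)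
  next
    case (step c x y)
    have "N x \<le> M"
      using member_le_sum[of x B "\<lambda>b. \<bar>N b\<bar>"] step.hyps B(1) unfolding M_def by simp
    then have "wmode W x m k w = 0" using N step.hyps that(2) by simp
    then show ?case using step by (simp add: mode_left.add mode_left.scale)
  qed
  then show ?thesis using B(2) by blast
qed

context twisted_intertwining_operator
begin

sublocale commuting_automorphisms V g1 g2
  by (intro commuting_automorphisms.intro M1.vertex_algebra_automorphism_axioms
      M2.vertex_algebra_automorphism_axioms commuting_automorphisms_axioms.intro commuting)

sublocale I_left: Vector_Spaces.linear "wscale W1" "wscale W3" "\<lambda>w1. I w1 n k w2" for n k w2
  by (rule I_linear_left)

sublocale I_right: Vector_Spaces.linear "wscale W2" "wscale W3" "I w1 n k" for w1 n k
  by (rule I_linear_right)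

lemma YW_zero [simp]: "YW W1 0 t w1 m = 0" "YW W2 0 t w2 m = 0" "YW W3 0 t w3 m = 0" "YW W3 v t 0 m = 0"
    "YI I 0 t w2 m = 0" "YI I w1 t 0 m = 0"
  by (cases m; simp add: YW_def YI_def log_series_apply M1.mode_left.zero M2.mode_left.zero
      M3.mode_left.zero M3.mode_right.zero I_left.zero I_right.zero)+

text \<open>Logarithms have natural exponents, so the logarithm-free part of a product only involves the
  logarithm-free parts of the factors.  Comparing the two sides of the Jacobi identity at
  logarithm-free monomials therefore only involves the modes with \<open>k = 0\<close>.\<close>

abbreviation jacobi1 where "jacobi1 v w1 w2 \<equiv> smul (wscale W3) (delta X1 (-1) X2 1 X0)
         ((\<lambda>v'. YW W3 v' X1 \<odot> YI I w1 X2 w2) \<odot> quotient_pow_L V g1 X1 (-1) X2 X0 v)"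

abbreviation jacobi2 where "jacobi2 v w1 w2 \<equiv> smul (wscale W3) (delta X2 (-1) X1 (-1) X0)
         ((\<lambda>v'. YI I w1 X2 \<odot> YW W2 v' X1 w2) \<odot>
            (\<lambda>m. exp_L V g1 (pi * \<i>) (quotient_pow_L V g1 X2 (-1) X1 X0 v m)))"

abbreviation jacobi3 where "jacobi3 v w1 w2 \<equiv> smul (wscale W3) (delta X2 1 X0 1 X1)
         ((\<lambda>w'. YI I w' X2 w2) \<odot> (\<lambda>v'. YW W1 v' X0 w1) \<odot> quotient_pow_L V g2 X2 1 X0 X1 v)"

text \<open>The exponents of \<open>X0\<close> and \<open>X1\<close> are those for which the leading
  modes are \<alpha> + m on \<open>W1\<close> and \<beta> + n on \<open>W2\<close>. The exponent of
  \<open>X2\<close> stays free and later selects the weight in \<open>W3\<close>.\<close>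

abbreviation corner :: "complex \<Rightarrow> complex \<Rightarrow> int \<Rightarrow> int \<Rightarrow> complex \<Rightarrow> monomial" where
  "corner \<alpha> \<beta> m n e \<equiv> exps X0 X1 (- \<alpha> - of_int m - 1) (- \<beta> - of_int n - 1) e"

abbreviation sum2 where "sum2 N B \<alpha> \<beta> m n w1 w2 e \<equiv> (\<Sum>i<N. \<Sum>j<N. wscale W3 ((-1) powi (- m) * (of_int m gchoose i) * (-1) ^ i)
          (I w1 (\<alpha> + of_int m - of_nat i - of_nat j - e - 1) 0
            (wmode W2 (B j) (\<beta> + of_int n + of_nat i + of_nat j) 0 w2)))"

abbreviation sum3 where "sum3 M A \<alpha> \<beta> m n w1 w2 e \<equiv> (\<Sum>i<M. \<Sum>j<M. wscale W3 (of_int n gchoose i)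
          (I (wmode W1 (A j) (\<alpha> + of_int m + of_nat i + of_nat j) 0 w1)
             (\<beta> + of_int n - of_nat i - of_nat j - e - 1) 0 w2))"

text \<open>The exponent of \<open>X1\<close> comes from the delta series and the quotient only,
  which fixes the delta index as \<open>n\<close>. The exponent of \<open>X0\<close> then forces the
  mode index \<alpha> + m + i + j on \<open>W1\<close>.\<close>

lemma third_term:
  assumes v: "v \<in> joint_space V g1 g2 \<alpha> \<beta> d" and \<beta>: "\<beta> \<in> spectrum_exponents V g2"
  obtains M B where "M > 0" "B 0 = v" "\<And>j. B j \<in> joint_space V g1 g2 \<alpha> \<beta> d"
    "\<And>e. jacobi3 v w1 w2
         (corner \<alpha> \<beta> m n e)
      = sum3 M B \<alpha> \<beta> m n w1 w2 e"
proof -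
  let ?J = "joint_space V g1 g2 \<alpha> \<beta> d"
  let ?Q = "quotient_pow_L V g2 X2 1 X0 X1 v"
  define B where "B j = ?Q (exps X0 X1 (of_nat j) (- \<beta>) (\<beta> - of_nat j))" for j
  have ve: "v \<in> gen_eigenspace V g2 \<beta>" using v by (simp add: joint_space_def)
  note Q = v01.quotient_pow_L_exps[OF M2.vertex_algebra_automorphism_axioms \<beta> ve, of 1]
  have BJ: "B j \<in> ?J" for j
    unfolding B_def by (rule M2.quotient_pow_L_stable[OF \<beta> subspace_joint joint_stable(2) _ v])
      (auto simp: joint_space_def)
  have B0: "B 0 = v" unfolding B_def by (rule Q(2))
  obtain N where N: "\<And>u m k. u \<in> ?J \<Longrightarrow> N \<le> Re m \<Longrightarrow> wmode W1 u m k w1 = 0"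
    using M1.uniform_truncation[of d w1] unfolding joint_space_def by blast
  define H where "H j m n = I (wmode W1 (B j) m 0 w1) n 0 w2" for j m n
  have "\<exists>M>0. \<forall>c. smul (wscale W3) (delta X2 1 X0 1 X1)
      ((\<lambda>w'. YI I w' X2 w2) \<odot> (\<lambda>v'. YW W1 v' X0 w1) \<odot> ?Q)
      (exps X0 X1 (- \<alpha> - of_int m - 1) (- \<beta> - of_int n - 1) c)
    = (\<Sum>i<M. \<Sum>j<M. wscale W3 (1 powi (- n) * (of_int n gchoose i) * 1 ^ i)
        (H j (of_nat i + of_nat j - (- \<alpha> - of_int m - 1) - 1) (\<beta> + of_int n - of_nat i - of_nat j - c - 1)))"
    (is "\<exists>M>0. \<forall>c. ?P M c")
  proof (rule v01.smul_delta_double[OF M3.W_vector_space, where N = N and H = H and n = n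
        and \<epsilon> = 1 and \<eta> = 1 and a = "- \<alpha> - of_int m - 1"])
    show "((\<lambda>w'. YI I w' X2 w2) \<odot> (\<lambda>v'. YW W1 v' X0 w1) \<odot> ?Q) (exps X0 X1 a b c)
      = (if b = - \<beta> then \<Sum>j<K. H j (of_nat j - a - 1) (\<beta> - of_nat j - c - 1) else 0)"
      if K: "\<And>j. K \<le> j \<Longrightarrow> N \<le> Re (of_nat j - a - 1)" for a b c K
      unfolding H_def
    proof (rule v01.series_apply_nested[OF Q(1), where B = B])
      show "?Q (exps X0 X1 (of_nat j) (- \<beta>) (\<beta> - of_nat j)) = B j" for j by (simp add: B_def)
      show "YW W1 u X0 w1 (exps X0 X1 a b c) = (if b = 0 \<and> c = 0 then wmode W1 u (- a - 1) 0 w1 else 0)" for u a b c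
        by (simp add: YW_def v01.log_series_exps)
      show "YI I w X2 w2 (exps X0 X1 a b c) = (if a = 0 \<and> b = 0 then I w (- c - 1) 0 w2 else 0)" for w a b c
        by (simp add: YI_def v01.log_series_exps)
      show "wmode W1 (B j) (of_nat j - a - 1) 0 w1 = 0" if "K \<le> j" for j
        using N[OF BJ K[OF that]] by simp
    qed simp_all
    show "H j m n = 0" if "N \<le> Re m" for j m n
      unfolding H_def N[OF BJ that] by (simp add: I_left.zero)
  qed
  then obtain M where M: "M > 0" "\<forall>c. ?P M c"
    by blast
  have "of_nat i + of_nat j - (- \<alpha> - of_int m - 1) - 1 = \<alpha> + of_int m + of_nat i + of_nat j" for i j :: nat
    by simp
  then show ?thesis by (intro that[of M B]) (use M B0 BJ in \<open>simp_all add: H_def add_ac\<close>)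
qed

text \<open>Same computation with \<open>X0\<close> and \<open>X1\<close> exchanged: now
  \<open>X0\<close> fixes the delta index as \<open>m\<close>, and \<open>X1\<close> carries the
  modes on \<open>W2\<close>. The leading vector is twisted by e^(pi i L).\<close>

lemma second_term:
  assumes v: "v \<in> joint_space V g1 g2 \<alpha> \<beta> d" and \<alpha>: "\<alpha> \<in> spectrum_exponents V g1"
  obtains M B where "M > 0" "B 0 = exp_L V g1 (pi * \<i>) v" "\<And>j. B j \<in> joint_space V g1 g2 \<alpha> \<beta> d"
    "\<And>e. jacobi2 v w1 w2
         (corner \<alpha> \<beta> m n e)
      = sum2 M B \<alpha> \<beta> m n w1 w2 e"
proof -
  let ?J = "joint_space V g1 g2 \<alpha> \<beta> d"
  let ?Q = "\<lambda>m. exp_L V g1 (pi * \<i>) (quotient_pow_L V g1 X2 (-1) X1 X0 v m)"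
  define B where "B j = ?Q (exps X1 X0 (of_nat j) (- \<alpha>) (\<alpha> - of_nat j))" for j
  have ve: "v \<in> gen_eigenspace V g1 \<alpha>" using v by (simp add: joint_space_def)
  note Q = v10.quotient_pow_L_exps[OF M1.vertex_algebra_automorphism_axioms \<alpha> ve, of "-1"]
  have J: "?J \<subseteq> gen_eigenspace V g1 \<alpha>" by (auto simp: joint_space_def)
  have BJ: "B j \<in> ?J" for j
    unfolding B_def
    by (intro M1.exp_L_stable[OF \<alpha> subspace_joint joint_stable(1) J]
        M1.quotient_pow_L_stable[OF \<alpha> subspace_joint joint_stable(1) J v])
  have B0: "B 0 = exp_L V g1 (pi * \<i>) v" unfolding B_def Q(2) ..
  obtain N where N: "\<And>u m k. u \<in> ?J \<Longrightarrow> N \<le> Re m \<Longrightarrow> wmode W2 u m k w2 = 0"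
    using M2.uniform_truncation[of d w2] unfolding joint_space_def by blast
  define H where "H j m n = I w1 n 0 (wmode W2 (B j) m 0 w2)" for j m n
  have "\<exists>M>0. \<forall>c. smul (wscale W3) (delta X2 (-1) X1 (-1) X0)
      ((\<lambda>v'. YI I w1 X2 \<odot> YW W2 v' X1 w2) \<odot> ?Q)
      (exps X1 X0 (- \<beta> - of_int n - 1) (- \<alpha> - of_int m - 1) c)
    = (\<Sum>i<M. \<Sum>j<M. wscale W3 ((-1) powi (- m) * (of_int m gchoose i) * (-1) ^ i)
        (H j (of_nat i + of_nat j - (- \<beta> - of_int n - 1) - 1) (\<alpha> + of_int m - of_nat i - of_nat j - c - 1)))"
    (is "\<exists>M>0. \<forall>c. ?P M c")
  proof (rule v10.smul_delta_double[OF M3.W_vector_space, where N = N and H = H and n = m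
        and \<epsilon> = "-1" and \<eta> = "-1" and a = "- \<beta> - of_int n - 1"])
    show "((\<lambda>v'. YI I w1 X2 \<odot> YW W2 v' X1 w2) \<odot> ?Q) (exps X1 X0 a b c)
      = (if b = - \<alpha> then \<Sum>j<K. H j (of_nat j - a - 1) (\<alpha> - of_nat j - c - 1) else 0)"
      if K: "\<And>j. K \<le> j \<Longrightarrow> N \<le> Re (of_nat j - a - 1)" for a b c K
      unfolding H_def
    proof (rule v10.series_apply_exps[where B = B and h = "\<lambda>u m n. I w1 n 0 (wmode W2 u m 0 w2)"])
      show "\<exists>j. a = of_nat j \<and> b = - \<alpha> \<and> c = \<alpha> - of_nat j" if "?Q (exps X1 X0 a b c) \<noteq> 0" for a b c
        using that by (intro Q(1)) auto
      show "?Q (exps X1 X0 (of_nat j) (- \<alpha>) (\<alpha> - of_nat j)) = B j" for j by (simp add: B_def)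
      show "(YI I w1 X2 \<odot> YW W2 u X1 w2) (exps X1 X0 a b c)
          = (if b = 0 then I w1 (- c - 1) 0 (wmode W2 u (- a - 1) 0 w2) else 0)" for u a b c
        by (rule v10.series_apply_pair[where k = "\<lambda>w n. I w1 n 0 w" and t = "\<lambda>n. wmode W2 u n 0 w2"])
          (simp_all add: YW_def YI_def v10.log_series_exps log_series_zero I_right.zero)
      show "(YI I w1 X2 \<odot> YW W2 0 X1 w2) m = 0" for m
        by (simp add: series_apply_def formal_sum_def case_prod_unfold)
      show "I w1 (\<alpha> - of_nat j - c - 1) 0 (wmode W2 (B j) (of_nat j - a - 1) 0 w2) = 0" if "K \<le> j" for j
        unfolding N[OF BJ K[OF that]] by (simp add: I_right.zero)
    qed
    show "H j m n = 0" if "N \<le> Re m" for j m n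
      unfolding H_def N[OF BJ that] by (simp add: I_right.zero)
  qed
  then obtain M where M: "M > 0" "\<forall>c. ?P M c"
    by blast
  have "of_nat i + of_nat j - (- \<beta> - of_int n - 1) - 1 = \<beta> + of_int n + of_nat i + of_nat j" for i j :: nat
    by simp
  then show ?thesis by (intro that[of M B]) (use M B0 BJ in \<open>simp_all add: H_def exps_swap add_ac\<close>)
qed

lemma mode_product_in:
  assumes C: "M3.ws.subspace C" and mode: "\<And>w. a = 0 \<Longrightarrow> wmode W3 u (- b - 1) 0 w \<in> C"
  shows "(YW W3 u X1 \<odot> YI I w1 X2 w2) (exps X0 X1 a b c) \<in> C"
proof (rule M3.ws.series_apply_in_subspace[OF C])
  fix m1 m2 assume "m1 + m2 = exps X0 X1 a b c"
  then obtain a1 b1 c1 where 1: "m1 = exps X0 X1 a1 b1 c1" "m2 = exps X0 X1 (a - a1) (b - b1) (c - c1)"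
    by (rule v01.exps_add_eqD)
  show "YW W3 u X1 (YI I w1 X2 w2 m1) m2 \<in> C"
  proof (cases "a1 = 0 \<and> b1 = 0")
    case True
    then show ?thesis
      unfolding 1(2) YW_def log_series_v10 using mode M3.ws.subspace_0[OF C] by simp
  next
    case False
    have "YI I w1 X2 w2 m1 = 0"
      unfolding 1 YI_def v01.log_series_exps(2) by (rule if_not_P[OF False])
    then show ?thesis using M3.ws.subspace_0[OF C] by simp
  qed
qed

text \<open>Only membership in \<open>C\<close> is claimed, so the coefficient is treated summand by
  summand. The exponent of \<open>X0\<close> fixes the delta index, and that of \<open>X1\<close>
  leaves a mode of index \<alpha> + \<beta> + m + n lowered by the two expansion indices.\<close>

lemma first_term:
  assumes v: "v \<in> joint_space V g1 g2 \<alpha> \<beta> d" and \<alpha>: "\<alpha> \<in> spectrum_exponents V g1"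
    and C: "M3.ws.subspace C"
    and mode: "\<And>u k w. u \<in> joint_space V g1 g2 \<alpha> \<beta> d \<Longrightarrow>
      wmode W3 u (\<alpha> + \<beta> + of_int m + of_int n - of_nat k) 0 w \<in> C"
  shows "jacobi1 v w1 w2
         (corner \<alpha> \<beta> m n e) \<in> C"
  unfolding smul_def
proof (rule M3.ws.formal_sum_in_subspace[OF C])
  let ?J = "joint_space V g1 g2 \<alpha> \<beta> d"
  let ?Q = "quotient_pow_L V g1 X1 (-1) X2 X0 v"
  let ?G = "(\<lambda>v'. YW W3 v' X1 \<odot> YI I w1 X2 w2) \<odot> ?Q"
  have ve: "v \<in> gen_eigenspace V g1 \<alpha>" using v by (simp add: joint_space_def)
  have QJ: "?Q a \<in> ?J" for a
    by (rule M1.quotient_pow_L_stable[OF \<alpha> subspace_joint joint_stable(1) _ v]) (auto simp: joint_space_def)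
  fix p assume p: "(case p of (a, b) \<Rightarrow> a + b) = exps X0 X1 (- \<alpha> - of_int m - 1) (- \<beta> - of_int n - 1) e"
  obtain m1 m2 where pm: "p = (m1, m2)" by (cases p)
  show "(case p of (a, b) \<Rightarrow> wscale W3 (delta X1 (-1) X2 1 X0 a) (?G b)) \<in> C"
  proof (cases "delta X1 (-1) X2 1 X0 m1 = 0")
    case True
    then show ?thesis using pm M3.ws.subspace_0[OF C] by simp
  next
    case False
    then obtain k :: int and i :: nat where
      m1: "m1 = xpow X0 (- of_int k - 1) + xpow X1 (of_int k - of_nat i) + xpow X2 (of_nat i)"
      unfolding delta_def by (auto dest!: formal_sum_nonzero)
    then have m1: "m1 = exps X0 X1 (- of_int k - 1) (of_int k - of_nat i) (of_nat i)"
      by (simp add: v01.xpow_exps v01.exps_add)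
    obtain a1 b1 c1 where 1: "m1 = exps X0 X1 a1 b1 c1"
      "m2 = exps X0 X1 (- \<alpha> - of_int m - 1 - a1) (- \<beta> - of_int n - 1 - b1) (e - c1)"
      using p pm by (auto elim: v01.exps_add_eqD)
    have abc: "a1 = - of_int k - 1" "b1 = of_int k - of_nat i" "c1 = of_nat i"
      using m1 unfolding 1 by (simp_all add: v01.exps_eq_iff)
    have m2: "m2 = exps X0 X1 (- \<alpha> - of_int m + of_int k) (- \<beta> - of_int n - 1 - of_int k + of_nat i) (e - of_nat i)"
      unfolding 1 abc by (simp add: v01.exps_eq_iff)
    have "?G m2 \<in> C"
    proof (rule M3.ws.series_apply_in_subspace[OF C])
      fix m3 m4 assume m34: "m3 + m4 = m2"
      show "(YW W3 (?Q m3) X1 \<odot> YI I w1 X2 w2) m4 \<in> C"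
      proof (cases "?Q m3 = 0")
        case True
        then have "(YW W3 (?Q m3) X1 \<odot> YI I w1 X2 w2) m4 = 0"
          by (simp add: series_apply_def formal_sum_def case_prod_unfold)
        then show ?thesis using M3.ws.subspace_0[OF C] by simp
      next
        case False
        from m34 obtain a3 b3 c3 where 3: "m3 = exps X0 X1 a3 b3 c3"
          "m4 = exps X0 X1 (- \<alpha> - of_int m + of_int k - a3)
             (- \<beta> - of_int n - 1 - of_int k + of_nat i - b3) (e - of_nat i - c3)"
          unfolding m2 by (auto elim: v01.exps_add_eqD)
        obtain j where "m3 = xpow X1 (\<alpha> - of_nat j) + xpow X2 (of_nat j) + xpow X0 (- \<alpha>)"
          using M1.quotient_pow_L_support[OF \<alpha> ve False] 3 by auto
        then have "m3 = exps X0 X1 (- \<alpha>) (\<alpha> - of_nat j) (of_nat j)"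
          by (simp add: v01.xpow_exps v01.exps_add)
        then have ab3: "a3 = - \<alpha>" "b3 = \<alpha> - of_nat j"
          unfolding 3 by (simp_all add: v01.exps_eq_iff)
        show ?thesis
          unfolding 3(2)
        proof (rule mode_product_in[OF C])
          fix w assume "- \<alpha> - of_int m + of_int k - a3 = 0"
          then have k: "k = m" unfolding ab3 by simp
          have eq: "- (- \<beta> - of_int n - 1 - of_int k + of_nat i - b3) - 1
              = \<alpha> + \<beta> + of_int m + of_int n - of_nat (i + j)"
            unfolding ab3 k by simp
          show "wmode W3 (?Q m3) (- (- \<beta> - of_int n - 1 - of_int k + of_nat i - b3) - 1) 0 w \<in> C"
            unfolding eq by (rule mode[OF QJ])
        qed
      qed
    qed
    then show ?thesis using pm M3.ws.subspace_scale[OF C] by simp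
  qed
qed

end


section \<open>Values of the intertwining operator\<close>

context generalized_twisted_module
begin

sublocale Wdec: eigen_decomposition "wscale W" UNIV "wgrade W" "LW0 W" "\<lambda>n. n"
proof (intro eigen_decomposition.intro direct_sum_decomposition.intro W_vector_space
    direct_sum_decomposition_axioms.intro W_grading LW.endomorphism_axioms
    eigen_decomposition_axioms.intro)
  show "wgrade W i \<subseteq> geig (wscale W) (LW0 W) i" for i
    using W_grade_L0 by (auto simp: geig_def)
qed simp

lemma wgrade_geig: "wgrade W n = geig (wscale W) (LW0 W) n"
  using Wdec.summand_eq_geig by simp

lemma subspace_wgrade: "ws.subspace (wgrade W n)"
  by (rule Wdec.subspace_summand) simp

lemma LW0_wgrade: "w \<in> wgrade W n \<Longrightarrow> LW0 W w \<in> wgrade W n"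
  by (simp add: wgrade_geig LW.geig_self)

lemma mode_wgrade:
  assumes "v \<in> vgrade V d" "w \<in> wgrade W n"
  shows "wmode W v m k w \<in> wgrade W (of_int d + n - m - 1)"
  using mode_weight[of v d w n] assms by (simp add: wgrade_geig)

end

text \<open>The generators of the subspace built from vectors that are homogeneous for the weight
  and for both automorphisms, sorted by the weight \<gamma> of the resulting mode. The second
  automorphism \<open>h\<close> is recorded because the reduction needs an exponent for it as
  well.\<close>

definition homogeneous_generators ::
  "'v::ab_group_add vertex_algebra \<Rightarrow> ('v \<Rightarrow> 'v) \<Rightarrow> ('v \<Rightarrow> 'v) \<Rightarrow>
   ('v, 'w::ab_group_add) graded_twisted_module \<Rightarrow> int \<Rightarrow> complex \<Rightarrow> 'w set" where
  "homogeneous_generators V g h W n \<gamma> =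
     {wmode W u (\<alpha> - of_int n) 0 w | u w \<alpha> \<beta> d \<delta>.
        \<alpha> \<in> spectrum_exponents V g \<and> \<beta> \<in> spectrum_exponents V h \<and> 1 \<le> d \<and>
        u \<in> joint_space V g h \<alpha> \<beta> d \<and> w \<in> wgrade W \<delta> \<and>
        \<gamma> = of_int d - \<alpha> + of_int n - 1 + \<delta>}"

context generalized_twisted_module
begin

lemma homogeneous_generators_wgrade: "homogeneous_generators V g h W n \<gamma> \<subseteq> wgrade W \<gamma>"
proof
  fix x assume "x \<in> homogeneous_generators V g h W n \<gamma>"
  then obtain u w \<alpha> \<beta> d \<delta> where x: "x = wmode W u (\<alpha> - of_int n) 0 w" "u \<in> joint_space V g h \<alpha> \<beta> d"
    "w \<in> wgrade W \<delta>" "\<gamma> = of_int d - \<alpha> + of_int n - 1 + \<delta>"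
    unfolding homogeneous_generators_def by blast
  have "wmode W u (\<alpha> - of_int n) 0 w \<in> wgrade W (of_int d + \<delta> - (\<alpha> - of_int n) - 1)"
    using x(2,3) by (intro mode_wgrade) (simp_all add: joint_space_def)
  moreover have "of_int d + \<delta> - (\<alpha> - of_int n) - 1 = \<gamma>" using x(4) by simp
  ultimately show "x \<in> wgrade W \<gamma>" using x(1) by simp
qed

lemma C_subspace_homogeneous:
  assumes comm: "commuting_automorphisms V g h"
  shows "C_subspace V g W n = ws.span (\<Union>\<gamma>. homogeneous_generators V g h W n \<gamma>)"
proof
  interpret comm: commuting_automorphisms V g h by fact
  let ?S = "ws.span (\<Union>\<gamma>. homogeneous_generators V g h W n \<gamma>)"
  have *: "wmode W u (\<alpha> - of_int n) 0 w \<in> ?S"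
    if \<alpha>: "\<alpha> \<in> spectrum_exponents V g" and u: "u \<in> gen_eigenspace V g \<alpha>" "u \<in> V_plus V" for \<alpha> u w
  proof -
    have "wmode W u (\<alpha> - of_int n) 0 w \<in> ?S"
      if \<beta>: "\<beta> \<in> spectrum_exponents V h" and d: "1 \<le> d" and u: "u \<in> joint_space V g h \<alpha> \<beta> d" for u \<beta> d
    proof -
      have "wmode W u (\<alpha> - of_int n) 0 (Wdec.comp w \<delta>) \<in> ?S" for \<delta>
      proof (rule ws.span_base)
        have "Wdec.comp w \<delta> \<in> wgrade W \<delta>" by (rule Wdec.comp_in) simp
        then show "wmode W u (\<alpha> - of_int n) 0 (Wdec.comp w \<delta>) \<in> (\<Union>\<gamma>. homogeneous_generators V g h W n \<gamma>)"
          unfolding homogeneous_generators_def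
          by (intro UN_I[OF UNIV_I] CollectI exI conjI) (rule refl \<alpha> \<beta> d u | assumption)+
      qed
      then have "(\<Sum>\<delta> | Wdec.comp w \<delta> \<noteq> 0. wmode W u (\<alpha> - of_int n) 0 (Wdec.comp w \<delta>)) \<in> ?S"
        by (intro ws.span_sum)
      then show ?thesis unfolding mode_right.sum[symmetric] Wdec.sum_comp .
    qed
    then have "(\<Union>\<beta>\<in>spectrum_exponents V h. \<Union>d\<in>{1..}. joint_space V g h \<alpha> \<beta> d)
        \<subseteq> {u. wmode W u (\<alpha> - of_int n) 0 w \<in> ?S}"
      by auto
    then have "vs.span (\<Union>\<beta>\<in>spectrum_exponents V h. \<Union>d\<in>{1..}. joint_space V g h \<alpha> \<beta> d)
        \<subseteq> {u. wmode W u (\<alpha> - of_int n) 0 w \<in> ?S}"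
      by (rule vs.span_minimal) (rule mode_left.subspace_linear_preimage, rule ws.subspace_span)
    then show ?thesis using comm.joint_span[OF u] by blast
  qed
  show "C_subspace V g W n \<subseteq> ?S"
    unfolding C_subspace_def by (rule ws.span_minimal) (use * in auto)
  have "u \<in> V_plus V" if "u \<in> vgrade V d" "1 \<le> d" for u d
    unfolding V_plus_def using that by (auto intro!: vs.span_base)
  then show "?S \<subseteq> C_subspace V g W n"
    unfolding C_subspace_def homogeneous_generators_def joint_space_def
    by (intro ws.span_mono) blast
qed

end

lemma sum_fun_apply: "(\<Sum>i\<in>A. F i) x = (\<Sum>i\<in>A. F i x)"
  by (induction A rule: infinite_finite_induct) auto

definition pointwise_scale :: "('a \<Rightarrow> 'b \<Rightarrow> 'b) \<Rightarrow> 'a \<Rightarrow> ('i \<Rightarrow> 'b) \<Rightarrow> 'i \<Rightarrow> 'b" where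
  "pointwise_scale sc c F = (\<lambda>i. sc c (F i))"

lemma vector_space_pointwise:
  assumes "vector_space sc" shows "vector_space (pointwise_scale sc)"
proof -
  interpret vector_space sc by fact
  show ?thesis
    by unfold_locales
      (auto simp: pointwise_scale_def fun_eq_iff scale_right_distrib scale_left_distrib)
qed

context vector_space
begin

lemma double_sum_lead:
  assumes Z: "subspace Z" and sum: "(\<Sum>i<M. \<Sum>j<M. x i j) \<in> Z" and M: "(M::nat) > 0"
    and rest: "\<And>i j. (i, j) \<noteq> (0, 0) \<Longrightarrow> x i j \<in> Z"
  shows "x 0 0 \<in> Z"
proof -
  have eq: "(\<Sum>i<M. \<Sum>j<M. x i j) = (\<Sum>p\<in>{..<M} \<times> {..<M}. x (fst p) (snd p))"
    by (simp add: sum.cartesian_product case_prod_unfold)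
  also have "\<dots> = x 0 0 + (\<Sum>p\<in>{..<M} \<times> {..<M} - {(0, 0)}. x (fst p) (snd p))"
    using M by (subst sum.remove[of _ "(0, 0)"]) auto
  finally have "x 0 0 = (\<Sum>i<M. \<Sum>j<M. x i j) - (\<Sum>p\<in>{..<M} \<times> {..<M} - {(0, 0)}. x (fst p) (snd p))"
    by simp
  also have "\<dots> \<in> Z"
    by (rule subspace_diff[OF Z sum], rule subspace_sum[OF Z], rule rest) (auto simp: prod_eq_iff)
  finally show ?thesis .
qed

text \<open>Stated for families because members might coincide; a coincidence would be a relation
  with coefficients 1 and -1.\<close>

lemma card_le_of_independent_family:
  assumes J: "finite J" and T: "finite T" and y: "\<And>j. j \<in> J \<Longrightarrow> y j \<in> span T"
    and ind: "\<And>c j. (\<Sum>j\<in>J. c j *s y j) = 0 \<Longrightarrow> j \<in> J \<Longrightarrow> c j = 0"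
  shows "card J \<le> card T"
proof -
  have inj: "inj_on y J"
  proof (rule inj_onI, rule ccontr)
    fix i j assume ij: "i \<in> J" "j \<in> J" "y i = y j" "i \<noteq> j"
    let ?c = "\<lambda>k. (if k = i then 1 else 0) - (if k = j then 1 else 0)"
    have "(\<Sum>k\<in>J. ?c k *s y k) = (\<Sum>k\<in>J. if k = i then y k else 0) - (\<Sum>k\<in>J. if k = j then y k else 0)"
      unfolding sum_subtractf[symmetric] by (intro sum.cong) (auto simp: scale_left_diff_distrib)
    also have "\<dots> = 0" using ij J by simp
    finally show False using ind[of ?c i] ij by simp
  qed
  have "independent (y ` J)"
  proof (rule independent_if_scalars_zero)
    fix c x assume "(\<Sum>x\<in>y ` J. c x *s x) = 0" "x \<in> y ` J"
    then show "c x = 0" using ind[of "c \<circ> y"] by (auto simp: sum.reindex[OF inj])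
  qed (use J in simp)
  moreover have "y ` J \<subseteq> span T" using y by blast
  ultimately have "card (y ` J) \<le> card T" using independent_span_bound[OF T] by blast
  then show ?thesis by (simp add: card_image[OF inj])
qed

end

locale graded_product = twisted_intertwining_operator V g1 g2 W1 W2 W3 I
  for V :: "'v::ab_group_add vertex_algebra" and g1 g2 :: "'v \<Rightarrow> 'v"
    and W1 :: "('v, 'w1::ab_group_add) graded_twisted_module"
    and W2 :: "('v, 'w2::ab_group_add) graded_twisted_module"
    and W3 :: "('v, 'w3::ab_group_add) graded_twisted_module"
    and I :: "'w1 \<Rightarrow> complex \<Rightarrow> nat \<Rightarrow> 'w2 \<Rightarrow> 'w3" +
  assumes lower_bounded1: "lower_bounded_generalized_twisted_module V g1 W1"
    and lower_bounded2: "lower_bounded_generalized_twisted_module V g2 W2"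
    and generalized3: "generalized_twisted_module V (g1 \<circ> g2) W3"
begin

sublocale L1: lower_bounded_generalized_twisted_module V g1 W1 by (rule lower_bounded1)
sublocale L2: lower_bounded_generalized_twisted_module V g2 W2 by (rule lower_bounded2)
sublocale L3: generalized_twisted_module V "g1 \<circ> g2" W3 by (rule generalized3)

abbreviation pscale :: "complex \<Rightarrow> (complex \<Rightarrow> 'w3) \<Rightarrow> complex \<Rightarrow> 'w3" where
  "pscale \<equiv> pointwise_scale (wscale W3)"

sublocale Fn: vector_space pscale
  by (rule vector_space_pointwise[OF M3.W_vector_space])

lemma I_derivative:
  "wscale W3 (- n - 1) (I w1 n k w2) + wscale W3 (of_nat (k + 1)) (I w1 n (k + 1) w2)
    = I (LW_neg1 W1 w1) (n + 1) k w2"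
  using fun_cong[OF I_L_neg1_derivative[of X0 w1 w2], of "(0(X0 := - n - 2), 0(X0 := k))"]
  unfolding YI_def fderiv_log_series by (simp add: log_series_coeff add.commute[of 1])

lemma I_L0:
  "LW0 W3 (I w1 n k w2) - I w1 n k (LW0 W2 w2)
    = wscale W3 (- n - 1) (I w1 n k w2) + wscale W3 (of_nat (k + 1)) (I w1 n (k + 1) w2)
      + I (LW0 W1 w1) n k w2"
proof -
  have "(0(X0 := - n - 1 :: complex))(X0 := - n - 1 - 1) = 0(X0 := - n - 2)" by (simp add: fun_eq_iff)
  then show ?thesis
    using fun_cong[OF I_L0_commutator[of w1 X0 w2], of "(0(X0 := - n - 1), 0(X0 := k))"]
      fderiv_log_series[of "wscale W3" X0 "\<lambda>n k. I w1 n k w2" n k]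
    unfolding YI_def
    by (simp add: log_series_coeff smul_single_coeff[OF M3.W_vector_space])
qed

lemma I_wgrade:
  assumes "w1 \<in> wgrade W1 n1" "w2 \<in> wgrade W2 n2"
  shows "I w1 n k w2 \<in> wgrade W3 (n1 + n2 - n - 1)"
proof -
  have "I w1 n k w2 \<in> geig (wscale W3) (LW0 W3) (n1 + n2 + (- n - 1))"
  proof (rule geig_bilinear[where J = "\<lambda>k w1 w2. I w1 n k w2"])
    show "\<exists>K. \<forall>k>K. I w1 n k w2 = 0" for w1 w2 using I_log_polynomial[of w1 w2] by blast
    show "w1 \<in> geig (wscale W1) (LW0 W1) n1" "w2 \<in> geig (wscale W2) (LW0 W2) n2"
      using assms by (simp_all add: L1.wgrade_geig L2.wgrade_geig)
  qed (fact M1.LW.endomorphism_axioms M2.LW.endomorphism_axioms M3.LW.endomorphism_axioms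
      I_linear_left I_linear_right I_L0)+
  then show ?thesis by (simp add: L3.wgrade_geig algebra_simps)
qed

text \<open>For homogeneous vectors, this is the intertwining operator at \<open>x = 1\<close> and \<open>log x = 0\<close>: the
  value at \<open>h\<close> is its component of weight \<open>h\<close>.\<close>

definition T :: "complex \<Rightarrow> complex \<Rightarrow> 'w1 \<Rightarrow> 'w2 \<Rightarrow> complex \<Rightarrow> 'w3" where
  "T n1 n2 w1 w2 = (\<lambda>h. I w1 (n1 + n2 - h - 1) 0 w2)"

sublocale T_left: Vector_Spaces.linear "wscale W1" pscale "\<lambda>w1. T n1 n2 w1 w2" for n1 n2 w2
  unfolding Vector_Spaces.linear_iff
  by (auto simp: M1.W_vector_space Fn.vector_space_axioms T_def pointwise_scale_def fun_eq_iff
      I_left.add I_left.scale)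

sublocale T_right: Vector_Spaces.linear "wscale W2" pscale "T n1 n2 w1" for n1 n2 w1
  unfolding Vector_Spaces.linear_iff
  by (auto simp: M2.W_vector_space Fn.vector_space_axioms T_def pointwise_scale_def fun_eq_iff
      I_right.add I_right.scale)

definition C_valued :: "int \<Rightarrow> (complex \<Rightarrow> 'w3) set" where
  "C_valued t = {F. \<forall>h. F h \<in> C_subspace V (g1 \<circ> g2) W3 t}"

lemma subspace_C3: "M3.ws.subspace (C_subspace V (g1 \<circ> g2) W3 t)"
  unfolding C_subspace_def by (rule M3.ws.subspace_span)

lemma subspace_C_valued: "Fn.subspace (C_valued t)"
  by (rule Fn.subspaceI)
    (auto simp: C_valued_def pointwise_scale_def M3.ws.subspace_0 M3.ws.subspace_add M3.ws.subspace_scale subspace_C3)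

abbreviation T_sum2 where "T_sum2 N B d \<beta> m n n1 n2 w1 w2 \<equiv> (\<Sum>i<N. \<Sum>j<N. pscale ((-1) powi (- m) * (of_int m gchoose i) * (-1) ^ i)
        (T n1 (of_int d - \<beta> - of_int n - of_nat i - of_nat j - 1 + n2) w1
          (wmode W2 (B j) (\<beta> + of_int n + of_nat i + of_nat j) 0 w2)))"

abbreviation T_sum3 where "T_sum3 M A d \<alpha> m n n1 n2 w1 w2 \<equiv> (\<Sum>i<M. \<Sum>j<M. pscale (of_int n gchoose i)
        (T (of_int d - \<alpha> - of_int m - of_nat i - of_nat j - 1 + n1) n2
          (wmode W1 (A j) (\<alpha> + of_int m + of_nat i + of_nat j) 0 w1) w2))"

text \<open>The condition on \<open>t\<close> turns every mode in the first term of the Jacobi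
  identity into one of index (\<alpha> + \<beta> - carry) - t - i with i \<ge> 0, which maps into
  the subspace by \<open>C_subspace_lower_modes\<close>. The scalars and ranges do not depend on the
  weight component, so the relation holds between families.\<close>

lemma reduction:
  assumes v: "v \<in> joint_space V g1 g2 \<alpha> \<beta> d"
    and d: "1 \<le> d"
    and \<alpha>: "\<alpha> \<in> spectrum_exponents V g1" and \<beta>: "\<beta> \<in> spectrum_exponents V g2"
    and t: "2 \<le> t" "t \<le> - (m + n) - carry \<alpha> \<beta>"
  obtains M A N B where "M > 0" "N > 0" "A 0 = v" "B 0 = exp_L V g1 (pi * \<i>) v"
    "\<And>j. A j \<in> joint_space V g1 g2 \<alpha> \<beta> d" "\<And>j. B j \<in> joint_space V g1 g2 \<alpha> \<beta> d"
    "T_sum2 N B d \<beta> m n n1 n2 w1 w2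
     + T_sum3 M A d \<alpha> m n n1 n2 w1 w2 \<in> C_valued t"
proof -
  let ?C = "C_subspace V (g1 \<circ> g2) W3 t"
  have mode: "wmode W3 u (\<alpha> + \<beta> + of_int m + of_int n - of_nat k) 0 w \<in> ?C"
    if u: "u \<in> joint_space V g1 g2 \<alpha> \<beta> d" for u k w
  proof (cases "u = 0")
    case True
    then show ?thesis by (simp add: M3.mode_left.zero M3.ws.subspace_0[OF subspace_C3])
  next
    case False
    let ?i = "k + nat (- (m + n) - carry \<alpha> \<beta> - t)"
    have "u \<in> V_plus V"
      using u d unfolding V_plus_def joint_space_def by (auto intro!: M1.vs.span_base)
    then have "wmode W3 u (\<alpha> + \<beta> - of_int (carry \<alpha> \<beta>) - of_int t - of_nat ?i) 0 w \<in> ?C"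
      using carry_spectrum[OF M3.vertex_algebra_automorphism_axioms \<alpha> \<beta> u False]
        joint_product[OF u] t(1) by (intro M3.C_subspace_lower_modes)
    moreover have "\<alpha> + \<beta> - of_int (carry \<alpha> \<beta>) - of_int t - of_nat ?i = \<alpha> + \<beta> + of_int m + of_int n - of_nat k"
      using t(2) by simp
    ultimately show ?thesis by (simp only:)
  qed
  obtain M A where A: "M > 0" "A 0 = v" "\<And>j. A j \<in> joint_space V g1 g2 \<alpha> \<beta> d"
    "\<And>e. jacobi3 v w1 w2
         (corner \<alpha> \<beta> m n e)
      = sum3 M A \<alpha> \<beta> m n w1 w2 e"
    using third_term[OF v \<beta>, of w2 w1 m n] by blast
  obtain N B where B: "N > 0" "B 0 = exp_L V g1 (pi * \<i>) v" "\<And>j. B j \<in> joint_space V g1 g2 \<alpha> \<beta> d"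
    "\<And>e. jacobi2 v w1 w2
         (corner \<alpha> \<beta> m n e)
      = sum2 N B \<alpha> \<beta> m n w1 w2 e"
    using second_term[OF v \<alpha>, of w1 w2 m n] by blast
  let ?F = "T_sum2 N B d \<beta> m n n1 n2 w1 w2"
  let ?G = "T_sum3 M A d \<alpha> m n n1 n2 w1 w2"
  have "(?F + ?G) h \<in> ?C" for h
  proof -
    \<comment> \<open>The exponent of \<open>X2\<close> at which all summands of both sums have
      weight \<open>h\<close>.\<close>
    define e where "e = \<alpha> + of_int m + \<beta> + of_int n - of_int d + 1 - n1 - n2 + h"
    have "n1 + (of_int d - \<beta> - of_int n - of_nat i - of_nat j - 1 + n2) - h - 1
        = \<alpha> + of_int m - of_nat i - of_nat j - e - 1"
      "(of_int d - \<alpha> - of_int m - of_nat i - of_nat j - 1 + n1) + n2 - h - 1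
        = \<beta> + of_int n - of_nat i - of_nat j - e - 1" for i j :: nat
      by (simp_all add: e_def)
    then have "(?F + ?G) h = jacobi2 v w1 w2
         (corner \<alpha> \<beta> m n e)
      + jacobi3 v w1 w2
         (corner \<alpha> \<beta> m n e)"
      unfolding A(4) B(4) by (simp only: plus_fun_apply sum_fun_apply pointwise_scale_def T_def)
    also have "\<dots> = jacobi1 v w1 w2
         (corner \<alpha> \<beta> m n e)"
      unfolding I_jacobi[symmetric] minus_apply by simp
    also have "\<dots> \<in> ?C" by (rule first_term[OF v \<alpha> subspace_C3 mode])
    finally show ?thesis .
  qed
  then have "?F + ?G \<in> C_valued t" unfolding C_valued_def by blast
  then show ?thesis using that[of M N A B] A(1-3) B(1-3) by blast
qed

end


context graded_product
begin

text \<open>In each sum the term (i, j) has total weight i + j below its leading term. The bounds by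
  \<open>r + 1\<close> thus bring all other terms to weight at most \<open>r\<close>; if the leading
  term of the opposite sum also has weight at most \<open>r\<close>, a single unknown term is left,
  with a nonzero coefficient.\<close>

lemma reduction_in_subspace:
  assumes v: "v \<in> joint_space V g1 g2 \<alpha> \<beta> d" and d: "1 \<le> d"
    and \<alpha>: "\<alpha> \<in> spectrum_exponents V g1" and \<beta>: "\<beta> \<in> spectrum_exponents V g2"
    and t: "2 \<le> t" "t \<le> - (m + n) - carry \<alpha> \<beta>" and Z: "Fn.subspace Z" "C_valued t \<subseteq> Z"
    and w: "w1 \<in> wgrade W1 n1" "w2 \<in> wgrade W2 n2"
    and IH: "\<And>m1 m2 u1 u2. u1 \<in> wgrade W1 m1 \<Longrightarrow> u2 \<in> wgrade W2 m2 \<Longrightarrow>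
      Re m1 + Re m2 \<le> r \<Longrightarrow> T m1 m2 u1 u2 \<in> Z"
    and r: "Re (of_int d - \<alpha> - of_int m - 1 + n1) + Re n2 \<le> r + 1"
      "Re n1 + Re (of_int d - \<beta> - of_int n - 1 + n2) \<le> r + 1"
  shows "Re n1 + Re (of_int d - \<beta> - of_int n - 1 + n2) \<le> r \<Longrightarrow>
      T (of_int d - \<alpha> - of_int m - 1 + n1) n2 (wmode W1 v (\<alpha> + of_int m) 0 w1) w2 \<in> Z"
    and "Re (of_int d - \<alpha> - of_int m - 1 + n1) + Re n2 \<le> r \<Longrightarrow>
      T n1 (of_int d - \<beta> - of_int n - 1 + n2) w1 (wmode W2 (exp_L V g1 (pi * \<i>) v) (\<beta> + of_int n) 0 w2) \<in> Z"
proof -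
  obtain M A N B where MN: "M > 0" "N > 0" and AB: "A 0 = v" "B 0 = exp_L V g1 (pi * \<i>) v"
    "\<And>j. A j \<in> joint_space V g1 g2 \<alpha> \<beta> d" "\<And>j. B j \<in> joint_space V g1 g2 \<alpha> \<beta> d" and
    D: "T_sum2 N B d \<beta> m n n1 n2 w1 w2 + T_sum3 M A d \<alpha> m n n1 n2 w1 w2 \<in> C_valued t"
    (is "?F + ?G \<in> _")
  proof (rule reduction[OF v d \<alpha> \<beta> t, of n1 n2 w1 w2], goal_cases)
    case (1 M A N B)
    from 1(2-8) show ?case by (rule that)
  qed
  have sum: "?F + ?G \<in> Z" using D Z(2) by blast
  have F: "pscale c (T n1 (of_int d - \<beta> - of_int n - of_nat i - of_nat j - 1 + n2) w1
      (wmode W2 (B j) (\<beta> + of_int n + of_nat i + of_nat j) 0 w2)) \<in> Z"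
    if "Re n1 + Re (of_int d - \<beta> - of_int n - 1 + n2) \<le> r + real i + real j" for c i j
  proof (intro Fn.subspace_scale[OF Z(1)] IH w)
    have "wmode W2 (B j) (\<beta> + of_int n + of_nat i + of_nat j) 0 w2
        \<in> wgrade W2 (of_int d + n2 - (\<beta> + of_int n + of_nat i + of_nat j) - 1)"
      using AB(4) w(2) by (intro L2.mode_wgrade) (auto simp: joint_space_def)
    then show "wmode W2 (B j) (\<beta> + of_int n + of_nat i + of_nat j) 0 w2
        \<in> wgrade W2 (of_int d - \<beta> - of_int n - of_nat i - of_nat j - 1 + n2)"
      by (simp add: algebra_simps)
  qed (use that in simp)
  have G: "pscale c (T (of_int d - \<alpha> - of_int m - of_nat i - of_nat j - 1 + n1) n2
      (wmode W1 (A j) (\<alpha> + of_int m + of_nat i + of_nat j) 0 w1) w2) \<in> Z"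
    if "Re (of_int d - \<alpha> - of_int m - 1 + n1) + Re n2 \<le> r + real i + real j" for c i j
  proof (intro Fn.subspace_scale[OF Z(1)] IH w)
    have "wmode W1 (A j) (\<alpha> + of_int m + of_nat i + of_nat j) 0 w1
        \<in> wgrade W1 (of_int d + n1 - (\<alpha> + of_int m + of_nat i + of_nat j) - 1)"
      using AB(3) w(1) by (intro L1.mode_wgrade) (auto simp: joint_space_def)
    then show "wmode W1 (A j) (\<alpha> + of_int m + of_nat i + of_nat j) 0 w1
        \<in> wgrade W1 (of_int d - \<alpha> - of_int m - of_nat i - of_nat j - 1 + n1)"
      by (simp add: algebra_simps)
  qed (use that in simp)
  have ij: "real i + real j \<ge> 1" if "(i, j) \<noteq> (0, 0)" for i j :: nat
    using that by (cases i; cases j) auto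
  show "T (of_int d - \<alpha> - of_int m - 1 + n1) n2 (wmode W1 v (\<alpha> + of_int m) 0 w1) w2 \<in> Z"
    if "Re n1 + Re (of_int d - \<beta> - of_int n - 1 + n2) \<le> r"
  proof -
    have "?F \<in> Z" using that by (intro Fn.subspace_sum[OF Z(1)] F) simp
    then have "?G \<in> Z" using Fn.subspace_diff[OF Z(1) sum, of ?F] by simp
    from Fn.double_sum_lead[OF Z(1) this MN(1) G] show ?thesis
      using r(1) ij by (fastforce simp: AB(1))
  qed
  show "T n1 (of_int d - \<beta> - of_int n - 1 + n2) w1 (wmode W2 (exp_L V g1 (pi * \<i>) v) (\<beta> + of_int n) 0 w2) \<in> Z"
    if "Re (of_int d - \<alpha> - of_int m - 1 + n1) + Re n2 \<le> r"
  proof -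
    have "?G \<in> Z" using that by (intro Fn.subspace_sum[OF Z(1)] G) simp
    then have "?F \<in> Z" using Fn.subspace_diff[OF Z(1) sum, of ?G] by simp
    from Fn.double_sum_lead[OF Z(1) this MN(2) F]
    have "pscale ((-1) powi (- m) * (of_int m gchoose 0) * (-1) ^ 0)
        (T n1 (of_int d - \<beta> - of_int n - of_nat 0 - of_nat 0 - 1 + n2) w1
          (wmode W2 (B 0) (\<beta> + of_int n + of_nat 0 + of_nat 0) 0 w2)) \<in> Z"
      using r(2) ij by fastforce
    then have "T n1 (of_int d - \<beta> - of_int n - of_nat 0 - of_nat 0 - 1 + n2) w1
          (wmode W2 (B 0) (\<beta> + of_int n + of_nat 0 + of_nat 0) 0 w2) \<in> Z"
      by (rule Fn.subspace_scaleD[OF Z(1)]) simp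
    then show ?thesis by (simp add: AB(2))
  qed
qed

text \<open>A reduction step lowers the total weight, but the drop depends on the exponents of \<open>v\<close> and
  may be arbitrarily small.  Since the weights of \<open>W1\<close> and \<open>W2\<close> are bounded below, the weight of \<open>v\<close>
  is bounded in terms of the initial total weight, which leaves only finitely many exponents.\<close>

lemma T_in_subspace:
  assumes p: "2 \<le> p" and q: "2 \<le> q" and Z: "Fn.subspace Z" "C_valued (min p q) \<subseteq> Z"
    and A: "\<And>n. wgrade W1 n \<subseteq> M1.ws.span ({a \<in> A. wt1 a = n} \<union> homogeneous_generators V g1 g2 W1 p n)"
    and B: "\<And>n. wgrade W2 n \<subseteq> M2.ws.span ({b \<in> B. wt2 b = n} \<union> homogeneous_generators V g2 g1 W2 q n)"
    and wt: "\<And>a. a \<in> A \<Longrightarrow> a \<in> wgrade W1 (wt1 a)" "\<And>b. b \<in> B \<Longrightarrow> b \<in> wgrade W2 (wt2 b)"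
    and AB: "\<And>a b. a \<in> A \<Longrightarrow> b \<in> B \<Longrightarrow> T (wt1 a) (wt2 b) a b \<in> Z"
    and w: "w1 \<in> wgrade W1 n1" "w2 \<in> wgrade W2 n2"
  shows "T n1 n2 w1 w2 \<in> Z"
proof -
  obtain N1 N2 :: int where N: "\<And>n. Re n < of_int N1 \<Longrightarrow> wgrade W1 n = {0}"
    "\<And>n. Re n < of_int N2 \<Longrightarrow> wgrade W2 n = {0}"
    using L1.W_lower_bounded L2.W_lower_bounded by blast
  have low1: "of_int N1 \<le> Re n" if "u \<in> wgrade W1 n" "u \<noteq> 0" for u n
    using N(1)[of n] that by (cases "Re n < of_int N1") auto
  have low2: "of_int N2 \<le> Re n" if "u \<in> wgrade W2 n" "u \<noteq> 0" for u n
    using N(2)[of n] that by (cases "Re n < of_int N2") auto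
  define D0 where "D0 = Re n1 + Re n2"
  define d0 where "d0 = \<lceil>D0 - of_int N1 - of_int N2\<rceil>"
  define P where "P = {(\<alpha>, \<beta>). \<alpha> \<in> spectrum_exponents V g1 \<and> \<beta> \<in> spectrum_exponents V g2 \<and>
      (\<exists>d\<in>{1..d0}. \<exists>v\<in>joint_space V g1 g2 \<alpha> \<beta> d. v \<noteq> 0)}"
  \<comment> \<open>The entries of the minimum, less the carry, are the differences between the two
    leading total weights for (m, n) = (-p, -carry) and (-carry, -q). They are positive since p, q
    \<ge> 2 and |Re \<alpha> - Re \<beta>| < 1.\<close>
  define drop :: "complex \<times> complex \<Rightarrow> real" where
    "drop = (\<lambda>(\<alpha>, \<beta>). min (of_int p + Re \<beta> - Re \<alpha>) (of_int q + Re \<alpha> - Re \<beta>) - of_int (carry \<alpha> \<beta>))"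
  \<comment> \<open>The entry 1 accounts for the nonleading terms of the sum that contains the
    leading term to be solved for.\<close>
  define \<epsilon> where "\<epsilon> = Min (insert 1 (drop ` P))"
  have fin: "finite (insert 1 (drop ` P))"
  proof -
    have "P \<subseteq> (\<Union>d\<in>{1..d0}. {\<alpha> \<in> spectrum_exponents V g1. \<exists>v \<in> vgrade V d. v \<noteq> 0 \<and> v \<in> gen_eigenspace V g1 \<alpha>}
        \<times> {\<beta> \<in> spectrum_exponents V g2. \<exists>v \<in> vgrade V d. v \<noteq> 0 \<and> v \<in> gen_eigenspace V g2 \<beta>})"
      unfolding P_def joint_space_def by blast
    then have "finite P" by (rule finite_subset) (simp add: M1.finite_exponents M2.finite_exponents)
    then show ?thesis by simp
  qed
  have drop_pos: "drop x > 0" if "x \<in> P" for x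
    using that p q by (auto simp: P_def spectrum_exponents_def drop_def carry_def)
  have \<epsilon>: "\<epsilon> > 0" "\<epsilon> \<le> 1" unfolding \<epsilon>_def using fin drop_pos by auto
  have \<epsilon>_drop: "\<epsilon> \<le> drop (\<alpha>, \<beta>)"
    if "\<alpha> \<in> spectrum_exponents V g1" "\<beta> \<in> spectrum_exponents V g2" "1 \<le> d"
      "v \<in> joint_space V g1 g2 \<alpha> \<beta> d" "v \<noteq> 0" "of_int d \<le> D0 - of_int N1 - of_int N2" for \<alpha> \<beta> d v
  proof -
    have "d \<le> d0" unfolding d0_def using that(6) by linarith
    then have "(\<alpha>, \<beta>) \<in> P" using that(1-5) unfolding P_def by auto
    then show ?thesis unfolding \<epsilon>_def using fin by (intro Min_le) auto
  qed
  have T_zero: "T m1 m2 0 u2 \<in> Z" "T m1 m2 u1 0 \<in> Z" for m1 m2 u1 u2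
    by (simp_all add: T_left.zero T_right.zero Fn.subspace_0[OF Z(1)])
  \<comment> \<open>Here \<open>k\<close> counts steps of size \<epsilon> above the sum of the two
    lower bounds. Below that sum one of the vectors is 0. The cap \<open>D0\<close> keeps the choice
    of \<epsilon> valid throughout.\<close>
  have "T m1 m2 u1 u2 \<in> Z"
    if "u1 \<in> wgrade W1 m1" "u2 \<in> wgrade W2 m2" "Re m1 + Re m2 \<le> D0"
      "Re m1 + Re m2 < of_int N1 + of_int N2 + real k * \<epsilon>" for k m1 m2 u1 u2
    using that
  proof (induction k arbitrary: m1 m2 u1 u2)
    case 0
    then have "u1 = 0 \<or> u2 = 0" using low1[of u1 m1] low2[of u2 m2] by force
    then show ?case using T_zero by auto
  next
    case (Suc k)
    have IH: "T m1' m2' u1' u2' \<in> Z"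
      if "u1' \<in> wgrade W1 m1'" "u2' \<in> wgrade W2 m2'" "Re m1' + Re m2' \<le> Re m1 + Re m2 - \<epsilon>" for m1' m2' u1' u2'
      using that Suc.prems(3,4) \<epsilon>(1) by (intro Suc.IH) (auto simp: algebra_simps)
    have left: "T m1 m2 x y \<in> Z"
      if x: "x \<in> homogeneous_generators V g1 g2 W1 p m1" and y: "y \<in> wgrade W2 m2" for x y
    proof -
      obtain v w \<alpha> \<beta> d \<delta> where *: "x = wmode W1 v (\<alpha> - of_int p) 0 w"
        "\<alpha> \<in> spectrum_exponents V g1" "\<beta> \<in> spectrum_exponents V g2" "1 \<le> d"
        "v \<in> joint_space V g1 g2 \<alpha> \<beta> d" "w \<in> wgrade W1 \<delta>" "m1 = of_int d - \<alpha> + of_int p - 1 + \<delta>"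
        using x unfolding homogeneous_generators_def by blast
      show ?thesis
      proof (cases "v = 0 \<or> w = 0 \<or> y = 0")
        case True
        then have "x = 0 \<or> y = 0" using *(1) by (auto simp: M1.mode_left.zero M1.mode_right.zero)
        then show ?thesis using T_zero by auto
      next
        case False
        have "Re m1 = of_int d - Re \<alpha> + of_int p - 1 + Re \<delta>" using *(7) by simp
        \<comment> \<open>Nonzero \<open>w\<close> and \<open>y\<close> have weights above the lower
          bounds, and -Re \<alpha> + p - 1 is positive, so the total weight limits
          \<open>d\<close>.\<close>
        then have "of_int d \<le> D0 - of_int N1 - of_int N2"
          using Suc.prems(3) low1[OF *(6)] low2[OF y] False *(2) p
          by (simp add: spectrum_exponents_def)
        then have "\<epsilon> \<le> drop (\<alpha>, \<beta>)" using \<epsilon>_drop *(2-5) False by blast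
        then show ?thesis
          using reduction_in_subspace(1)[OF *(5,4,2,3), of "min p q" "- p" "- carry \<alpha> \<beta>" Z w \<delta> y m2 "Re m1 + Re m2 - \<epsilon>"]
            IH p q Z *(6) y \<epsilon>(2) unfolding *(1,7) by (simp add: drop_def)
      qed
    qed
    have right: "T m1 m2 x y \<in> Z"
      if y: "y \<in> homogeneous_generators V g2 g1 W2 q m2" and x: "x \<in> wgrade W1 m1" for x y
    proof -
      obtain v w \<alpha> \<beta> d \<delta> where *: "y = wmode W2 v (\<beta> - of_int q) 0 w"
        "\<beta> \<in> spectrum_exponents V g2" "\<alpha> \<in> spectrum_exponents V g1" "1 \<le> d"
        "v \<in> joint_space V g2 g1 \<beta> \<alpha> d" "w \<in> wgrade W2 \<delta>" "m2 = of_int d - \<beta> + of_int q - 1 + \<delta>"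
        using y unfolding homogeneous_generators_def by blast
      have v: "v \<in> joint_space V g1 g2 \<alpha> \<beta> d" using *(5) by (simp add: joint_space_commute)
      show ?thesis
      proof (cases "v = 0 \<or> w = 0 \<or> x = 0")
        case True
        then have "x = 0 \<or> y = 0" using *(1) by (auto simp: M2.mode_left.zero M2.mode_right.zero)
        then show ?thesis using T_zero by auto
      next
        case False
        have "Re m2 = of_int d - Re \<beta> + of_int q - 1 + Re \<delta>" using *(7) by simp
        then have "of_int d \<le> D0 - of_int N1 - of_int N2"
          using Suc.prems(3) low2[OF *(6)] low1[OF x] False *(2) q
          by (simp add: spectrum_exponents_def)
        then have "\<epsilon> \<le> drop (\<alpha>, \<beta>)" using \<epsilon>_drop *(2-4) v False by blast
        moreover obtain u where u: "u \<in> joint_space V g1 g2 \<alpha> \<beta> d" "exp_L V g1 (pi * \<i>) u = v"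
          using M1.exp_L_surj[OF *(3) subspace_joint joint_stable(1) _ v] by (auto simp: joint_space_def)
        ultimately show ?thesis
          using reduction_in_subspace(2)[OF u(1) *(4,3,2), of "min p q" "- carry \<alpha> \<beta>" "- q" Z x m1 w \<delta> "Re m1 + Re m2 - \<epsilon>"]
            IH p q Z *(6) x \<epsilon>(2) unfolding *(1,7) by (simp add: drop_def)
      qed
    qed
    have "T m1 m2 a y \<in> Z" if a: "a \<in> A" "wt1 a = m1" and y: "y \<in> wgrade W2 m2" for a y
    proof -
      have "M2.ws.span ({b \<in> B. wt2 b = m2} \<union> homogeneous_generators V g2 g1 W2 q m2)
          \<subseteq> {y. T m1 m2 a y \<in> Z}"
        using AB[of a] a right wt(1)[of a]
        by (intro M2.ws.span_minimal T_right.subspace_linear_preimage Z(1)) auto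
      then show ?thesis using B y by blast
    qed
    then have "M1.ws.span ({a \<in> A. wt1 a = m1} \<union> homogeneous_generators V g1 g2 W1 p m1)
        \<subseteq> {x. T m1 m2 x u2 \<in> Z}"
      using left Suc.prems(2)
      by (intro M1.ws.span_minimal T_left.subspace_linear_preimage Z(1)) auto
    then show ?case using A Suc.prems(1) by blast
  qed
  moreover obtain k :: nat where "(D0 - of_int N1 - of_int N2) / \<epsilon> < real k"
    using reals_Archimedean2 by blast
  then have "D0 < of_int N1 + of_int N2 + real k * \<epsilon>"
    using \<epsilon>(1) by (simp add: field_simps)
  ultimately show ?thesis using w unfolding D0_def by blast
qed

end


section \<open>The dimension estimate\<close>

text \<open>A finite product can hide an infinite factor next to 0. In that case one of the sets is
  empty and so is the product set; otherwise both bounds are nonzero, hence finite.\<close>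

lemma finite_bases_product:
  fixes A :: "'a set" and B :: "'b set" and m n :: enat
  assumes A: "\<And>F. finite F \<Longrightarrow> F \<subseteq> A \<Longrightarrow> enat (card F) \<le> m"
    and B: "\<And>F. finite F \<Longrightarrow> F \<subseteq> B \<Longrightarrow> enat (card F) \<le> n" and fin: "m * n \<noteq> \<infinity>"
  shows "finite (A \<times> B) \<and> enat (card (A \<times> B)) \<le> m * n"
proof -
  have infinite: "k = \<infinity>" if inf: "infinite C" and le: "\<And>F. finite F \<Longrightarrow> F \<subseteq> C \<Longrightarrow> enat (card F) \<le> k"
    for C :: "'c set" and k :: enat
  proof (rule ccontr)
    assume "k \<noteq> \<infinity>"
    then obtain i where i: "k = enat i" by auto
    obtain F where "F \<subseteq> C" "card F = Suc i" "finite F" using infinite_arbitrarily_large[OF inf] by metis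
    then show False using le[of F] i by simp
  qed
  have nonzero: "k \<noteq> 0" if "c \<in> C" "\<And>F. finite F \<Longrightarrow> F \<subseteq> C \<Longrightarrow> enat (card F) \<le> k"
    for C :: "'c set" and c k
    using that(2)[of "{c}"] that(1) by (auto simp: zero_enat_def)
  show ?thesis
  proof (cases "A = {} \<or> B = {}")
    case True
    then show ?thesis by (auto simp: zero_enat_def[symmetric])
  next
    case False
    then have "m \<noteq> 0" "n \<noteq> 0" using nonzero[of _ A m] nonzero[of _ B n] A B by blast+
    then have "m \<noteq> \<infinity>" "n \<noteq> \<infinity>" using fin by (auto simp: imult_is_infinity)
    then have "finite A" "finite B" using infinite[of A m] infinite[of B n] A B by blast+
    moreover then have "enat (card A) * enat (card B) \<le> m * n" using A B by (intro mult_mono) auto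
    ultimately show ?thesis by (simp add: card_cartesian_product)
  qed
qed

context graded_product
begin

section \<open>Stability under L(0) and separation of weight components\<close>

definition T_span :: "(complex \<Rightarrow> 'w3) set" where
  "T_span = Fn.span {T n1 n2 w1 w2 | n1 n2 w1 w2. w1 \<in> wgrade W1 n1 \<and> w2 \<in> wgrade W2 n2}"

lemma T_in_T_span: "w1 \<in> wgrade W1 n1 \<Longrightarrow> w2 \<in> wgrade W2 n2 \<Longrightarrow> T n1 n2 w1 w2 \<in> T_span"
  unfolding T_span_def by (rule Fn.span_base) blast

lemma subspace_T_span: "Fn.subspace T_span"
  unfolding T_span_def by (rule Fn.subspace_span)

lemma T_wgrade: "w1 \<in> wgrade W1 n1 \<Longrightarrow> w2 \<in> wgrade W2 n2 \<Longrightarrow> T n1 n2 w1 w2 h \<in> wgrade W3 h"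
  using I_wgrade[of w1 n1 w2 n2 "n1 + n2 - h - 1" 0] by (simp add: T_def)

definition L0_fun :: "(complex \<Rightarrow> 'w3) \<Rightarrow> complex \<Rightarrow> 'w3" where
  "L0_fun F = (\<lambda>h. LW0 W3 (F h))"

sublocale L0_fun: endomorphism pscale L0_fun
  by (intro endomorphism.intro endomorphism_axioms.intro Fn.vector_space_axioms Fn.linear_endoI)
    (simp_all add: L0_fun_def pointwise_scale_def fun_eq_iff M3.LW.map_add M3.LW.map_scale)

text \<open>\<open>L(-1)\<close> is not assumed to raise weights by one on \<open>W1\<close>, but the remaining components of
  \<open>L(-1) w1\<close> do not contribute, because both sides have a definite weight.\<close>

lemma I_derivative_component:
  assumes w: "w1 \<in> wgrade W1 n1" "w2 \<in> wgrade W2 n2"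
  shows "wscale W3 (- n - 1) (I w1 n 0 w2) + I w1 n 1 w2
    = I (L1.Wdec.comp (LW_neg1 W1 w1) (n1 + 1)) (n + 1) 0 w2"
proof -
  let ?x = "LW_neg1 W1 w1" and ?m = "n1 + n2 - n - 1"
  have "I ?x (n + 1) 0 w2 = wscale W3 (- n - 1) (I w1 n 0 w2) + I w1 n 1 w2"
    using I_derivative[of n w1 0 w2] by simp
  moreover have "\<dots> \<in> wgrade W3 ?m"
    using I_wgrade[OF w] by (intro M3.ws.subspace_add M3.ws.subspace_scale L3.subspace_wgrade)
  ultimately have eq: "I ?x (n + 1) 0 w2 = L3.Wdec.comp (I ?x (n + 1) 0 w2) ?m"
    by (simp add: L3.Wdec.comp_self)
  have "I ?x (n + 1) 0 w2 = (\<Sum>j | L1.Wdec.comp ?x j \<noteq> 0. I (L1.Wdec.comp ?x j) (n + 1) 0 w2)"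
    by (subst L1.Wdec.sum_comp[symmetric]) (rule I_left.sum)
  then have "I ?x (n + 1) 0 w2
      = L3.Wdec.comp (\<Sum>j | L1.Wdec.comp ?x j \<noteq> 0. I (L1.Wdec.comp ?x j) (n + 1) 0 w2) ?m"
    using eq by metis
  also have "\<dots>
      = (\<Sum>j | L1.Wdec.comp ?x j \<noteq> 0. L3.Wdec.comp (I (L1.Wdec.comp ?x j) (n + 1) 0 w2) ?m)"
  proof -
    interpret l: Vector_Spaces.linear "wscale W3" "wscale W3" "\<lambda>v. L3.Wdec.comp v ?m"
      by (rule L3.Wdec.linear_comp)
    show ?thesis by (rule l.sum)
  qed
  also have "\<dots> = (\<Sum>j | L1.Wdec.comp ?x j \<noteq> 0. if j = n1 + 1 then I (L1.Wdec.comp ?x j) (n + 1) 0 w2 else 0)"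
  proof (rule sum.cong[OF refl])
    fix j
    have "I (L1.Wdec.comp ?x j) (n + 1) 0 w2 \<in> wgrade W3 (j + n2 - (n + 1) - 1)"
      using L1.Wdec.comp_in w(2) by (intro I_wgrade) auto
    moreover have "?m = j + n2 - (n + 1) - 1 \<longleftrightarrow> j = n1 + 1" by (auto simp: algebra_simps)
    ultimately show "L3.Wdec.comp (I (L1.Wdec.comp ?x j) (n + 1) 0 w2) ?m
        = (if j = n1 + 1 then I (L1.Wdec.comp ?x j) (n + 1) 0 w2 else 0)"
      by (simp add: L3.Wdec.comp_of_summand)
  qed
  also have "\<dots> = I (L1.Wdec.comp ?x (n1 + 1)) (n + 1) 0 w2"
    by (auto simp: L1.Wdec.finite_comp I_left.zero)
  finally show ?thesis using I_derivative[of n w1 0 w2] by simp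
qed

text \<open>The commutator with L(0) brings in the coefficient of the first power of log x, which
  \<open>T\<close> does not record. Together with its companion it is a logarithm-free coefficient
  for L(-1) w1, hence again a value of \<open>T\<close>.\<close>

lemma L0_fun_T_span: "F \<in> T_span \<Longrightarrow> L0_fun F \<in> T_span"
proof -
  assume F: "F \<in> T_span"
  have "L0_fun (T n1 n2 w1 w2) \<in> T_span" if w: "w1 \<in> wgrade W1 n1" "w2 \<in> wgrade W2 n2" for n1 n2 w1 w2
  proof -
    let ?y = "L1.Wdec.comp (LW_neg1 W1 w1) (n1 + 1)"
    have "L0_fun (T n1 n2 w1 w2) = T n1 n2 (LW0 W1 w1) w2 + T n1 n2 w1 (LW0 W2 w2) + T (n1 + 1) n2 ?y w2"
    proof
      fix h
      let ?n = "n1 + n2 - h - 1"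
      have "LW0 W3 (I w1 ?n 0 w2) = I (LW0 W1 w1) ?n 0 w2 + I w1 ?n 0 (LW0 W2 w2)
          + (wscale W3 (- ?n - 1) (I w1 ?n 0 w2) + I w1 ?n 1 w2)"
        using I_L0[of w1 ?n 0 w2] by (simp add: algebra_simps)
      moreover have "?n + 1 = n1 + 1 + n2 - h - 1" by simp
      ultimately show "L0_fun (T n1 n2 w1 w2) h
          = (T n1 n2 (LW0 W1 w1) w2 + T n1 n2 w1 (LW0 W2 w2) + T (n1 + 1) n2 ?y w2) h"
        unfolding I_derivative_component[OF w] by (simp only: L0_fun_def T_def plus_fun_apply)
    qed
    also have "\<dots> \<in> T_span"
      using w L1.LW0_wgrade L2.LW0_wgrade L1.Wdec.comp_in
      by (intro Fn.subspace_add[OF subspace_T_span] T_in_T_span) auto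
    finally show ?thesis .
  qed
  then have "{T n1 n2 w1 w2 | n1 n2 w1 w2. w1 \<in> wgrade W1 n1 \<and> w2 \<in> wgrade W2 n2} \<subseteq> {F. L0_fun F \<in> T_span}"
    by blast
  moreover have "Fn.subspace {F. L0_fun F \<in> T_span}"
    by (rule Fn.subspaceI)
      (simp_all add: L0_fun.map_add L0_fun.map_scale Fn.subspace_0 Fn.subspace_add Fn.subspace_scale subspace_T_span)
  ultimately have "Fn.span {T n1 n2 w1 w2 | n1 n2 w1 w2. w1 \<in> wgrade W1 n1 \<and> w2 \<in> wgrade W2 n2} \<subseteq> {F. L0_fun F \<in> T_span}"
    by (rule Fn.span_minimal)
  then show ?thesis using F unfolding T_span_def[symmetric] by blast
qed

lemma T_span_wgrade: "F \<in> T_span \<Longrightarrow> F h \<in> wgrade W3 h"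
proof -
  have "T_span \<subseteq> {F. F h \<in> wgrade W3 h}"
    unfolding T_span_def
  proof (rule Fn.span_minimal)
    show "Fn.subspace {F. F h \<in> wgrade W3 h}"
      by (rule Fn.subspaceI)
        (auto simp: pointwise_scale_def M3.ws.subspace_0 M3.ws.subspace_add M3.ws.subspace_scale L3.subspace_wgrade)
  qed (auto intro: T_wgrade)
  then show "F \<in> T_span \<Longrightarrow> F h \<in> wgrade W3 h" by blast
qed

text \<open>A value of \<open>T\<close> may have infinitely many nonzero components, so a single
  component need not belong to \<open>T_span\<close>. Separation is possible up to families that
  vanish on a given finite set of weights.\<close>

definition agree :: "complex set \<Rightarrow> (complex \<Rightarrow> 'w3) set" where
  "agree H = {F. \<exists>G\<in>T_span. \<forall>h\<in>H. F h = G h}"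

lemma subspace_agree: "Fn.subspace (agree H)"
proof (rule Fn.subspaceI)
  show "0 \<in> agree H"
    using Fn.subspace_0[OF subspace_T_span] by (auto simp: agree_def intro!: bexI[of _ 0])
next
  fix F F' assume "F \<in> agree H" "F' \<in> agree H"
  then obtain G G' where "G \<in> T_span" "\<forall>h\<in>H. F h = G h" "G' \<in> T_span" "\<forall>h\<in>H. F' h = G' h"
    by (auto simp: agree_def)
  then show "F + F' \<in> agree H"
    unfolding agree_def using Fn.subspace_add[OF subspace_T_span] by (auto intro!: bexI[of _ "G + G'"])
next
  fix c F assume "F \<in> agree H"
  then obtain G where "G \<in> T_span" "\<forall>h\<in>H. F h = G h" by (auto simp: agree_def)
  then show "pscale c F \<in> agree H"
    unfolding agree_def using Fn.subspace_scale[OF subspace_T_span]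
    by (auto intro!: bexI[of _ "pscale c G"] simp: pointwise_scale_def)
qed

text \<open>On \<open>H\<close>, \<open>F\<close> is the sum of its one-weight restrictions. These
  are generalized eigenvectors of the pointwise L(0) for distinct eigenvalues, and
  \<open>agree H\<close> is stable under it, so \<open>geig_separation\<close> applies.\<close>

lemma restriction_in_agree:
  assumes F: "F \<in> T_span" and H: "finite H" "h \<in> H"
  shows "(\<lambda>h'. if h' = h then F h else 0) \<in> agree H"
proof (rule L0_fun.geig_separation[OF subspace_agree _ H(1), where lam = "\<lambda>h. h" and x = "\<lambda>h h'. if h' = h then F h else 0"])
  show "L0_fun G \<in> agree H" if G: "G \<in> agree H" for G
  proof -
    obtain G' where "G' \<in> T_span" "\<forall>h\<in>H. G h = G' h" using G by (auto simp: agree_def)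
    then show ?thesis unfolding agree_def using L0_fun_T_span by (auto intro!: bexI[of _ "L0_fun G'"] simp: L0_fun_def)
  qed
  show "(\<lambda>h'. if h' = k then F k else 0) \<in> geig (pscale) L0_fun k" if "k \<in> H" for k
  proof -
    have "F k \<in> geig (wscale W3) (LW0 W3) k" using T_span_wgrade[OF F] by (simp add: L3.wgrade_geig)
    then obtain K where K: "(M3.LW.shift k ^^ K) (F k) = 0" by (auto simp: geig_def)
    have "(L0_fun.shift k ^^ i) (\<lambda>h'. if h' = k then F k else 0)
        = (\<lambda>h'. if h' = k then (M3.LW.shift k ^^ i) (F k) else 0)" for i
      by (induction i) (auto simp: L0_fun_def pointwise_scale_def fun_eq_iff)
    from this[of K] have "(L0_fun.shift k ^^ K) (\<lambda>h'. if h' = k then F k else 0) = 0"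
      by (simp add: K fun_eq_iff)
    then show ?thesis unfolding geig_def by blast
  qed
  have "(\<Sum>h\<in>H. (\<lambda>h'. if h' = h then F h else 0)) k = F k" if "k \<in> H" for k
    using that H(1) by (simp add: sum_fun_apply)
  then show "(\<Sum>h\<in>H. (\<lambda>h'. if h' = h then F h else 0)) \<in> agree H"
    unfolding agree_def using F by blast
qed (use H(2) in auto)

text \<open>The derivative property expresses (k + 1) times the coefficient of (log x)^(k+1) through
  coefficients of (log x)^k, one of them for L(-1) w1. By induction the logarithm-free coefficients
  span, and the gradings reduce these to homogeneous vectors.\<close>

lemma I_span:
  "I w1 n k w2 \<in> M3.ws.span {I u1 m 0 u2 | u1 m u2 m1 m2. u1 \<in> wgrade W1 m1 \<and> u2 \<in> wgrade W2 m2}"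
  (is "_ \<in> M3.ws.span ?X")
proof (induction k arbitrary: w1 n w2)
  case 0
  have *: "I (L1.Wdec.comp w1 i) n 0 (L2.Wdec.comp w2 j) \<in> M3.ws.span ?X" for i j
    using L1.Wdec.comp_in[of i w1] L2.Wdec.comp_in[of j w2] by (intro M3.ws.span_base) blast
  have "I w1 n 0 w2 = (\<Sum>i | L1.Wdec.comp w1 i \<noteq> 0. I (L1.Wdec.comp w1 i) n 0 w2)"
    by (subst L1.Wdec.sum_comp[of w1, symmetric]) (rule I_left.sum)
  also have "\<dots> = (\<Sum>i | L1.Wdec.comp w1 i \<noteq> 0. \<Sum>j | L2.Wdec.comp w2 j \<noteq> 0.
      I (L1.Wdec.comp w1 i) n 0 (L2.Wdec.comp w2 j))"
    by (subst L2.Wdec.sum_comp[of w2, symmetric]) (simp only: I_right.sum)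
  also have "\<dots> \<in> M3.ws.span ?X" using * by (intro M3.ws.span_sum)
  finally show ?case .
next
  case (Suc k)
  have "wscale W3 (of_nat (k + 1)) (I w1 n (Suc k) w2)
      = I (LW_neg1 W1 w1) (n + 1) k w2 - wscale W3 (- n - 1) (I w1 n k w2)"
    using I_derivative[of n w1 k w2] by (simp add: algebra_simps)
  also have "\<dots> \<in> M3.ws.span ?X" using Suc by (intro M3.ws.span_diff M3.ws.span_scale)
  finally show ?case
    by (rule M3.ws.subspace_scaleD[OF M3.ws.subspace_span]) (simp del: of_nat_Suc)
qed

lemma components_in_agree:
  assumes surj: "surjective_operator (wscale W3) I" and H: "finite H"
  shows "(\<lambda>h. if h \<in> H then L3.Wdec.comp b h else 0) \<in> agree H"
proof -
  let ?X = "{I u1 m 0 u2 | u1 m u2 m1 m2. u1 \<in> wgrade W1 m1 \<and> u2 \<in> wgrade W2 m2}"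
  let ?R = "\<lambda>b h. if h \<in> H then L3.Wdec.comp b h else 0"
  have "M3.ws.span {I w1 n k w2 | w1 n k w2. True} \<subseteq> M3.ws.span ?X"
    by (rule M3.ws.span_minimal) (use I_span in auto)
  then have "b \<in> M3.ws.span ?X" using surj by (auto simp: surjective_operator_def)
  then show ?thesis
  proof (induction rule: M3.ws.span_induct_alt)
    case base
    have "?R 0 = 0" by (auto simp: fun_eq_iff)
    then show ?case using Fn.subspace_0[OF subspace_agree] by simp
  next
    case (step c x y)
    then obtain u1 m u2 m1 m2 where x: "x = I u1 m 0 u2" "u1 \<in> wgrade W1 m1" "u2 \<in> wgrade W2 m2"
      by blast
    let ?h = "m1 + m2 - m - 1"
    have "x = T m1 m2 u1 u2 ?h" by (simp add: T_def x(1))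
    moreover have "L3.Wdec.comp x = (\<lambda>j. if j = ?h then x else 0)"
      using I_wgrade[OF x(2,3)] x(1) by (intro L3.Wdec.comp_of_summand) auto
    ultimately have Rx: "?R x = (if ?h \<in> H then (\<lambda>h'. if h' = ?h then T m1 m2 u1 u2 ?h else 0) else 0)"
      by (auto simp: fun_eq_iff)
    have "?R x \<in> agree H"
    proof (cases "?h \<in> H")
      case True
      then show ?thesis
        unfolding Rx using restriction_in_agree[OF T_in_T_span[OF x(2,3)] H True] by simp
    next
      case False
      then show ?thesis unfolding Rx using Fn.subspace_0[OF subspace_agree] by simp
    qed
    moreover have "?R (wscale W3 c x + y) = pscale c (?R x) + ?R y"
      by (auto simp: fun_eq_iff pointwise_scale_def L3.Wdec.comp_add L3.Wdec.comp_scale)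
    ultimately show ?case
      using step.IH by (simp only:) (intro Fn.subspace_add Fn.subspace_scale subspace_agree)
  qed
qed

text \<open>Each \<open>b\<close> in an independent set modulo the subspace is matched on the
  finitely many weights involved by some \<open>G b\<close> in \<open>T_span\<close>, written as a
  family in \<open>C_valued t\<close> plus \<open>y b\<close> in the span of \<open>X\<close>. A
  relation among the \<open>y b\<close>, read at these weights, becomes a relation among the
  \<open>b\<close> modulo the subspace. So the \<open>y b\<close> are independent, which bounds
  their number by \<open>card X\<close>.\<close>

lemma quotient_dim_bound:
  assumes surj: "surjective_operator (wscale W3) I" and t: "t = min p q"
    and X: "finite X" and T_span: "T_span \<subseteq> Fn.span (C_valued t \<union> X)"
  shows "quotient_dim (wscale W3) (C_subspace V (g1 \<circ> g2) W3 t) \<le> enat (card X)"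
  unfolding quotient_dim_def
proof (rule SUP_least)
  let ?C = "C_subspace V (g1 \<circ> g2) W3 t"
  fix E assume "E \<in> {B. finite B \<and> (\<forall>c. (\<Sum>b\<in>B. wscale W3 (c b) b) \<in> ?C \<longrightarrow> (\<forall>b\<in>B. c b = 0))}"
  then have E: "finite E" "\<And>c b. (\<Sum>b\<in>E. wscale W3 (c b) b) \<in> ?C \<Longrightarrow> b \<in> E \<Longrightarrow> c b = 0" by auto
  define H where "H = (\<Union>b\<in>E. {h. L3.Wdec.comp b h \<noteq> 0})"
  have H: "finite H" unfolding H_def using E(1) L3.Wdec.finite_comp by auto
  have "\<exists>G\<in>T_span. \<forall>h\<in>H. L3.Wdec.comp b h = G h" for b
    using components_in_agree[OF surj H, of b] by (auto simp: agree_def)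
  then obtain G where G: "\<And>b. G b \<in> T_span" "\<And>b h. h \<in> H \<Longrightarrow> L3.Wdec.comp b h = G b h" by metis
  have "\<exists>x y. G b = x + y \<and> x \<in> C_valued t \<and> y \<in> Fn.span X" for b
  proof -
    have "G b \<in> Fn.span (C_valued t \<union> X)" using G(1) T_span by blast
    then show ?thesis
      unfolding Fn.span_Un using Fn.span_eq_iff[THEN iffD2, OF subspace_C_valued] by auto
  qed
  then obtain x y where xy: "\<And>b. G b = x b + y b" "\<And>b. x b \<in> C_valued t" "\<And>b. y b \<in> Fn.span X" by metis
  have "card E \<le> card X"
  proof (rule Fn.card_le_of_independent_family[OF E(1) X xy(3)])
    fix c b assume c: "(\<Sum>b\<in>E. pscale (c b) (y b)) = 0" and b: "b \<in> E"
    have comp_in: "(\<Sum>b\<in>E. wscale W3 (c b) (L3.Wdec.comp b h)) \<in> ?C" if h: "h \<in> H" for h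
    proof -
      have "(\<Sum>b\<in>E. pscale (c b) (y b)) h = 0" unfolding c by simp
      then have "(\<Sum>b\<in>E. wscale W3 (c b) (y b h)) = 0" by (simp add: sum_fun_apply pointwise_scale_def)
      then have "(\<Sum>b\<in>E. wscale W3 (c b) (L3.Wdec.comp b h)) = (\<Sum>b\<in>E. wscale W3 (c b) (x b h))"
        by (simp add: G(2)[OF h] xy(1) M3.ws.scale_right_distrib sum.distrib)
      also have "\<dots> \<in> ?C"
        using xy(2) by (intro M3.ws.subspace_sum M3.ws.subspace_scale subspace_C3) (auto simp: C_valued_def)
      finally show ?thesis .
    qed
    have "(\<Sum>b\<in>E. wscale W3 (c b) b) = (\<Sum>b\<in>E. wscale W3 (c b) (\<Sum>h\<in>H. L3.Wdec.comp b h))"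
      by (intro sum.cong refl arg_cong2[of _ _ _ _ "wscale W3"] L3.Wdec.sum_comp_superset[symmetric] H)
        (auto simp: H_def)
    also have "\<dots> = (\<Sum>h\<in>H. \<Sum>b\<in>E. wscale W3 (c b) (L3.Wdec.comp b h))"
      unfolding M3.ws.scale_sum_right by (rule sum.swap)
    also have "\<dots> \<in> ?C" by (rule M3.ws.subspace_sum[OF subspace_C3 comp_in])
    finally show "c b = 0" using E(2) b by blast
  qed
  then show "enat (card E) \<le> enat (card X)" by simp
qed

lemma quotient_dim_product:
  assumes surj: "surjective_operator (wscale W3) I" and p: "2 \<le> p" and q: "2 \<le> q"
  shows "quotient_dim (wscale W3) (C_subspace V (g1 \<circ> g2) W3 (min p q))
    \<le> quotient_dim (wscale W1) (C_subspace V g1 W1 p) * quotient_dim (wscale W2) (C_subspace V g2 W2 q)"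
    (is "?d3 \<le> ?d1 * ?d2")
proof (cases "?d1 * ?d2 = \<infinity>")
  case False
  obtain A wt1 where A: "\<And>n. wgrade W1 n \<subseteq> M1.ws.span ({a \<in> A. wt1 a = n} \<union> homogeneous_generators V g1 g2 W1 p n)"
    "\<And>a. a \<in> A \<Longrightarrow> a \<in> wgrade W1 (wt1 a)"
    "\<And>F. finite F \<Longrightarrow> F \<subseteq> A \<Longrightarrow> enat (card F) \<le> ?d1"
  proof (rule L1.Wdec.homogeneous_basis[of "homogeneous_generators V g1 g2 W1 p"], goal_cases)
    case (1 n)
    show ?case by (rule L1.homogeneous_generators_wgrade)
  next
    case (2 C wt)
    show ?case
      by (rule that[of C wt])
        (use 2(2-) in \<open>simp_all add: L1.C_subspace_homogeneous[OF commuting_automorphisms_axioms]\<close>)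
  qed
  have comm: "commuting_automorphisms V g2 g1"
    by (intro commuting_automorphisms.intro M1.vertex_algebra_automorphism_axioms
      M2.vertex_algebra_automorphism_axioms commuting_automorphisms_axioms.intro commuting[symmetric])
  obtain B wt2 where B: "\<And>n. wgrade W2 n \<subseteq> M2.ws.span ({b \<in> B. wt2 b = n} \<union> homogeneous_generators V g2 g1 W2 q n)"
    "\<And>b. b \<in> B \<Longrightarrow> b \<in> wgrade W2 (wt2 b)"
    "\<And>F. finite F \<Longrightarrow> F \<subseteq> B \<Longrightarrow> enat (card F) \<le> ?d2"
  proof (rule L2.Wdec.homogeneous_basis[of "homogeneous_generators V g2 g1 W2 q"], goal_cases)
    case (1 n)
    show ?case by (rule L2.homogeneous_generators_wgrade)
  next
    case (2 C wt)
    show ?case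
      by (rule that[of C wt])
        (use 2(2-) in \<open>simp_all add: L2.C_subspace_homogeneous[OF comm]\<close>)
  qed
  have AB: "finite (A \<times> B)" "enat (card (A \<times> B)) \<le> ?d1 * ?d2"
    using finite_bases_product[OF A(3) B(3) False] by auto
  let ?X = "(\<lambda>(a, b). T (wt1 a) (wt2 b) a b) ` (A \<times> B)"
  have "T n1 n2 w1 w2 \<in> Fn.span (C_valued (min p q) \<union> ?X)"
    if w: "w1 \<in> wgrade W1 n1" "w2 \<in> wgrade W2 n2" for n1 n2 w1 w2
  proof (rule T_in_subspace[OF p q Fn.subspace_span _ A(1) B(1) A(2) B(2) _ w])
    show "C_valued (min p q) \<subseteq> Fn.span (C_valued (min p q) \<union> ?X)" by (auto intro: Fn.span_base)
    show "T (wt1 a) (wt2 b) a b \<in> Fn.span (C_valued (min p q) \<union> ?X)" if "a \<in> A" "b \<in> B" for a b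
      using that by (intro Fn.span_base) auto
  qed
  then have "T_span \<subseteq> Fn.span (C_valued (min p q) \<union> ?X)"
    unfolding T_span_def by (intro Fn.span_minimal) auto
  then have "?d3 \<le> enat (card ?X)"
    using AB(1) by (intro quotient_dim_bound[OF surj refl]) auto
  also have "\<dots> \<le> enat (card (A \<times> B))" using card_image_le[OF AB(1)] by simp
  also have "\<dots> \<le> ?d1 * ?d2" by (rule AB(2))
  finally show ?thesis .
qed simp

end


theorem theorem4p1:
  fixes V :: "'v::ab_group_add vertex_algebra"
    and g1 g2 :: "'v \<Rightarrow> 'v"
    and W1 :: "('v, 'w1::ab_group_add) graded_twisted_module"
    and W2 :: "('v, 'w2::ab_group_add) graded_twisted_module"
    and W3 :: "('v, 'w3::ab_group_add) graded_twisted_module"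
    and p q :: int
  assumes "grading_restricted_vertex_algebra V"
    and "vertex_algebra_automorphism V g1"
    and "vertex_algebra_automorphism V g2"
    and "g1 \<circ> g2 = g2 \<circ> g1"
    and "lower_bounded_generalized_twisted_module V g1 W1"
    and "lower_bounded_generalized_twisted_module V g2 W2"
    and "generalized_surjective_product V g1 g2 W1 W2 W3"
    and "p \<ge> 2"
    and "q \<ge> 2"
  shows "quotient_dim (wscale W3) (C_subspace V (g1 \<circ> g2) W3 (min p q))
    \<le> quotient_dim (wscale W1) (C_subspace V g1 W1 p)
      * quotient_dim (wscale W2) (C_subspace V g2 W2 q)"
proof -
  obtain I where I: "twisted_intertwining_operator V g1 g2 W1 W2 W3 I" "surjective_operator (wscale W3) I"
    and W3: "generalized_twisted_module V (g1 \<circ> g2) W3"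
    using assms(7) by (auto simp: generalized_surjective_product_def)
  interpret graded_product V g1 g2 W1 W2 W3 I
    by (intro graded_product.intro graded_product_axioms.intro I(1) assms(5,6) W3)
  show ?thesis by (rule quotient_dim_product[OF I(2) assms(8,9)])
qed


end
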